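(* Let $X$ be a Banach space with the compact approximation property and let $N \in \mathbb{N}$. If $\mathcal{P}(^N X) = \mathrm{NRA}(^N X)$ (that is, every $N$-homogeneous polynomial from $X$ into $X$ attains its numerical radius), then $X$ is finite dimensional.
   Context: Banach spaces are over $\mathbb{K}=\mathbb{R}$ or $\mathbb{C}$. $S_X$ is the unit sphere of $X$, and $\Pi(X) = \{(x,x^* ) \in S_X \times S_{X^*} : x^*(x)=1\}$. $\mathcal{P}(^N X)$ is the Banach space of (continuous) $N$-homogeneous polynomials from $X$ into $X$, with norm $\|P\|=\sup_{\|x\|\le 1}\|P(x)\|$. The numerical radius of $P \in \mathcal{P}(^N X)$ is $\nu(P) = \sup\{|x^*(P(x))| : (x,x^* ) \in \Pi(X)\}$; $P$ attains its numerical radius if $\nu(P) = |x^*(P(x))|$ for some $(x,x^* ) \in \Pi(X)$; and $\mathrm{NRA}(^N X)$ is the set of all $P\in\mathcal{P}(^N X)$ attaining their numerical radius. $X$ has the compact approximation property if for every compact set $K \subseteq X$ and every $\varepsilon>0$ there is a compact linear operator $T : X \to X$ with $\|T(x)-x\| \leq \varepsilon$ for all $x \in K$. *)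

theory Defs
  imports "HOL-Analysis.Analysis"
begin

text \<open>
  A normed space over a scalar field \<open>'k\<close> (used with \<open>real\<close> and \<open>complex\<close>): scalar multiplication by
  \<open>'k\<close> is given by \<open>smul\<close>, and the underlying real normed space of the type class is the one
  obtained by restriction of scalars.  Completeness comes from the class \<open>banach\<close> on \<open>'a\<close>.
\<close>

locale normed_space_over = vector_space smul
  for smul :: "'k::real_normed_field \<Rightarrow> 'a::real_normed_vector \<Rightarrow> 'a" +
  assumes norm_smul: "norm (smul c x) = norm c * norm x"
    and smul_of_real: "smul (of_real r) x = r *\<^sub>R x"

lemma normed_space_over_scaleR:
  "normed_space_over ((*\<^sub>R) :: real \<Rightarrow> 'a::real_normed_vector \<Rightarrow> 'a)"
  by unfold_locales (simp_all add: algebra_simps)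

lemma normed_space_over_mult:
  "normed_space_over ((*) :: 'k::real_normed_field \<Rightarrow> 'k \<Rightarrow> 'k)"
  by unfold_locales (simp_all add: algebra_simps norm_mult scaleR_conv_of_real)

definition dual_space ::
    "('k::real_normed_field \<Rightarrow> 'a::real_normed_vector \<Rightarrow> 'a) \<Rightarrow> ('a \<Rightarrow> 'k) set"
  where "dual_space smul = {f. Vector_Spaces.linear smul (*) f \<and> bounded_linear f}"

definition state_pairs ::
    "('k::real_normed_field \<Rightarrow> 'a::real_normed_vector \<Rightarrow> 'a) \<Rightarrow> ('a \<times> ('a \<Rightarrow> 'k)) set"
  where "state_pairs smul =
    {(x, f). norm x = 1 \<and> f \<in> dual_space smul \<and> onorm f = 1 \<and> f x = 1}"

text \<open>\<open>N\<close>-linear maps act on lists of length \<open>N\<close>; their values on other lists are irrelevant.\<close>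

definition multilinear_map ::
    "('k::field \<Rightarrow> 'a::ab_group_add \<Rightarrow> 'a) \<Rightarrow> nat \<Rightarrow> ('a list \<Rightarrow> 'a) \<Rightarrow> bool"
  where "multilinear_map smul N A \<longleftrightarrow>
    (\<forall>xs i. length xs = N \<longrightarrow> i < N \<longrightarrow> Vector_Spaces.linear smul smul (\<lambda>y. A (xs[i := y])))"

definition homogeneous_polynomials ::
    "('k::real_normed_field \<Rightarrow> 'a::real_normed_vector \<Rightarrow> 'a) \<Rightarrow> nat \<Rightarrow> ('a \<Rightarrow> 'a) set"
  where "homogeneous_polynomials smul N =
    {P. continuous_on UNIV P \<and>
        (\<exists>A. multilinear_map smul N A \<and> (\<forall>x. P x = A (replicate N x)))}"

definition numerical_radius ::
    "('k::real_normed_field \<Rightarrow> 'a::real_normed_vector \<Rightarrow> 'a) \<Rightarrow> ('a \<Rightarrow> 'a) \<Rightarrow> real"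
  where "numerical_radius smul P = (SUP (x, f) \<in> state_pairs smul. norm (f (P x)))"

definition NRA ::
    "('k::real_normed_field \<Rightarrow> 'a::real_normed_vector \<Rightarrow> 'a) \<Rightarrow> nat \<Rightarrow> ('a \<Rightarrow> 'a) set"
  where "NRA smul N =
    {P \<in> homogeneous_polynomials smul N.
       \<exists>(x, f) \<in> state_pairs smul. numerical_radius smul P = norm (f (P x))}"

definition compact_operator ::
    "('k::real_normed_field \<Rightarrow> 'a::real_normed_vector \<Rightarrow> 'a) \<Rightarrow> ('a \<Rightarrow> 'a) \<Rightarrow> bool"
  where "compact_operator smul T \<longleftrightarrow>
    Vector_Spaces.linear smul smul T \<and> compact (closure (T ` cball 0 1))"

definition compact_approximation_property ::
    "('k::real_normed_field \<Rightarrow> 'a::real_normed_vector \<Rightarrow> 'a) \<Rightarrow> bool"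
  where "compact_approximation_property smul \<longleftrightarrow>
    (\<forall>K \<epsilon>. compact K \<longrightarrow> 0 < \<epsilon> \<longrightarrow>
       (\<exists>T. compact_operator smul T \<and> (\<forall>x\<in>K. norm (T x - x) \<le> \<epsilon>)))"

end

theory Submission imports Defs "HOL-Library.Diagonal_Subsequence" begin

text \<open>
  Suppose that every \<open>N\<close>-homogeneous polynomial attains its numerical radius and that \<open>X\<close> is infinite
  dimensional.  Fix a state \<open>(x0, f)\<close>.  Only the polynomials \<open>P x = f(x)^(N-1) T x\<close> with \<open>T\<close> a bounded linear
  operator are needed.  The number \<open>s (P u)\<close> is linear in \<open>T\<close>, so the hypothesis says that every
  operator attains its supremum over the family \<open>num_funs\<close> of the functionals
  \<open>T \<mapsto> re (\<omega> f(u)^(N-1) s (T u))\<close>, where \<open>|\<omega>| = 1\<close> and \<open>(u, s)\<close> is a state.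

  Such attainment is the hypothesis of a compactness theorem in the style of James
  (\<open>james_attainment\<close>): let \<open>S\<close> be a closed space of operators on which every element attains its supremum
  over a bounded symmetric set \<open>D\<close> of functionals, and in which bounded sequences have weak cluster
  points, tested against \<open>D\<close>.  Then every linear functional dominated by the supremum over \<open>D\<close> is a norm limit, on \<open>S\<close>, of
  linear combinations of members of \<open>D\<close>.  The theorem is used twice.

  First let \<open>S\<close> consist of the operators \<open>g(_) x0\<close>, a copy of the dual.  The supremum over \<open>num_funs\<close>
  is then equivalent to the norm of \<open>g\<close>, and the members of \<open>num_funs\<close> become evaluations at points of \<open>X\<close>;
  hence every functional on the dual is an evaluation, that is, \<open>X\<close> is reflexive (\<open>reflexive\<close>).

  Next let \<open>S\<close> consist of all bounded linear operators; cluster points exist now because \<open>X\<close> is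
  reflexive.  Let \<open>Q\<close> be the projection onto the kernel of \<open>f\<close> along \<open>x0\<close>.  For every compact \<open>K\<close>, the
  supremum of \<open>num_funs\<close> at \<open>Q - K Q\<close> is at least a fixed \<open>c > 0\<close>
  (\<open>identity_not_near_compact\<close>), because a compact operator nearly annihilates some unit vector of that
  kernel.  By Hahn-Banach some functional dominated by that supremum is at least \<open>c\<close> at all these
  operators.  By \<open>james_attainment\<close> it is a limit of finite sums of the functionals \<open>T \<mapsto> h (T x)\<close>, and
  reflexivity turns this into a bound by the supremum of \<open>T\<close> over some compact set
  (\<open>nuclear_continuity\<close>).  The compact approximation property makes \<open>Q - K Q\<close> small on any given compact
  set, which is a contradiction.

  The real and the complex case are treated together: the locale \<open>scalar_banach\<close> abstracts the real part
  of a scalar.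
\<close>

section \<open>The Hahn-Banach theorem in the form of Mazur and Orlicz\<close>

definition sublinear :: "('a::real_vector \<Rightarrow> real) \<Rightarrow> bool"
  where "sublinear p \<longleftrightarrow> (\<forall>x y. p (x + y) \<le> p x + p y) \<and> (\<forall>t\<ge>0. \<forall>x. p (t *\<^sub>R x) = t * p x)"

lemma sublinear_add: "sublinear p \<Longrightarrow> p (x + y) \<le> p x + p y"
  and sublinear_scaleR: "sublinear p \<Longrightarrow> 0 \<le> t \<Longrightarrow> p (t *\<^sub>R x) = t * p x"
  by (auto simp: sublinear_def)

lemma sublinear_zero: "sublinear p \<Longrightarrow> p 0 = 0"
  using sublinear_scaleR[of p 0 0] by simp

lemma sublinear_minus: "sublinear p \<Longrightarrow> - p (- x) \<le> p x"
  using sublinear_add[of p x "- x"] sublinear_zero[of p] by simp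

lemma sublinearI:
  assumes "\<And>x y. p (x + y) \<le> p x + p y" and "\<And>t x. 0 < t \<Longrightarrow> p (t *\<^sub>R x) \<le> t * p x" and "p 0 = 0"
  shows "sublinear p"
  unfolding sublinear_def
proof (intro conjI allI impI)
  fix t :: real and x assume "0 \<le> t"
  show "p (t *\<^sub>R x) = t * p x"
  proof (cases "t = 0")
    case False
    with \<open>0 \<le> t\<close> have t: "0 < t" by simp
    have "p x = p ((1 / t) *\<^sub>R (t *\<^sub>R x))" using t by simp
    also have "\<dots> \<le> (1 / t) * p (t *\<^sub>R x)" using assms(2)[of "1 / t" "t *\<^sub>R x"] t by simp
    finally have "t * p x \<le> p (t *\<^sub>R x)" using t by (simp add: field_simps)
    with assms(2)[OF t, of x] show ?thesis by simp
  qed (use assms(3) in simp)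
qed (use assms in auto)

text \<open>
  Taking the infimum of \<open>p (x + t c) - t a\<close> over the cone generated by \<open>C\<close> pushes \<open>p\<close> down as far as is
  compatible with the value \<open>a\<close> on \<open>C\<close>.  A linear functional below the result is automatically at
  least \<open>a\<close> on \<open>C\<close>.
\<close>

lemma sublinear_infimum_along_cone:
  assumes p: "sublinear p" and C: "convex C" "C \<noteq> {}" and a: "\<And>c. c \<in> C \<Longrightarrow> a \<le> p c"
  obtains q where "sublinear q" "\<And>x. q x \<le> p x" "\<And>c. c \<in> C \<Longrightarrow> q (- c) \<le> - a"
proof -
  define A where "A x = {p (x + t *\<^sub>R c) - t * a | t c. 0 \<le> t \<and> c \<in> C}" for x
  define q where "q x = Inf (A x)" for x
  have ne: "A x \<noteq> {}" for x using C(2) unfolding A_def by (auto intro: exI[of _ 0])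
  have lb: "- p (- x) \<le> r" if "r \<in> A x" for r x
  proof -
    from that obtain t c where tc: "0 \<le> t" "c \<in> C" "r = p (x + t *\<^sub>R c) - t * a"
      by (auto simp: A_def)
    have "t * a \<le> p (t *\<^sub>R c)"
      using a[OF tc(2)] tc(1) by (simp add: sublinear_scaleR[OF p] mult_left_mono)
    also have "\<dots> \<le> p (- x) + p (x + t *\<^sub>R c)" using sublinear_add[OF p, of "- x" "x + t *\<^sub>R c"] by simp
    finally show ?thesis using tc(3) by simp
  qed
  have bdd: "bdd_below (A x)" for x using lb by (meson bdd_belowI)
  have le: "q x \<le> p (x + t *\<^sub>R c) - t * a" if "0 \<le> t" "c \<in> C" for x t c
    unfolding q_def by (rule cInf_lower[OF _ bdd]) (use that in \<open>auto simp: A_def\<close>)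
  have near: "\<exists>t c. 0 \<le> t \<and> c \<in> C \<and> p (x + t *\<^sub>R c) - t * a < q x + e" if "0 < e" for x e
  proof -
    have "\<exists>r\<in>A x. r < q x + e"
      using cInf_less_iff[OF ne bdd, of x "q x + e"] that by (simp add: q_def)
    then show ?thesis by (auto simp: A_def)
  qed
  have qp: "q x \<le> p x" for x using le[of 0 _ x] C(2) by auto
  have add: "q (x + y) \<le> q x + q y" for x y
  proof (rule field_le_epsilon)
    fix e :: real assume e: "0 < e"
    obtain t c where tc: "0 \<le> t" "c \<in> C" "p (x + t *\<^sub>R c) - t * a < q x + e/2"
      using near[of "e/2" x] e by auto
    obtain s d where sd: "0 \<le> s" "d \<in> C" "p (y + s *\<^sub>R d) - s * a < q y + e/2"
      using near[of "e/2" y] e by auto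
    have "\<exists>b\<in>C. t *\<^sub>R c + s *\<^sub>R d = (t + s) *\<^sub>R b"
    proof (cases "t + s = 0")
      case True
      then show ?thesis using tc sd by (auto simp: add_nonneg_eq_0_iff)
    next
      case False
      have "(t / (t + s)) *\<^sub>R c + (s / (t + s)) *\<^sub>R d \<in> C"
        using C(1) tc sd False by (intro convexD) (auto simp: add_divide_distrib[symmetric])
      moreover have "t *\<^sub>R c + s *\<^sub>R d = (t + s) *\<^sub>R ((t / (t + s)) *\<^sub>R c + (s / (t + s)) *\<^sub>R d)"
        using False by (simp add: scaleR_add_right)
      ultimately show ?thesis by blast
    qed
    then obtain b where b: "b \<in> C" "t *\<^sub>R c + s *\<^sub>R d = (t + s) *\<^sub>R b" by blast
    have "q (x + y) \<le> p (x + y + (t + s) *\<^sub>R b) - (t + s) * a" using le[of "t+s" b "x+y"] b tc sd by simp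
    also have "x + y + (t + s) *\<^sub>R b = (x + t *\<^sub>R c) + (y + s *\<^sub>R d)"
      unfolding b(2)[symmetric] by (simp add: algebra_simps)
    also have "p \<dots> \<le> p (x + t *\<^sub>R c) + p (y + s *\<^sub>R d)" by (rule sublinear_add[OF p])
    finally show "q (x + y) \<le> q x + q y + e" using tc(3) sd(3) by (simp add: algebra_simps)
  qed
  have scale: "q (t *\<^sub>R x) \<le> t * q x" if t: "0 < t" for t x
  proof (rule field_le_epsilon)
    fix e :: real assume e: "0 < e"
    then have "0 < e / t" using t by simp
    then obtain s c where sc: "0 \<le> s" "c \<in> C" "p (x + s *\<^sub>R c) - s * a < q x + e / t" using near by blast
    have "q (t *\<^sub>R x) \<le> p (t *\<^sub>R x + (t * s) *\<^sub>R c) - (t * s) * a" using le sc t by simp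
    also have "t *\<^sub>R x + (t * s) *\<^sub>R c = t *\<^sub>R (x + s *\<^sub>R c)" by (simp add: algebra_simps)
    also have "p \<dots> - (t * s) * a = t * (p (x + s *\<^sub>R c) - s * a)"
      using t sublinear_scaleR[OF p, of t "x + s *\<^sub>R c"] by (simp add: right_diff_distrib)
    also have "\<dots> \<le> t * (q x + e / t)" using sc t by (intro mult_left_mono) auto
    also have "\<dots> = t * q x + e" using t by (simp add: field_simps)
    finally show "q (t *\<^sub>R x) \<le> t * q x + e" .
  qed
  have "0 \<le> q 0"
    unfolding q_def using ne lb[of _ 0] sublinear_zero[OF p] by (intro cInf_greatest) auto
  then have "q 0 = 0" using qp[of 0] sublinear_zero[OF p] by simp
  then have "sublinear q" using add scale by (intro sublinearI)
  moreover have "q (- c) \<le> - a" if "c \<in> C" for c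
    using le[of 1 c "- c"] that sublinear_zero[OF p] by simp
  ultimately show ?thesis using that qp by blast
qed

lemma exists_minimal_sublinear:
  assumes p: "sublinear p"
  obtains q where "sublinear q" "q \<le> p" "\<And>r. sublinear r \<Longrightarrow> r \<le> q \<Longrightarrow> r = q"
proof -
  define A where "A = {q. sublinear q \<and> q \<le> p}"
  define P where "P = (\<lambda>f g :: 'a \<Rightarrow> real. g \<le> f)"
  have "\<exists>m\<in>A. \<forall>a\<in>A. P m a \<longrightarrow> a = m"
  proof (rule predicate_Zorn)
    show "partial_order_on A (relation_of P A)"
      by (auto simp: partial_order_on_def preorder_on_def refl_on_def trans_def antisym_def relation_of_def P_def)
    fix C assume C: "C \<in> Chains (relation_of P A)"
    then have CA: "C \<subseteq> A" by (rule Chains_relation_of)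
    have ch: "f \<le> g \<or> g \<le> f" if "f \<in> C" "g \<in> C" for f g
      using C that unfolding Chains_def relation_of_def P_def by blast
    show "\<exists>u\<in>A. \<forall>a\<in>C. P a u"
    proof (cases "C = {}")
      case True then show ?thesis using p by (auto simp: A_def)
    next
      case False
      define u where "u x = Inf ((\<lambda>f. f x) ` C)" for x
      have lb: "- p (- x) \<le> f x" if "f \<in> C" for f x
      proof -
        have "sublinear f" "f \<le> p" using that CA by (auto simp: A_def)
        then show ?thesis using sublinear_minus[of f "- x"] le_funD[of f p "- x"] by simp
      qed
      then have bdd: "bdd_below ((\<lambda>f. f x) ` C)" for x by (intro bdd_belowI) auto
      have le: "u x \<le> f x" if "f \<in> C" for f x
        unfolding u_def using that by (intro cInf_lower bdd) auto
      have near: "\<exists>f\<in>C. f x < u x + e" if "0 < e" for x e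
        using cInf_less_iff[OF _ bdd, of x "u x + e"] that False by (auto simp: u_def)
      have "sublinear u"
      proof (rule sublinearI)
        fix x y show "u (x + y) \<le> u x + u y"
        proof (rule field_le_epsilon)
          fix e :: real assume e: "0 < e"
          obtain f g where f: "f \<in> C" "f x < u x + e/2" and g: "g \<in> C" "g y < u y + e/2"
            using near[of "e/2"] e by (meson half_gt_zero)
          obtain h where h: "h \<in> C" "h \<le> f" "h \<le> g" using ch[OF f(1) g(1)] f g by auto
          have "u (x + y) \<le> h (x + y)" by (rule le[OF h(1)])
          also have "\<dots> \<le> h x + h y" using h CA by (auto simp: A_def intro: sublinear_add)
          also have "\<dots> \<le> f x + g y" using h by (auto simp: le_fun_def intro: add_mono)
          finally show "u (x + y) \<le> u x + u y + e" using f g by simp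
        qed
      next
        fix t :: real and x assume t: "0 < t"
        show "u (t *\<^sub>R x) \<le> t * u x"
        proof (rule field_le_epsilon)
          fix e :: real assume e: "0 < e"
          then obtain f where f: "f \<in> C" "f x < u x + e / t" using near[of "e/t" x] t by auto
          have "u (t *\<^sub>R x) \<le> f (t *\<^sub>R x)" by (rule le[OF f(1)])
          also have "\<dots> = t * f x" using f CA t by (auto simp: A_def sublinear_scaleR)
          also have "\<dots> \<le> t * (u x + e / t)" using f t by (intro mult_left_mono) auto
          also have "\<dots> = t * u x + e" using t by (simp add: field_simps)
          finally show "u (t *\<^sub>R x) \<le> t * u x + e" .
        qed
      next
        have "f 0 = 0" if "f \<in> C" for f using that CA by (auto simp: A_def sublinear_zero)
        then have "(\<lambda>f. f 0) ` C = {0}" using False by force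
        then show "u 0 = 0" by (simp add: u_def)
      qed
      moreover have "u \<le> p"
      proof -
        obtain f where f: "f \<in> C" using False by auto
        then have "u \<le> f" by (auto simp: le_fun_def le)
        also have "f \<le> p" using f CA by (auto simp: A_def)
        finally show ?thesis .
      qed
      ultimately show ?thesis using le by (auto simp: A_def P_def le_fun_def)
    qed
  qed
  then obtain m where m: "m \<in> A" "\<forall>a\<in>A. P m a \<longrightarrow> a = m" by blast
  show ?thesis
    by (rule that[of m]) (use m in \<open>auto simp: A_def P_def intro: order_trans\<close>)
qed

text \<open>
  If \<open>q\<close> is minimal, then lowering it along a single ray through \<open>c\<close> changes nothing, which forces
  \<open>q (- c) = - q c\<close>; an odd sublinear functional is linear.
\<close>

lemma linear_if_minimal_sublinear:
  assumes q: "sublinear q" and min: "\<And>r. sublinear r \<Longrightarrow> r \<le> q \<Longrightarrow> r = q"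
  shows "linear q"
proof -
  have neg: "q (- c) = - q c" for c
  proof -
    obtain r where r: "sublinear r" "\<And>x. r x \<le> q x" "r (- c) \<le> - q c"
      using sublinear_infimum_along_cone[OF q, of "{c}" "q c"] by auto
    then have "r = q" by (intro min) (auto simp: le_fun_def)
    with r(3) have "q (- c) \<le> - q c" by simp
    with sublinear_minus[OF q, of c] show ?thesis by simp
  qed
  show ?thesis
  proof (rule linearI)
    fix x y
    have "q x \<le> q (x + y) + q (- y)" using sublinear_add[OF q, of "x + y" "- y"] by simp
    then show "q (x + y) = q x + q y" using sublinear_add[OF q, of x y] neg by simp
  next
    fix t :: real and x
    show "q (t *\<^sub>R x) = t *\<^sub>R q x"
      using sublinear_scaleR[OF q, of t x] sublinear_scaleR[OF q, of "- t" x] neg[of "t *\<^sub>R x"]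
      by (cases "0 \<le> t") auto
  qed
qed

text \<open>
  All separation arguments below are instances of this statement: for a singleton \<open>C\<close> it gives norming
  functionals, and for a subspace \<open>C\<close> with \<open>a = 0\<close> it gives functionals that vanish on \<open>C\<close>.
\<close>

theorem mazur_orlicz:
  assumes p: "sublinear p" and C: "convex C" and a: "\<And>c. c \<in> C \<Longrightarrow> a \<le> p c"
  obtains F where "linear F" "\<And>x. F x \<le> p x" "\<And>c. c \<in> C \<Longrightarrow> a \<le> F c"
proof (cases "C = {}")
  case True
  obtain q where q: "sublinear q" "q \<le> p" "\<And>r. sublinear r \<Longrightarrow> r \<le> q \<Longrightarrow> r = q"
    using exists_minimal_sublinear[OF p] by metis
  then show ?thesis using linear_if_minimal_sublinear[of q] True that by (auto simp: le_fun_def)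
next
  case False
  obtain p' where p': "sublinear p'" "\<And>x. p' x \<le> p x" "\<And>c. c \<in> C \<Longrightarrow> p' (- c) \<le> - a"
    using sublinear_infimum_along_cone[OF p C False a] by blast
  obtain q where q: "sublinear q" "q \<le> p'" "\<And>r. sublinear r \<Longrightarrow> r \<le> q \<Longrightarrow> r = q"
    using exists_minimal_sublinear[OF p'(1)] by metis
  have lin: "linear q" by (rule linear_if_minimal_sublinear[OF q(1) q(3)])
  show ?thesis
  proof (rule that[OF lin])
    show "q x \<le> p x" for x using q(2) p'(2)[of x] by (auto simp: le_fun_def intro: order_trans)
    show "a \<le> q c" if "c \<in> C" for c
      using p'(3)[OF that] le_funD[OF q(2), of "- c"] linear_neg[OF lin, of c] by simp
  qed
qed

lemma sublinear_norm_multiple: "0 \<le> c \<Longrightarrow> sublinear (\<lambda>x. c * norm x)"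
  by (rule sublinearI) (auto simp: distrib_left[symmetric] intro: mult_left_mono norm_triangle_ineq)

lemma linear_le_norm_imp_bounded:
  assumes "linear (F :: 'a::real_normed_vector \<Rightarrow> real)" "\<And>x. F x \<le> c * norm x"
  shows "bounded_linear F" "\<bar>F x\<bar> \<le> c * norm x"
proof -
  have *: "\<bar>F x\<bar> \<le> c * norm x" for x
    using assms(2)[of x] assms(2)[of "- x"] linear_neg[OF assms(1), of x] by auto
  then show "\<bar>F x\<bar> \<le> c * norm x" .
  show "bounded_linear F"
    using assms(1) * by (auto simp: bounded_linear_def bounded_linear_axioms_def mult.commute intro!: exI[of _ c])
qed

lemma exists_norming_functional:
  fixes x :: "'a::real_normed_vector"
  obtains h :: "'a \<Rightarrow>\<^sub>L real" where "norm h \<le> 1" "h x = norm x"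
proof -
  obtain F where F: "linear F" "\<And>y. F y \<le> 1 * norm y" "\<And>c. c \<in> {x} \<Longrightarrow> norm x \<le> F c"
    using mazur_orlicz[OF sublinear_norm_multiple[of 1], of "{x}" "norm x"] by auto
  have b: "bounded_linear F" "\<And>y. \<bar>F y\<bar> \<le> 1 * norm y"
    using linear_le_norm_imp_bounded[OF F(1,2)] by auto
  show ?thesis
  proof (rule that[of "Blinfun F"])
    show "norm (Blinfun F) \<le> 1"
      using b by (intro norm_blinfun_bound) (auto simp: bounded_linear_Blinfun_apply)
    show "Blinfun F x = norm x" using F(2)[of x] F(3)[of x] b by (auto simp: bounded_linear_Blinfun_apply)
  qed
qed

text \<open>
  A generalized limit is any linear functional below the limit superior.  It replaces the weak compactness
  of balls: pointwise generalized limits of a bounded sequence of functionals or operators are the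
  cluster points that James's argument asks for.
\<close>

lemma exists_generalized_limit:
  obtains L :: "(nat \<Rightarrow> real) \<Rightarrow> real" where
    "\<And>x y. bounded (range x) \<Longrightarrow> bounded (range y) \<Longrightarrow> L (\<lambda>n. x n + y n) = L x + L y"
    "\<And>c x. bounded (range x) \<Longrightarrow> L (\<lambda>n. c * x n) = c * L x"
    "\<And>a x. bounded (range x) \<Longrightarrow> eventually (\<lambda>n. x n \<le> a) sequentially \<Longrightarrow> L x \<le> a"
proof -
  define U where "U (x :: nat \<Rightarrow>\<^sub>C real) = {a. eventually (\<lambda>n. x n \<le> a) sequentially}" for x
  define p where "p x = Inf (U x)" for x
  have ne: "norm x \<in> U x" for x
    using norm_bounded[of x] by (auto simp: U_def intro!: always_eventually intro: order_trans[OF abs_ge_self])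
  have lb: "- norm x \<le> a" if a: "a \<in> U x" for a x
  proof -
    obtain n where "x n \<le> a" using a eventually_happens[of "\<lambda>n. x n \<le> a" sequentially] by (auto simp: U_def)
    then show ?thesis using norm_bounded[of x n] by simp
  qed
  have bdd: "bdd_below (U x)" for x using lb by (meson bdd_belowI)
  have le: "p x \<le> a" if "a \<in> U x" for a x unfolding p_def using that by (intro cInf_lower bdd)
  have near: "\<exists>a\<in>U x. a < p x + e" if "0 < e" for x e
    using cInf_less_iff[OF _ bdd, of x "p x + e"] ne[of x] that by (auto simp: p_def)
  \<comment> \<open>the functional \<open>p\<close> is the limit superior\<close>
  have "sublinear p"
  proof (rule sublinearI)
    fix x y show "p (x + y) \<le> p x + p y"
    proof (rule field_le_epsilon)
      fix e :: real assume e: "0 < e"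
      obtain a b where a: "a \<in> U x" "a < p x + e/2" and b: "b \<in> U y" "b < p y + e/2"
        using near[of "e/2"] e by (meson half_gt_zero)
      have "a + b \<in> U (x + y)" using a(1) b(1) unfolding U_def
        by (auto simp: plus_bcontfun.rep_eq elim: eventually_elim2)
      then show "p (x + y) \<le> p x + p y + e" using le[of "a + b" "x + y"] a b by simp
    qed
  next
    fix t :: real and x assume t: "0 < t"
    show "p (t *\<^sub>R x) \<le> t * p x"
    proof (rule field_le_epsilon)
      fix e :: real assume e: "0 < e"
      then obtain a where a: "a \<in> U x" "a < p x + e / t" using near[of "e/t" x] t by auto
      have "t * a \<in> U (t *\<^sub>R x)" using a(1) t unfolding U_def
        by (auto simp: scaleR_bcontfun.rep_eq)
      then have "p (t *\<^sub>R x) \<le> t * a" by (rule le)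
      also have "\<dots> \<le> t * (p x + e / t)" using a t by (intro mult_left_mono) auto
      also have "\<dots> = t * p x + e" using t by (simp add: field_simps)
      finally show "p (t *\<^sub>R x) \<le> t * p x + e" .
    qed
  next
    show "p 0 = 0"
    proof (rule antisym)
      show "p 0 \<le> 0" by (rule le) (simp add: U_def)
      show "0 \<le> p 0" unfolding p_def using ne[of 0] lb[of _ 0] by (intro cInf_greatest) auto
    qed
  qed
  then obtain F where F: "linear F" "\<And>x. F x \<le> p x"
    using mazur_orlicz[of p "{}" 0] by auto
  have in_b: "x \<in> bcontfun" if "bounded (range x)" for x :: "nat \<Rightarrow> real"
    using that by (auto simp: bcontfun_def continuous_on_discrete)
  note ap = Bcontfun_inverse[OF in_b]
  show ?thesis
  proof (rule that[of "\<lambda>x. F (Bcontfun x)"])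
    fix x y :: "nat \<Rightarrow> real" assume b: "bounded (range x)" "bounded (range y)"
    have bb: "bounded (range (\<lambda>n. x n + y n))" using b by (rule bounded_plus_comp)
    have "Bcontfun (\<lambda>n. x n + y n) = Bcontfun x + Bcontfun y"
      by (rule bcontfun_eqI) (simp add: ap[OF bb] ap[OF b(1)] ap[OF b(2)] plus_bcontfun.rep_eq)
    then show "F (Bcontfun (\<lambda>n. x n + y n)) = F (Bcontfun x) + F (Bcontfun y)"
      by (simp add: linear_add[OF F(1)])
  next
    fix c and x :: "nat \<Rightarrow> real" assume b: "bounded (range x)"
    have bb: "bounded (range (\<lambda>n. c * x n))" using bounded_scaleR_comp[OF b, of c] by simp
    have "Bcontfun (\<lambda>n. c * x n) = c *\<^sub>R Bcontfun x"
      by (rule bcontfun_eqI) (simp add: ap[OF bb] ap[OF b] scaleR_bcontfun.rep_eq)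
    then show "F (Bcontfun (\<lambda>n. c * x n)) = c * F (Bcontfun x)"
      by (simp add: linear_scale[OF F(1)])
  next
    fix a and x :: "nat \<Rightarrow> real" assume b: "bounded (range x)" and ev: "eventually (\<lambda>n. x n \<le> a) sequentially"
    then show "F (Bcontfun x) \<le> a"
      using order_trans[OF F(2) le] by (simp add: U_def ap[OF b])
  qed
qed

section \<open>Triangular sequences of operators\<close>

text \<open>
  Since \<open>D\<close> will be closed under negation, this says that for each \<open>\<delta>\<close> in \<open>D\<close> the number \<open>\<delta> u\<close> lies between
  the lower and the upper limit of \<open>\<delta> (f n)\<close>.
\<close>

definition between :: "('v::real_normed_vector \<Rightarrow>\<^sub>L real) set \<Rightarrow> 'v \<Rightarrow> (nat \<Rightarrow> 'v) \<Rightarrow> bool"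
  where "between D u f \<longleftrightarrow> (\<forall>\<delta>\<in>D. \<forall>a. eventually (\<lambda>n. a \<le> blinfun_apply \<delta> (f n)) sequentially \<longrightarrow> a \<le> blinfun_apply \<delta> u)"

lemma betweenD:
  "between D u f \<Longrightarrow> \<delta> \<in> D \<Longrightarrow> eventually (\<lambda>n. a \<le> blinfun_apply \<delta> (f n)) sequentially \<Longrightarrow> a \<le> blinfun_apply \<delta> u"
  by (auto simp: between_def)

lemma between_subsequence:
  assumes "between D u (f \<circ> r)" "strict_mono (r :: nat \<Rightarrow> nat)"
  shows "between D u f"
  unfolding between_def
proof (intro ballI allI impI)
  fix \<delta> a assume d: "\<delta> \<in> D" and "eventually (\<lambda>n. a \<le> blinfun_apply \<delta> (f n)) sequentially"
  then have "eventually (\<lambda>n. a \<le> blinfun_apply \<delta> ((f \<circ> r) n)) sequentially"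
    using eventually_subseq[OF assms(2)] by simp
  then show "a \<le> blinfun_apply \<delta> u" by (rule betweenD[OF assms(1) d])
qed

lemma between_tail_hulls:
  assumes "between D u g" and "\<And>n. g n \<in> convex hull (f ` {n..})"
  shows "between D u f"
  unfolding between_def
proof (intro ballI allI impI)
  fix \<delta> a assume d: "\<delta> \<in> D" and ev: "eventually (\<lambda>n. a \<le> blinfun_apply \<delta> (f n)) sequentially"
  then obtain m where m: "\<And>n. m \<le> n \<Longrightarrow> a \<le> \<delta> (f n)" by (auto simp: eventually_sequentially)
  have "a \<le> \<delta> (g n)" if "m \<le> n" for n
  proof -
    have "convex {x. a \<le> blinfun_apply \<delta> x}"
      using convex_linear_vimage[of "blinfun_apply \<delta>" "{a..}"]
      by (simp add: vimage_def blinfun.bounded_linear_right bounded_linear.linear)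
    then have "convex hull (f ` {n..}) \<subseteq> {x. a \<le> blinfun_apply \<delta> x}"
      using m that by (intro hull_minimal) auto
    then show ?thesis using assms(2)[of n] by auto
  qed
  then show "a \<le> \<delta> u" using betweenD[OF assms(1) d] by (auto simp: eventually_sequentially)
qed

text \<open>
  This is the algebraic fact behind Helly's theorem.  It is stated relative to \<open>S\<close> because the functionals will
  only be compared on a proper subspace of the operators.
\<close>

lemma functional_in_span_of_annihilators:
  fixes S :: "'v::real_normed_vector set" and F :: "('v \<Rightarrow>\<^sub>L real) set"
  assumes S: "subspace S" and "finite F" and "linear \<psi>"
    and "\<And>T. T \<in> S \<Longrightarrow> (\<And>\<delta>. \<delta> \<in> F \<Longrightarrow> blinfun_apply \<delta> T = 0) \<Longrightarrow> \<psi> T = (0::real)"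
  shows "\<exists>\<beta>\<in>span F. \<forall>T\<in>S. \<psi> T = blinfun_apply \<beta> T"
  using assms(2-4)
proof (induction F arbitrary: \<psi> rule: finite_induct)
  case empty
  then show ?case by (auto intro!: bexI[of _ 0])
next
  case (insert \<delta> F)
  have mono: "span F \<subseteq> span (insert \<delta> F)" by (intro span_mono) auto
  show ?case
  proof (cases "\<forall>T\<in>S. (\<forall>d\<in>F. blinfun_apply d T = 0) \<longrightarrow> blinfun_apply \<delta> T = 0")
    case True
    have "\<exists>\<beta>\<in>span F. \<forall>T\<in>S. \<psi> T = blinfun_apply \<beta> T"
      using insert.prems True by (intro insert.IH) auto
    then show ?thesis using mono by blast
  next
    case False
    \<comment> \<open>subtracting the right multiple of \<open>\<delta>\<close> makes \<open>\<psi>\<close> vanish on the larger kernel\<close>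
    then obtain z where z: "z \<in> S" "\<And>d. d \<in> F \<Longrightarrow> blinfun_apply d z = 0" "\<delta> z \<noteq> 0" by blast
    define c where "c = \<psi> z / \<delta> z"
    define \<psi>' where "\<psi>' T = \<psi> T - c * \<delta> T" for T
    have "linear \<psi>'"
      unfolding \<psi>'_def
      by (intro linear_compose_sub insert.prems(1) bounded_linear.linear bounded_linear_const_mult
          blinfun.bounded_linear_right)
    moreover have "\<psi>' T = 0" if T: "T \<in> S" "\<And>d. d \<in> F \<Longrightarrow> blinfun_apply d T = 0" for T
    proof -
      let ?T = "T - (\<delta> T / \<delta> z) *\<^sub>R z"
      have "?T \<in> S" using S T z by (intro subspace_diff subspace_scale)
      moreover have "blinfun_apply d ?T = 0" if "d \<in> insert \<delta> F" for d
        using that T z by (auto simp: blinfun.diff_right blinfun.scaleR_right)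
      ultimately have "\<psi> ?T = 0" by (rule insert.prems)
      then show ?thesis
        using insert.prems(1) z(3) by (simp add: \<psi>'_def c_def linear_diff linear_scale)
    qed
    ultimately obtain \<beta> where b: "\<beta> \<in> span F" "\<forall>T\<in>S. \<psi>' T = blinfun_apply \<beta> T" using insert.IH by metis
    have "\<beta> \<in> span (insert \<delta> F)" "\<delta> \<in> span (insert \<delta> F)"
      using b(1) mono by (blast, simp add: span_base)
    then have "\<beta> + c *\<^sub>R \<delta> \<in> span (insert \<delta> F)" by (intro span_add span_scale)
    moreover have "\<psi> T = blinfun_apply (\<beta> + c *\<^sub>R \<delta>) T" if "T \<in> S" for T
      using b(2) that by (simp add: \<psi>'_def blinfun.add_left blinfun.scaleR_left algebra_simps)
    ultimately show ?thesis by blast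
  qed
qed

text \<open>
  If every \<open>T\<close> of norm at most one in the common kernel of \<open>F\<close> had \<open>\<Phi> T < \<epsilon>\<close>, then by Hahn-Banach \<open>\<Phi>\<close> would
  differ by a functional of norm at most \<open>\<epsilon>\<close> from one vanishing on that kernel, hence from a
  member of the span of \<open>F\<close>.
\<close>

lemma helly:
  fixes S :: "'v::real_normed_vector set" and F :: "('v \<Rightarrow>\<^sub>L real) set"
  assumes S: "subspace S" and F: "finite F" "F \<subseteq> D" and \<Phi>: "linear \<Phi>" and e: "0 < \<epsilon>"
    and far: "\<And>\<beta>. \<beta> \<in> span D \<Longrightarrow> \<exists>T\<in>S. \<epsilon> * norm T < \<bar>\<Phi> T - blinfun_apply \<beta> T\<bar>"
  obtains T where "T \<in> S" "norm T \<le> 1" "\<And>\<delta>. \<delta> \<in> F \<Longrightarrow> blinfun_apply \<delta> T = 0" "\<epsilon> \<le> \<Phi> T"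
proof (rule ccontr)
  note found = that
  assume "\<not> thesis"
  then have no: "\<Phi> T < \<epsilon>" if "T \<in> S" "norm T \<le> 1" "\<And>\<delta>. \<delta> \<in> F \<Longrightarrow> blinfun_apply \<delta> T = 0" for T
    using that found by (meson not_less)
  define L where "L = {T \<in> S. \<forall>\<delta>\<in>F. blinfun_apply \<delta> T = 0}"
  have L: "subspace L"
    using S unfolding L_def subspace_def by (auto simp: blinfun.add_right blinfun.scaleR_right)
  have \<Phi>L: "\<Phi> T \<le> \<epsilon> * norm T" if T: "T \<in> L" for T
  proof (cases "T = 0")
    case False
    have "(1 / norm T) *\<^sub>R T \<in> L" using L T by (simp add: subspace_scale)
    then have "\<Phi> ((1 / norm T) *\<^sub>R T) < \<epsilon>" using False by (intro no) (auto simp: L_def)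
    then show ?thesis using False by (simp add: linear_scale[OF \<Phi>] field_simps)
  qed (simp add: linear_0[OF \<Phi>])
  define p where "p T = \<epsilon> * norm T - \<Phi> T" for T
  have "sublinear p"
  proof (rule sublinearI)
    fix x y show "p (x + y) \<le> p x + p y"
      using mult_left_mono[OF norm_triangle_ineq[of x y], of \<epsilon>] e
      by (simp add: p_def linear_add[OF \<Phi>] algebra_simps)
  qed (simp_all add: p_def linear_scale[OF \<Phi>] linear_0[OF \<Phi>] algebra_simps)
  moreover have "convex L" using L by (rule subspace_imp_convex)
  moreover have "0 \<le> p T" if "T \<in> L" for T using \<Phi>L[OF that] by (simp add: p_def)
  ultimately obtain G where G: "linear G" "\<And>T. G T \<le> p T" "\<And>T. T \<in> L \<Longrightarrow> 0 \<le> G T"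
    using mazur_orlicz[of p L 0] by blast
  have "G T = 0" if "T \<in> L" for T
    using G(3)[of T] G(3)[of "- T"] that linear_neg[OF G(1), of T] subspace_neg[OF L that] by simp
  then obtain \<beta> where b: "\<beta> \<in> span F" "\<forall>T\<in>S. G T = blinfun_apply \<beta> T"
    using functional_in_span_of_annihilators[OF S F(1) G(1)] by (auto simp: L_def)
  have "- \<beta> \<in> span D" using b(1) span_mono[OF F(2)] by (auto intro: span_neg)
  then obtain T where T: "T \<in> S" "\<epsilon> * norm T < \<bar>\<Phi> T - blinfun_apply (- \<beta>) T\<bar>" using far by blast
  have "linear (\<lambda>T. \<Phi> T + G T)" using \<Phi> G(1) by (rule linear_compose_add)
  moreover have "\<Phi> T + G T \<le> \<epsilon> * norm T" for T using G(2)[of T] by (simp add: p_def)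
  ultimately have "\<bar>\<Phi> T + G T\<bar> \<le> \<epsilon> * norm T" using linear_le_norm_imp_bounded(2) by blast
  then show False using T b(2) by (simp add: blinfun.minus_left)
qed

text \<open>
  The operators and the finite sets are chosen alternately.  Each new operator is annihilated by all earlier
  sets and has \<open>\<Phi> T \<ge> \<epsilon>\<close>; hence \<open>\<Phi> \<ge> \<epsilon>\<close> on the convex hull of the operators so far, and as \<open>D\<close> dominates \<open>\<Phi>\<close>
  and this hull is compact, finitely many members of \<open>D\<close> witness a value above \<open>\<epsilon> / 2\<close> throughout.
\<close>

lemma exists_triangular_sequence:
  fixes S :: "'v::real_normed_vector set" and D :: "('v \<Rightarrow>\<^sub>L real) set"
  assumes S: "subspace S" and \<Phi>: "linear \<Phi>" and e: "0 < \<epsilon>"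
    and far: "\<And>\<beta>. \<beta> \<in> span D \<Longrightarrow> \<exists>T\<in>S. \<epsilon> * norm T < \<bar>\<Phi> T - blinfun_apply \<beta> T\<bar>"
    and dom: "\<And>T. T \<in> S \<Longrightarrow> \<exists>\<delta>\<in>D. \<Phi> T \<le> blinfun_apply \<delta> T"
  obtains T :: "nat \<Rightarrow> 'v" and F :: "nat \<Rightarrow> ('v \<Rightarrow>\<^sub>L real) set" where
    "\<And>n. T n \<in> S" "\<And>n. norm (T n) \<le> 1" "\<And>n. F n \<subseteq> D"
    "\<And>m n \<delta>. m < n \<Longrightarrow> \<delta> \<in> F m \<Longrightarrow> blinfun_apply \<delta> (T n) = 0"
    "\<And>n g. g \<in> convex hull (T ` {..n}) \<Longrightarrow> \<exists>\<delta>\<in>F n. \<epsilon> / 2 \<le> blinfun_apply \<delta> g"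
proof -
  define P where "P f n TF \<longleftrightarrow> fst TF \<in> S \<and> norm (fst TF) \<le> 1 \<and> \<epsilon> \<le> \<Phi> (fst TF)
     \<and> (\<forall>X\<in>f ` {..<n}. \<forall>\<delta>\<in>snd X. blinfun_apply \<delta> (fst TF) = 0) \<and> finite (snd TF) \<and> snd TF \<subseteq> D
     \<and> (\<forall>g\<in>convex hull (insert (fst TF) (fst ` f ` {..<n})). \<exists>\<delta>\<in>snd TF. \<epsilon> / 2 \<le> blinfun_apply \<delta> g)"
    for f :: "nat \<Rightarrow> 'v \<times> ('v \<Rightarrow>\<^sub>L real) set" and n TF
  have "\<exists>f. \<forall>n. P f n (f n)"
  proof (rule dependent_wellorder_choice)
    fix r and f g :: "nat \<Rightarrow> 'v \<times> ('v \<Rightarrow>\<^sub>L real) set" and n :: nat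
    assume fg: "\<And>y. y < n \<Longrightarrow> f y = g y"
    then have "f ` {..<n} = g ` {..<n}" by (intro image_cong) auto
    then show "P f n r = P g n r" by (simp only: P_def)
  next
    fix n and f :: "nat \<Rightarrow> 'v \<times> ('v \<Rightarrow>\<^sub>L real) set" assume IH: "\<And>y. y < n \<Longrightarrow> P f y (f y)"
    have "finite (\<Union>m<n. snd (f m))" "(\<Union>m<n. snd (f m)) \<subseteq> D" using IH by (auto simp: P_def)
    then obtain T where T: "T \<in> S" "norm T \<le> 1" "\<And>\<delta>. \<delta> \<in> (\<Union>m<n. snd (f m)) \<Longrightarrow> blinfun_apply \<delta> T = 0" "\<epsilon> \<le> \<Phi> T"
      using helly[OF S _ _ \<Phi> e far] by blast
    define C where "C = convex hull (insert T (fst ` f ` {..<n}))"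
    have "compact C" unfolding C_def by (intro finite_imp_compact_convex_hull) auto
    have "convex {g. \<epsilon> \<le> \<Phi> g}"
      using convex_linear_vimage[OF \<Phi>, of "{\<epsilon>..}"] by (simp add: vimage_def)
    then have "convex (S \<inter> {g. \<epsilon> \<le> \<Phi> g})" by (intro convex_Int subspace_imp_convex[OF S])
    then have CS: "C \<subseteq> S \<inter> {g. \<epsilon> \<le> \<Phi> g}"
      unfolding C_def using T IH by (intro hull_minimal) (auto simp: P_def)
    have "C \<subseteq> (\<Union>\<delta>\<in>D. {g. \<epsilon> / 2 < blinfun_apply \<delta> g})"
    proof
      fix g assume "g \<in> C"
      then have "g \<in> S" "\<epsilon> \<le> \<Phi> g" using CS by auto
      then obtain \<delta> where "\<delta> \<in> D" "\<Phi> g \<le> blinfun_apply \<delta> g" using dom by blast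
      then show "g \<in> (\<Union>\<delta>\<in>D. {g. \<epsilon> / 2 < blinfun_apply \<delta> g})" using \<open>\<epsilon> \<le> \<Phi> g\<close> e by force
    qed
    moreover have "open {g. \<epsilon> / 2 < blinfun_apply \<delta> g}" for \<delta> :: "'v \<Rightarrow>\<^sub>L real"
      by (intro open_Collect_less continuous_intros)
    ultimately obtain F where F: "F \<subseteq> D" "finite F" "C \<subseteq> (\<Union>\<delta>\<in>F. {g. \<epsilon> / 2 < blinfun_apply \<delta> g})"
      using compactE_image[OF \<open>compact C\<close>] by metis
    have "P f n (T, F)"
      unfolding P_def fst_conv snd_conv C_def[symmetric]
    proof (intro conjI ballI)
      fix X \<delta> assume "X \<in> f ` {..<n}" "\<delta> \<in> snd X"
      then show "blinfun_apply \<delta> T = 0" using T(3) by blast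
    next
      fix g assume "g \<in> C"
      then show "\<exists>\<delta>\<in>F. \<epsilon> / 2 \<le> blinfun_apply \<delta> g" using F(3) by (auto intro: less_imp_le)
    qed (use T F in auto)
    then show "\<exists>r. P f n r" by blast
  qed
  then obtain f where f: "\<And>n. P f n (f n)" by blast
  show ?thesis
  proof (rule that[of "\<lambda>n. fst (f n)" "\<lambda>n. snd (f n)"])
    fix n g assume "g \<in> convex hull ((\<lambda>n. fst (f n)) ` {..n})"
    moreover have "(\<lambda>n. fst (f n)) ` {..n} = insert (fst (f n)) (fst ` f ` {..<n})"
      by (simp add: lessThan_Suc_atMost[symmetric] lessThan_Suc image_image)
    ultimately show "\<exists>\<delta>\<in>snd (f n). \<epsilon> / 2 \<le> blinfun_apply \<delta> g" using f[of n] by (simp add: P_def)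
  qed (use f in \<open>auto simp: P_def\<close>)
qed

lemma convex_hull_range_nat:
  "convex hull (range T) = (\<Union>n. convex hull (T ` {..n::nat}))" (is "?L = ?R")
proof
  show "?R \<subseteq> ?L" by (intro UN_least hull_mono) auto
  have "convex ?R"
  proof (rule convexI)
    fix x y and u v :: real assume xy: "x \<in> ?R" "y \<in> ?R" "0 \<le> u" "0 \<le> v" "u + v = 1"
    then obtain m n where mn: "x \<in> convex hull (T ` {..m})" "y \<in> convex hull (T ` {..n})" by auto
    have "convex hull (T ` {..m}) \<subseteq> convex hull (T ` {..max m n})" "convex hull (T ` {..n}) \<subseteq> convex hull (T ` {..max m n})"
      by (intro hull_mono image_mono; auto)+
    then have "u *\<^sub>R x + v *\<^sub>R y \<in> convex hull (T ` {..max m n})"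
      using mn xy by (intro convexD[OF convex_convex_hull]) auto
    then show "u *\<^sub>R x + v *\<^sub>R y \<in> ?R" by blast
  qed
  moreover have "range T \<subseteq> ?R" by (auto intro!: hull_inc)
  ultimately show "?L \<subseteq> ?R" by (intro hull_minimal)
qed

text \<open>
  A member of \<open>F m\<close> annihilates \<open>T n\<close> for all large \<open>n\<close>, hence also every cluster point.  So the convex
  combinations of the sequence stay away from all its cluster points.
\<close>

lemma triangular_sequence_separated:
  fixes T :: "nat \<Rightarrow> 'v::real_normed_vector"
  assumes D: "\<And>n. F n \<subseteq> D" and sym: "\<And>\<delta>. \<delta> \<in> D \<Longrightarrow> - \<delta> \<in> D"
    and zero: "\<And>m n \<delta>. m < n \<Longrightarrow> \<delta> \<in> F m \<Longrightarrow> blinfun_apply \<delta> (T n) = 0"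
    and big: "\<And>n g. g \<in> convex hull (T ` {..n}) \<Longrightarrow> \<exists>\<delta>\<in>F n. d \<le> blinfun_apply \<delta> g"
    and u: "between D u T" and g: "g \<in> convex hull (range T)"
  shows "\<exists>\<delta>\<in>D. d \<le> blinfun_apply \<delta> (g - u)"
proof -
  obtain m where m: "g \<in> convex hull (T ` {..m})" using g by (auto simp: convex_hull_range_nat)
  then obtain \<delta> where d: "\<delta> \<in> F m" "d \<le> \<delta> g" using big by blast
  then have dD: "\<delta> \<in> D" using D by auto
  have "eventually (\<lambda>n. blinfun_apply \<delta> (T n) = 0) sequentially"
    using zero[OF _ d(1)] by (auto simp: eventually_at_top_dense)
  then have "0 \<le> \<delta> u" "0 \<le> (- \<delta>) u"
    by (intro betweenD[OF u] dD sym; auto elim: eventually_mono simp: blinfun.minus_left)+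
  then have "\<delta> u = 0" by (simp add: blinfun.minus_left)
  then show ?thesis using d dD by (intro bexI[of _ \<delta>]) (auto simp: blinfun.diff_right)
qed

section \<open>Stable subsequences\<close>

text \<open>
  For bounded \<open>f\<close> this says that, for each \<open>e\<close> in \<open>E\<close>, the supremum over \<open>D\<close> of \<open>\<delta> e - liminf \<delta> (f k)\<close> equals the supremum of
  \<open>\<delta> e - limsup \<delta> (f k)\<close>, although the two limits may differ at individual \<open>\<delta>\<close>.  As a
  consequence the supremum of \<open>\<delta> (e - u)\<close> is the same for all cluster points \<open>u\<close>.
\<close>

definition stable :: "('v::real_normed_vector \<Rightarrow>\<^sub>L real) set \<Rightarrow> (nat \<Rightarrow> 'v) \<Rightarrow> 'v set \<Rightarrow> bool"
  where "stable D f E \<longleftrightarrow> (\<forall>e\<in>E. \<forall>\<epsilon>>0. \<forall>t. \<forall>\<delta>\<in>D.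
    frequently (\<lambda>k. t \<le> blinfun_apply \<delta> (e - f k)) sequentially \<longrightarrow>
    (\<exists>\<delta>'\<in>D. eventually (\<lambda>k. t - \<epsilon> \<le> blinfun_apply \<delta>' (e - f k)) sequentially))"

lemma convex_hull_sequence_separable:
  fixes T :: "nat \<Rightarrow> 'v::real_normed_vector"
  obtains e :: "nat \<Rightarrow> 'v" where "convex hull (range T) \<subseteq> closure (range e)"
proof -
  have "\<exists>N. finite N \<and> convex hull (T ` {..n}) \<subseteq> (\<Union>x\<in>N. ball x (1 / Suc j))" for n j
  proof -
    have "compact (convex hull (T ` {..n}))" by (intro finite_imp_compact_convex_hull) auto
    then have "\<forall>e>0. \<exists>N. finite N \<and> convex hull (T ` {..n}) \<subseteq> (\<Union>x\<in>N. ball x e)"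
      using compact_eq_totally_bounded by blast
    moreover have "0 < 1 / real (Suc j)" by simp
    ultimately show ?thesis by blast
  qed
  note net = this
  define N where "N n j = (SOME N. finite N \<and> convex hull (T ` {..n}) \<subseteq> (\<Union>x\<in>N. ball x (1 / Suc j)))" for n j
  have N: "finite (N n j)" "convex hull (T ` {..n}) \<subseteq> (\<Union>x\<in>N n j. ball x (1 / Suc j))" for n j
    using someI_ex[OF net[of n j]] unfolding N_def by (rule conjunct1, rule conjunct2)
  define E where "E = insert 0 (\<Union>n j. N n j)"
  have "countable (\<Union>j. N n j)" for n by (rule countable_UN) (auto intro: countable_finite N(1))
  then have "countable (\<Union>n j. N n j)" by (rule countable_UN[OF countableI_type])
  then have "countable E" unfolding E_def by (rule countable_insert)
  then have r: "range (from_nat_into E) = E" by (intro range_from_nat_into) (auto simp: E_def)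
  have cl: "x \<in> closure E" if x: "x \<in> convex hull (range T)" for x
    unfolding closure_approachable
  proof (intro allI impI)
    fix \<epsilon> :: real assume "0 < \<epsilon>"
    then obtain j where j: "inverse (real (Suc j)) < \<epsilon>" using reals_Archimedean by blast
    obtain n where "x \<in> convex hull (T ` {..n})" using x by (auto simp: convex_hull_range_nat)
    then obtain y where "y \<in> N n j" "x \<in> ball y (1 / Suc j)" using N(2)[of n j] by blast
    then have "y \<in> E" "dist y x < \<epsilon>" using j by (auto simp: E_def inverse_eq_divide)
    then show "\<exists>y\<in>E. dist y x < \<epsilon>" by blast
  qed
  have "convex hull (range T) \<subseteq> closure (range (from_nat_into E))" unfolding r using cl by (rule subsetI)
  then show ?thesis by (rule that)
qed

text \<open>
  Passing to a subsequence can only raise the supremum of \<open>\<delta> e - limsup \<delta> (T k)\<close>.  For a fixed \<open>e\<close>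
  and a fixed tolerance some subsequence raises it almost as far as possible; a diagonal sequence does this
  for a countable dense set of \<open>e\<close> and all tolerances.  If \<open>\<delta> e - \<delta> (T k) \<ge> t\<close> holds frequently, then it
  holds always along a further subsequence, and by this maximality the value \<open>t\<close> is almost
  reached eventually along the diagonal sequence itself.
\<close>

lemma pryce_subsequence:
  fixes T :: "nat \<Rightarrow> 'v::real_normed_vector" and D :: "('v \<Rightarrow>\<^sub>L real) set"
  assumes D: "\<And>\<delta>. \<delta> \<in> D \<Longrightarrow> norm \<delta> \<le> 1" and T: "\<And>n. norm (T n) \<le> 1"
  obtains r :: "nat \<Rightarrow> nat" where "strict_mono r" "stable D (T \<circ> r) (convex hull (range T))"
proof -
  have bound: "\<bar>blinfun_apply \<delta> x\<bar> \<le> norm x" if "\<delta> \<in> D" for \<delta> x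
    using norm_blinfun[of \<delta> x] mult_right_mono[OF D[OF that] norm_ge_zero[of x]] by simp
  obtain e :: "nat \<Rightarrow> 'v" where e: "convex hull (range T) \<subseteq> closure (range e)"
    using convex_hull_sequence_separable .
  define good where "good s i t \<longleftrightarrow> (\<exists>\<delta>\<in>D. eventually (\<lambda>k. t \<le> blinfun_apply \<delta> (e i - T (s k))) sequentially)"
    for s :: "nat \<Rightarrow> nat" and i and t :: real
  have good_sub: "good (s \<circ> r) i t" if "good s i t" "strict_mono r" for s r i t
  proof -
    obtain \<delta> where d: "\<delta> \<in> D" "eventually (\<lambda>k. t \<le> blinfun_apply \<delta> (e i - T (s k))) sequentially"
      using \<open>good s i t\<close> by (auto simp: good_def)
    show ?thesis
      unfolding good_def o_def using eventually_subseq[OF \<open>strict_mono r\<close> d(2)] d(1) by (intro bexI[of _ \<delta>])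
  qed
  have good_le: "t \<le> norm (e i) + 1" if g: "good s i t" for s i t
  proof -
    obtain \<delta> where d: "\<delta> \<in> D" "eventually (\<lambda>k. t \<le> blinfun_apply \<delta> (e i - T (s k))) sequentially"
      using g by (auto simp: good_def)
    obtain k where "t \<le> blinfun_apply \<delta> (e i - T (s k))"
      using eventually_happens[OF d(2)] by auto
    also have "\<dots> \<le> norm (e i - T (s k))" using bound[OF d(1)] by (rule order_trans[OF abs_ge_self])
    also have "\<dots> \<le> norm (e i) + 1" using norm_triangle_ineq4[of "e i" "T (s k)"] T[of "s k"] by linarith
    finally show ?thesis .
  qed
  have good_mono: "good s i t'" if "good s i t" "t' \<le> t" for s i t t'
  proof -
    obtain \<delta> where d: "\<delta> \<in> D" "eventually (\<lambda>k. t \<le> blinfun_apply \<delta> (e i - T (s k))) sequentially"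
      using \<open>good s i t\<close> by (auto simp: good_def)
    have "eventually (\<lambda>k. t' \<le> blinfun_apply \<delta> (e i - T (s k))) sequentially"
      using d(2) by (rule eventually_mono) (use \<open>t' \<le> t\<close> in simp)
    then show ?thesis using d(1) by (auto simp: good_def)
  qed
  \<comment> \<open>\<open>n\<close> encodes an approximating point \<open>e i\<close> together with the tolerance \<open>1 / Suc j\<close>\<close>
  define P where "P n s \<longleftrightarrow> (\<forall>r t. strict_mono r \<longrightarrow> good (s \<circ> r) (fst (prod_decode n)) t \<longrightarrow>
       good s (fst (prod_decode n)) (t - 1 / Suc (snd (prod_decode n))))" for n and s :: "nat \<Rightarrow> nat"
  interpret subseqs P
  proof
    fix n and s :: "nat \<Rightarrow> nat" assume s: "strict_mono s"
    obtain i j where ij: "prod_decode n = (i, j)" by (cases "prod_decode n")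
    define X where "X = {t. \<exists>r. strict_mono r \<and> good (s \<circ> r) i t}"
    show "\<exists>r. strict_mono r \<and> P n (s \<circ> r)"
    proof (cases "X = {}")
      case True
      have "\<not> good (s \<circ> r) i t" if "strict_mono r" for r t using True that unfolding X_def by blast
      then have "P n (s \<circ> id)" unfolding P_def ij fst_conv comp_id by blast
      then show ?thesis using strict_mono_id by blast
    next
      case False
      have bdd: "bdd_above X"
      proof (rule bdd_aboveI)
        fix t assume "t \<in> X"
        then obtain r where "good (s \<circ> r) i t" unfolding X_def by blast
        then show "t \<le> norm (e i) + 1" by (rule good_le)
      qed
      have "Sup X - 1 / Suc j < Sup X" by simp
      then obtain t where "t \<in> X" and t: "Sup X - 1 / Suc j < t" using less_cSup_iff[OF False bdd] by blast
      then obtain r where r: "strict_mono r" "good (s \<circ> r) i t" unfolding X_def by blast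
      have "P n (s \<circ> r)"
        unfolding P_def ij fst_conv snd_conv
      proof (intro allI impI)
        fix r' :: "nat \<Rightarrow> nat" and t' assume r': "strict_mono r'" "good (s \<circ> r \<circ> r') i t'"
        then have "good (s \<circ> (r \<circ> r')) i t'" by (simp only: comp_assoc)
        then have "t' \<in> X" unfolding X_def using strict_mono_o[OF r(1) r'(1)] by blast
        then have "t' \<le> Sup X" by (rule cSup_upper[OF _ bdd])
        then have "t' - 1 / Suc j \<le> t" using t by linarith
        then show "good (s \<circ> r) i (t' - 1 / Suc j)" using r(2) good_mono by blast
      qed
      then show ?thesis using r by blast
    qed
  qed
  have stab: "P n (s \<circ> r)" if "strict_mono r" "P n s" for r s n
    unfolding P_def
  proof (intro allI impI)
    fix r' :: "nat \<Rightarrow> nat" and t assume r': "strict_mono r'" "good (s \<circ> r \<circ> r') (fst (prod_decode n)) t"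
    then have "good s (fst (prod_decode n)) (t - 1 / Suc (snd (prod_decode n)))"
      using that(2) strict_mono_o[OF that(1) r'(1)] unfolding P_def comp_assoc by blast
    then show "good (s \<circ> r) (fst (prod_decode n)) (t - 1 / Suc (snd (prod_decode n)))"
      using good_sub that(1) by blast
  qed
  define q where "q = diagseq"
  have q: "strict_mono q" unfolding q_def by (rule subseq_diagseq)
  have key: "good q i (t - 1 / Suc j)" if r: "strict_mono r" "good (q \<circ> r) i t" for i j r t
  proof -
    define n where "n = prod_encode (i, j)"
    define m where "m = Suc n"
    have Pn: "P n (q \<circ> (+) m)" unfolding q_def m_def by (rule diagseq_holds[OF stab])
    \<comment> \<open>the diagonal sequence satisfies \<open>P n\<close> only after dropping \<open>m\<close> terms, so \<open>r\<close> is shifted accordingly\<close>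
    define r' where "r' k = r (k + m) - m" for k
    have ge: "k + m \<le> r (k + m)" for k using r(1) by (rule strict_mono_imp_increasing)
    have r': "strict_mono r'"
      unfolding strict_mono_Suc_iff r'_def
    proof
      fix k show "r (k + m) - m < r (Suc k + m) - m"
        using strict_monoD[OF r(1), of "k + m" "Suc k + m"] ge[of k] by simp
    qed
    have "(q \<circ> (+) m) \<circ> r' = (q \<circ> r) \<circ> (\<lambda>k. k + m)"
    proof
      fix k show "((q \<circ> (+) m) \<circ> r') k = ((q \<circ> r) \<circ> (\<lambda>k. k + m)) k" using ge[of k] by (simp add: r'_def)
    qed
    moreover have "good ((q \<circ> r) \<circ> (\<lambda>k. k + m)) i t" by (rule good_sub[OF r(2)]) (simp add: strict_mono_def)
    ultimately have "good ((q \<circ> (+) m) \<circ> r') i t" by (simp only:)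
    moreover have "prod_decode n = (i, j)" by (simp add: n_def)
    ultimately have "good (q \<circ> (+) m) i (t - 1 / Suc j)"
      using Pn r' by (simp only: P_def fst_conv snd_conv)
    then obtain \<delta> where \<delta>: "\<delta> \<in> D"
      "eventually (\<lambda>k. t - 1 / Suc j \<le> blinfun_apply \<delta> (e i - T (q (k + m)))) sequentially"
      unfolding good_def o_def add.commute[of m] by blast
    have "eventually (\<lambda>k. t - 1 / Suc j \<le> blinfun_apply \<delta> (e i - T (q k))) sequentially"
      using \<delta>(2) by (rule eventually_sequentially_seg[THEN iffD1])
    then show ?thesis unfolding good_def using \<delta>(1) by blast
  qed
  have "stable D (T \<circ> q) (convex hull (range T))"
    unfolding stable_def
  proof (intro ballI allI impI)
    fix x and \<epsilon> t :: real and \<delta> assume x: "x \<in> convex hull (range T)" and \<epsilon>: "0 < \<epsilon>" and d: "\<delta> \<in> D"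
      and fr: "frequently (\<lambda>k. t \<le> blinfun_apply \<delta> (x - (T \<circ> q) k)) sequentially"
    have "x \<in> closure (range e)" using x e by (rule rev_subsetD)
    moreover have \<epsilon>3: "0 < \<epsilon> / 3" using \<epsilon> by simp
    ultimately have "\<exists>y\<in>range e. dist y x < \<epsilon> / 3" unfolding closure_approachable by blast
    then obtain i where i: "norm (e i - x) < \<epsilon> / 3" by (auto simp: dist_norm)
    obtain j where "inverse (real (Suc j)) < \<epsilon> / 3" using reals_Archimedean[OF \<epsilon>3] by blast
    then have j: "1 / real (Suc j) < \<epsilon> / 3" by (simp only: inverse_eq_divide)
    have "infinite {k. t \<le> blinfun_apply \<delta> (x - T (q k))}"
      using fr unfolding cofinite_eq_sequentially[symmetric] frequently_cofinite o_def .
    from infinite_enumerate[OF this]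
    obtain r :: "nat \<Rightarrow> nat" where r: "strict_mono r" "\<And>k. t \<le> blinfun_apply \<delta> (x - T (q (r k)))"
      unfolding mem_Collect_eq by blast
    have split: "blinfun_apply \<delta>' (e i - y) = blinfun_apply \<delta>' (x - y) + blinfun_apply \<delta>' (e i - x)" for \<delta>' :: "'v \<Rightarrow>\<^sub>L real" and y
      by (simp add: blinfun.diff_right)
    have close: "\<bar>blinfun_apply \<delta>' (e i - x)\<bar> < \<epsilon> / 3" if "\<delta>' \<in> D" for \<delta>'
      using bound[OF that, of "e i - x"] i by simp
    have "t - \<epsilon> / 3 \<le> blinfun_apply \<delta> (e i - T (q (r k)))" for k
      using close[OF d] r(2)[of k] split[of \<delta> "T (q (r k))"] by linarith
    then have "good (q \<circ> r) i (t - \<epsilon> / 3)" unfolding good_def using d by (intro bexI[of _ \<delta>] always_eventually) auto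
    then have "good q i (t - \<epsilon> / 3 - 1 / Suc j)" using key r(1) by blast
    then obtain \<delta>' where d': "\<delta>' \<in> D"
      "eventually (\<lambda>k. t - \<epsilon> / 3 - 1 / Suc j \<le> blinfun_apply \<delta>' (e i - T (q k))) sequentially"
      by (auto simp: good_def)
    have "eventually (\<lambda>k. t - \<epsilon> \<le> blinfun_apply \<delta>' (x - (T \<circ> q) k)) sequentially"
      using d'(2)
    proof eventually_elim
      case (elim k)
      then show ?case using close[OF d'(1)] split[of \<delta>' "T (q k)"] j unfolding o_def by linarith
    qed
    then show "\<exists>\<delta>'\<in>D. eventually (\<lambda>k. t - \<epsilon> \<le> blinfun_apply \<delta>' (x - (T \<circ> q) k)) sequentially"
      using d'(1) by blast
  qed
  then show ?thesis using that q by blast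
qed

section \<open>Attainment of suprema and the theorem of James\<close>

definition supp_fun :: "('v::real_normed_vector \<Rightarrow>\<^sub>L real) set \<Rightarrow> 'v \<Rightarrow> real"
  where "supp_fun D x = (SUP \<delta>\<in>D. blinfun_apply \<delta> x)"

context
  fixes D :: "('v::real_normed_vector \<Rightarrow>\<^sub>L real) set"
  assumes D_ne: "D \<noteq> {}" and D_unit: "D \<subseteq> cball 0 1"
begin

lemma unit_functional_bound:
  assumes "\<delta> \<in> D" shows "\<bar>blinfun_apply \<delta> x\<bar> \<le> norm x"
proof -
  have "norm \<delta> \<le> 1" using assms D_unit by auto
  then show ?thesis using norm_blinfun[of \<delta> x] mult_right_mono[OF _ norm_ge_zero[of x], of "norm \<delta>" 1] by simp
qed

lemma supp_fun_bdd: "bdd_above ((\<lambda>\<delta>. blinfun_apply \<delta> x) ` D)"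
  using unit_functional_bound by (intro bdd_aboveI[of _ "norm x"]) (auto intro: order_trans[OF abs_ge_self])

lemma supp_fun_upper: "\<delta> \<in> D \<Longrightarrow> blinfun_apply \<delta> x \<le> supp_fun D x"
  unfolding supp_fun_def by (rule cSUP_upper[OF _ supp_fun_bdd])

lemma supp_fun_least: "(\<And>\<delta>. \<delta> \<in> D \<Longrightarrow> blinfun_apply \<delta> x \<le> a) \<Longrightarrow> supp_fun D x \<le> a"
  unfolding supp_fun_def by (rule cSUP_least[OF D_ne])

lemma supp_fun_norm: "supp_fun D x \<le> norm x"
  using unit_functional_bound by (intro supp_fun_least) (auto intro: order_trans[OF abs_ge_self])

lemma sublinear_supp_fun: "sublinear (supp_fun D)"
proof (rule sublinearI)
  fix x y show "supp_fun D (x + y) \<le> supp_fun D x + supp_fun D y"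
    by (intro supp_fun_least) (auto simp: blinfun.add_right intro: add_mono supp_fun_upper)
next
  fix t :: real and x assume "0 < t"
  then show "supp_fun D (t *\<^sub>R x) \<le> t * supp_fun D x"
    by (intro supp_fun_least) (auto simp: blinfun.scaleR_right intro: supp_fun_upper)
next
  show "supp_fun D 0 = 0"
    using D_ne by (simp add: supp_fun_def)
qed

text \<open>
  Where \<open>e - u\<close> attains its supremum, \<open>\<delta> (f k)\<close> is frequently not much larger than \<open>\<delta> u\<close>.  Stability moves to
  some \<open>\<delta>'\<close> where the corresponding estimate holds eventually, and it then passes to any other cluster point.
\<close>

lemma supp_fun_between_independent:
  assumes st: "stable D f (convex hull (range f))"
    and att: "\<And>e. e \<in> convex hull (range f) \<Longrightarrow> \<exists>\<delta>\<in>D. blinfun_apply \<delta> (e - u) = supp_fun D (e - u)"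
    and sym: "\<And>\<delta>. \<delta> \<in> D \<Longrightarrow> - \<delta> \<in> D"
    and u: "between D u f" and v: "between D v f" and e: "e \<in> convex hull (range f)"
  shows "supp_fun D (e - u) \<le> supp_fun D (e - v)"
proof (rule field_le_epsilon)
  fix \<epsilon> :: real assume \<epsilon>: "0 < \<epsilon>"
  obtain \<delta> where d: "\<delta> \<in> D" "blinfun_apply \<delta> (e - u) = supp_fun D (e - u)" using att[OF e] by blast
  define t where "t = supp_fun D (e - u) - \<epsilon> / 2"
  have "frequently (\<lambda>k. t \<le> blinfun_apply \<delta> (e - f k)) sequentially"
  proof (rule ccontr)
    assume "\<not> ?thesis"
    then have "eventually (\<lambda>k. blinfun_apply \<delta> e - t \<le> blinfun_apply \<delta> (f k)) sequentially"
      unfolding not_frequently by (rule eventually_mono) (simp add: blinfun.diff_right)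
    then have "blinfun_apply \<delta> e - t \<le> blinfun_apply \<delta> u" by (rule betweenD[OF u d(1)])
    then show False using d(2) \<epsilon> by (simp add: t_def blinfun.diff_right)
  qed
  then obtain \<delta>' where d': "\<delta>' \<in> D" "eventually (\<lambda>k. t - \<epsilon> / 2 \<le> blinfun_apply \<delta>' (e - f k)) sequentially"
    using st e d(1) \<epsilon> unfolding stable_def by (meson half_gt_zero)
  have "eventually (\<lambda>k. t - \<epsilon> / 2 - blinfun_apply \<delta>' e \<le> blinfun_apply (- \<delta>') (f k)) sequentially"
    using d'(2) by (rule eventually_mono) (simp add: blinfun.diff_right blinfun.minus_left)
  then have "t - \<epsilon> / 2 - blinfun_apply \<delta>' e \<le> blinfun_apply (- \<delta>') v"
    by (rule betweenD[OF v sym[OF d'(1)]])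
  then have "t - \<epsilon> / 2 \<le> blinfun_apply \<delta>' (e - v)" by (simp add: blinfun.diff_right blinfun.minus_left)
  also have "\<dots> \<le> supp_fun D (e - v)" by (rule supp_fun_upper[OF d'(1)])
  finally show "supp_fun D (e - u) \<le> supp_fun D (e - v) + \<epsilon>" by (simp add: t_def)
qed

text \<open>
  This is the mechanism of Simons.  Each \<open>g n\<close> nearly minimises the next partial sum.  A combination
  of \<open>g n\<close> and \<open>g (Suc n)\<close> is a competitor for \<open>g n\<close>, so by convexity the slope of the partial sums hardly
  decreases from one step to the next; the first slope is at least \<open>d\<close>.
\<close>

lemma near_minimisers_grow:
  fixes f :: "nat \<Rightarrow> 'v" and l :: "nat \<Rightarrow> real"
  assumes l: "\<And>n. 0 < l n" "\<And>n. l (Suc n) \<le> l n" "l 0 = 1" and d: "0 < d"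
    and sep: "\<And>g. g \<in> convex hull (range f) \<Longrightarrow> d \<le> supp_fun D (g - u)"
  obtains g where "\<And>n. g n \<in> convex hull (f ` {n..})"
    "\<And>n. supp_fun D (\<Sum>i<n. l i *\<^sub>R (g i - u)) + l n * d / 2 \<le> supp_fun D (\<Sum>i<Suc n. l i *\<^sub>R (g i - u))"
proof -
  define p where "p = supp_fun D"
  have p: "sublinear p" unfolding p_def by (rule sublinear_supp_fun)
  define \<phi> where "\<phi> g n = (\<Sum>i<n. l i *\<^sub>R (g i - u))" for g n
  \<comment> \<open>chosen so that all slope losses together stay below \<open>d / 2\<close>\<close>
  define \<epsilon> where "\<epsilon> n = l (Suc n) * d * (1/2)^(Suc n) / 4" for n
  have \<epsilon>: "0 < \<epsilon> n" for n using l(1) d by (simp add: \<epsilon>_def)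
  define P where "P g n x \<longleftrightarrow> x \<in> convex hull (f ` {n..}) \<and>
     (\<forall>y\<in>convex hull (f ` {n..}). p (\<phi> g n + l n *\<^sub>R (x - u)) - \<epsilon> n \<le> p (\<phi> g n + l n *\<^sub>R (y - u)))"
    for g n x
  have "\<exists>g. \<forall>n. P g n (g n)"
  proof (rule dependent_wellorder_choice)
    fix r and f g :: "nat \<Rightarrow> 'v" and n :: nat assume "\<And>y. y < n \<Longrightarrow> f y = g y"
    then have "\<phi> f n = \<phi> g n" unfolding \<phi>_def by (intro sum.cong) auto
    then show "P f n r = P g n r" by (simp add: P_def)
  next
    fix n and g :: "nat \<Rightarrow> 'v"
    define Y where "Y = (\<lambda>y. p (\<phi> g n + l n *\<^sub>R (y - u))) ` (convex hull (f ` {n..}))"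
    have ne: "Y \<noteq> {}" unfolding Y_def by auto
    have "d * l n - p (- \<phi> g n) \<le> r" if r: "r \<in> Y" for r
    proof -
      obtain y where y: "y \<in> convex hull (f ` {n..})" "r = p (\<phi> g n + l n *\<^sub>R (y - u))"
        using r by (auto simp: Y_def)
      have "convex hull (f ` {n..}) \<subseteq> convex hull (range f)" by (intro hull_mono) auto
      then have "d \<le> p (y - u)" using sep y(1) by (auto simp: p_def)
      then have "d * l n \<le> p (l n *\<^sub>R (y - u))" using l(1)[of n]
        by (simp add: sublinear_scaleR[OF p] mult.commute less_imp_le)
      also have "\<dots> \<le> p (- \<phi> g n) + p (\<phi> g n + l n *\<^sub>R (y - u))"
        using sublinear_add[OF p, of "- \<phi> g n" "\<phi> g n + l n *\<^sub>R (y - u)"] by simp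
      finally show ?thesis using y(2) by simp
    qed
    then have bdd: "bdd_below Y" by (meson bdd_belowI)
    obtain r where "r \<in> Y" "r < Inf Y + \<epsilon> n"
      using cInf_less_iff[OF ne bdd, of "Inf Y + \<epsilon> n"] \<epsilon>[of n] by auto
    then obtain x where x: "x \<in> convex hull (f ` {n..})" "p (\<phi> g n + l n *\<^sub>R (x - u)) < Inf Y + \<epsilon> n"
      by (auto simp: Y_def)
    have "Inf Y \<le> p (\<phi> g n + l n *\<^sub>R (y - u))" if "y \<in> convex hull (f ` {n..})" for y
      using that by (intro cInf_lower bdd) (auto simp: Y_def)
    then show "\<exists>x. P g n x" using x by (force simp: P_def)
  qed
  then obtain g where g: "\<And>n. P g n (g n)" by blast
  have phi_Suc: "\<phi> g (Suc n) = \<phi> g n + l n *\<^sub>R (g n - u)" for n by (simp add: \<phi>_def)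
  have mem: "g n \<in> convex hull (f ` {n..})" for n using g by (simp add: P_def)
  have grow: "l n * d * (1/2 + (1/2)^n / 2) \<le> p (\<phi> g (Suc n)) - p (\<phi> g n)" for n
  proof (induction n)
    case 0
    have "convex hull (f ` {0..}) \<subseteq> convex hull (range f)" by (intro hull_mono) auto
    then have "d \<le> p (g 0 - u)" unfolding p_def using mem[of 0] by (intro sep) auto
    then show ?case using l(3) sublinear_zero[OF p] by (simp add: phi_Suc) (simp add: \<phi>_def)
  next
    case (Suc n)
    define m where "m = l n + l (Suc n)"
    have pos: "0 < l n" "0 < l (Suc n)" "0 < m" using l(1) by (auto simp: m_def add_pos_pos)
    \<comment> \<open>the competitor for \<open>g n\<close>: with total weight \<open>m\<close> it reproduces the partial sum two steps ahead\<close>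
    define h where "h = (l n / m) *\<^sub>R g n + (l (Suc n) / m) *\<^sub>R g (Suc n)"
    have "convex hull (f ` {Suc n..}) \<subseteq> convex hull (f ` {n..})" by (intro hull_mono) auto
    then have h: "h \<in> convex hull (f ` {n..})"
      unfolding h_def using mem[of n] mem[of "Suc n"] pos
      by (intro convexD[OF convex_convex_hull]) (auto simp: m_def add_divide_distrib[symmetric])
    define w where "w = \<phi> g n + l n *\<^sub>R (h - u)"
    have mh: "m *\<^sub>R h = l n *\<^sub>R g n + l (Suc n) *\<^sub>R g (Suc n)"
      using pos by (simp add: h_def scaleR_add_right)
    have phi2: "\<phi> g (Suc (Suc n)) = \<phi> g n + m *\<^sub>R (h - u)"
      unfolding phi_Suc scaleR_diff_right[of m] mh by (simp add: m_def algebra_simps)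
    have "m *\<^sub>R w = l (Suc n) *\<^sub>R \<phi> g n + l n *\<^sub>R \<phi> g (Suc (Suc n))"
      unfolding phi2 w_def m_def by (simp add: algebra_simps)
    then have "m * p w \<le> l (Suc n) * p (\<phi> g n) + l n * p (\<phi> g (Suc (Suc n)))"
      using sublinear_add[OF p, of "l (Suc n) *\<^sub>R \<phi> g n" "l n *\<^sub>R \<phi> g (Suc (Suc n))"] pos sublinear_scaleR[OF p, of m w]
      by (simp add: sublinear_scaleR[OF p])
    moreover have "p (\<phi> g (Suc n)) - \<epsilon> n \<le> p w" using g[of n] h by (simp add: P_def w_def phi_Suc)
    then have "m * (p (\<phi> g (Suc n)) - \<epsilon> n) \<le> m * p w" using pos by simp
    moreover have "m * \<epsilon> n \<le> 2 * l n * \<epsilon> n" using l(2)[of n] \<epsilon>[of n] by (simp add: m_def)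
    moreover have "l (Suc n) * (l n * d * (1/2 + (1/2)^n / 2)) \<le> l (Suc n) * (p (\<phi> g (Suc n)) - p (\<phi> g n))"
      using Suc pos by simp
    ultimately have "l n * (p (\<phi> g (Suc (Suc n))) - p (\<phi> g (Suc n))) \<ge>
       l (Suc n) * (l n * d * (1/2 + (1/2)^n / 2)) - 2 * l n * \<epsilon> n"
      by (simp add: m_def algebra_simps)
    also have "l (Suc n) * (l n * d * (1/2 + (1/2)^n / 2)) - 2 * l n * \<epsilon> n
        = l n * (l (Suc n) * d * (1/2 + (1/2)^Suc n / 2))"
      by (simp add: \<epsilon>_def algebra_simps)
    finally show ?case using pos by simp
  qed
  show ?thesis
  proof (rule that[of g])
    fix n
    have "l n * d / 2 \<le> l n * d * (1/2 + (1/2)^n / 2)" using l(1)[of n] d by (simp add: distrib_left)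
    then show "supp_fun D (\<Sum>i<n. l i *\<^sub>R (g i - u)) + l n * d / 2 \<le> supp_fun D (\<Sum>i<Suc n. l i *\<^sub>R (g i - u))"
      using grow[of n] unfolding \<phi>_def p_def by linarith
  qed (rule mem)
qed

end

lemma stable_subset: "stable D f E \<Longrightarrow> E' \<subseteq> E \<Longrightarrow> stable D f E'"
  unfolding stable_def by blast

text \<open>
  Let \<open>g n\<close> be the near minimisers, chosen with respect to some cluster point \<open>v\<close>, let \<open>u\<close> be a cluster point of
  \<open>g\<close>, and let \<open>\<delta>\<close> attain the supremum at the sum of \<open>\<rho>^i (g i - u)\<close>.  The partial sums grow by
  \<open>\<rho>^n d / 2\<close>, and this growth, known for \<open>v\<close>, carries over to \<open>u\<close> by stability.  As the weights decrease so
  fast that the tails are negligible, \<open>\<delta> (g n - u) \<ge> d / 4\<close> for every \<open>n\<close>; but \<open>u\<close> is a cluster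
  point of \<open>g\<close>.
\<close>

lemma james_contradiction:
  fixes S :: "'v::banach set" and D :: "('v \<Rightarrow>\<^sub>L real) set" and f :: "nat \<Rightarrow> 'v"
  assumes S: "subspace S" "closed S"
    and D_norm: "\<And>\<delta>. \<delta> \<in> D \<Longrightarrow> norm \<delta> \<le> 1" and sym: "\<And>\<delta>. \<delta> \<in> D \<Longrightarrow> - \<delta> \<in> D"
    and attain: "\<And>T. T \<in> S \<Longrightarrow> \<exists>\<delta>\<in>D. \<forall>\<delta>'\<in>D. blinfun_apply \<delta>' T \<le> blinfun_apply \<delta> T"
    and cluster: "\<And>g. (\<And>n. g n \<in> S) \<Longrightarrow> (\<And>n. norm (g n) \<le> 1) \<Longrightarrow> \<exists>u\<in>S. between D u g"
    and f: "\<And>n. f n \<in> S" "\<And>n. norm (f n) \<le> 1"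
    and st: "stable D f (convex hull (range f))" and d: "0 < d"
    and sep: "\<And>u g. u \<in> S \<Longrightarrow> between D u f \<Longrightarrow> g \<in> convex hull (range f) \<Longrightarrow> \<exists>\<delta>\<in>D. d \<le> blinfun_apply \<delta> (g - u)"
  shows False
proof -
  have D_ne: "D \<noteq> {}" using attain[OF subspace_0[OF S(1)]] by auto
  have D_unit: "D \<subseteq> cball 0 1" using D_norm by auto
  note bound = unit_functional_bound[OF D_ne D_unit]
  note upper = supp_fun_upper[OF D_ne D_unit]
  note least = supp_fun_least[OF D_ne D_unit]
  define p where "p = supp_fun D"
  have p: "sublinear p" unfolding p_def by (rule sublinear_supp_fun[OF D_ne D_unit])
  have attain': "\<exists>\<delta>\<in>D. blinfun_apply \<delta> T = p T" if T: "T \<in> S" for T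
  proof -
    obtain \<delta> where \<delta>: "\<delta> \<in> D" "\<forall>\<delta>'\<in>D. blinfun_apply \<delta>' T \<le> blinfun_apply \<delta> T" using attain[OF T] by blast
    then have "p T \<le> blinfun_apply \<delta> T" unfolding p_def by (intro least) auto
    then show ?thesis using upper[OF \<delta>(1), of T] \<delta>(1) by (intro bexI[of _ \<delta>]) (auto simp: p_def)
  qed
  \<comment> \<open>with this ratio a tail contributes at most \<open>\<rho>^n d / 8\<close>, a quarter of the growth at step \<open>n\<close>\<close>
  define \<rho> where "\<rho> = d / (16 + d)"
  have \<rho>: "0 < \<rho>" "\<rho> < 1" "\<rho> / (1 - \<rho>) = d / 16" using d by (auto simp: \<rho>_def field_simps)
  obtain v where v: "v \<in> S" "between D v f" using cluster f by blast
  have sepv: "d \<le> supp_fun D (g - v)" if "g \<in> convex hull (range f)" for g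
    using sep[OF v that] upper by (meson order_trans)
  obtain g where g: "\<And>n. g n \<in> convex hull (f ` {n..})"
    "\<And>n. supp_fun D (\<Sum>i<n. \<rho>^i *\<^sub>R (g i - v)) + \<rho>^n * d / 2 \<le> supp_fun D (\<Sum>i<Suc n. \<rho>^i *\<^sub>R (g i - v))"
  proof (rule near_minimisers_grow[OF D_ne D_unit, of "\<lambda>n. \<rho>^n" d f v])
    show "\<rho> ^ Suc n \<le> \<rho> ^ n" for n using \<rho> by (intro power_decreasing) auto
  qed (use \<rho> d sepv in auto)
  have hullS: "convex hull (range f) \<subseteq> S"
    using f S by (intro hull_minimal subspace_imp_convex) auto
  have hull1: "convex hull (range f) \<subseteq> cball 0 1"
    using f by (intro hull_minimal convex_cball) auto
  have gh: "g n \<in> convex hull (range f)" for n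
    using g(1)[of n] hull_mono[of "f ` {n..}" "range f" convex] by auto
  have gS: "g n \<in> S" and g1: "norm (g n) \<le> 1" for n using gh[of n] hullS hull1 by auto
  have "\<exists>u\<in>S. between D u g" by (rule cluster) (rule gS g1)+
  then obtain u where u: "u \<in> S" "between D u g" ..
  have uf: "between D u f" by (rule between_tail_hulls[OF u(2) g(1)])
  define \<phi> where "\<phi> w n = (\<Sum>i<n. \<rho>^i *\<^sub>R (g i - w))" for w n
  \<comment> \<open>up to scaling, the partial sums are \<open>e - u\<close> and \<open>e - v\<close> for the same convex combination \<open>e\<close>\<close>
  have indep: "p (\<phi> u n) = p (\<phi> v n)" for n
  proof (cases "n = 0")
    case False
    define m where "m = (\<Sum>i<n. \<rho>^i)"
    have m: "0 < m" unfolding m_def using \<rho> False by (intro sum_pos) (auto simp: lessThan_empty_iff)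
    define e where "e = (\<Sum>i<n. (\<rho>^i / m) *\<^sub>R g i)"
    have e: "e \<in> convex hull (range f)"
      unfolding e_def using m \<rho> gh
    proof (intro convex_sum[OF _ convex_convex_hull])
      show "(\<Sum>i<n. \<rho>^i / m) = 1" using m unfolding m_def by (subst sum_divide_distrib[symmetric]) simp
    qed auto
    have \<phi>e: "\<phi> w n = m *\<^sub>R (e - w)" for w
    proof -
      have "m *\<^sub>R e = (\<Sum>i<n. \<rho>^i *\<^sub>R g i)" using m by (simp add: e_def scaleR_sum_right)
      moreover have "\<phi> w n = (\<Sum>i<n. \<rho>^i *\<^sub>R g i) - m *\<^sub>R w"
        by (simp add: \<phi>_def m_def scaleR_diff_right sum_subtractf scaleR_sum_left)
      ultimately show ?thesis by (simp add: scaleR_diff_right)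
    qed
    have att: "\<exists>\<delta>\<in>D. blinfun_apply \<delta> (e - w) = supp_fun D (e - w)"
      if "w \<in> S" "e \<in> convex hull (range f)" for e w
      using attain'[of "e - w"] subspace_diff[OF S(1)] that hullS by (auto simp: p_def)
    have "p (e - u) = p (e - v)"
      unfolding p_def
      by (intro antisym supp_fun_between_independent[OF D_ne D_unit st att sym] u v uf e)
    then show ?thesis unfolding \<phi>e using m by (simp add: sublinear_scaleR[OF p])
  qed (simp add: \<phi>_def)
  have grow: "p (\<phi> u n) + \<rho>^n * d / 2 \<le> p (\<phi> u (Suc n))" for n
    unfolding indep using g(2)[of n] by (simp add: p_def \<phi>_def)
  define F where "F = (\<lambda>i. \<rho>^i *\<^sub>R (g i - u))"
  have sF: "summable F"
  proof (rule summable_comparison_test)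
    show "\<exists>N. \<forall>n\<ge>N. norm (F n) \<le> \<rho>^n * (1 + norm u)"
    proof (intro exI allI impI)
      fix n
      have "norm (g n - u) \<le> 1 + norm u" using norm_triangle_ineq4[of "g n" u] g1[of n] by simp
      then show "norm (F n) \<le> \<rho>^n * (1 + norm u)" using \<rho> by (simp add: F_def mult_left_mono)
    qed
    show "summable (\<lambda>n. \<rho>^n * (1 + norm u))" using \<rho> by (intro summable_mult2 summable_geometric) auto
  qed
  define X where "X = suminf F"
  have X: "X \<in> S"
  proof (rule closed_sequentially[OF S(2)])
    show "(\<Sum>i<n. F i) \<in> S" for n
      unfolding F_def using gS u S(1) by (intro subspace_sum subspace_scale subspace_diff)
    show "(\<lambda>n. \<Sum>i<n. F i) \<longlonglongrightarrow> X" unfolding X_def by (rule summable_LIMSEQ[OF sF])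
  qed
  have du: "\<bar>blinfun_apply \<delta> u\<bar> \<le> 1" if \<delta>: "\<delta> \<in> D" for \<delta>
  proof -
    have "\<bar>blinfun_apply \<delta> (g n)\<bar> \<le> 1" for n using bound[OF \<delta>, of "g n"] g1[of n] by linarith
    then have "- 1 \<le> blinfun_apply \<delta> (g n) \<and> - 1 \<le> blinfun_apply (- \<delta>) (g n)" for n
      unfolding blinfun.minus_left by (metis abs_le_iff le_minus_iff minus_minus neg_le_iff_le)
    then have "- 1 \<le> blinfun_apply \<delta> u" "- 1 \<le> blinfun_apply (- \<delta>) u"
      using betweenD[OF u(2) \<delta>, of "- 1"] betweenD[OF u(2) sym[OF \<delta>], of "- 1"] by simp_all
    then show ?thesis by (simp add: blinfun.minus_left)
  qed
  have dg: "\<bar>blinfun_apply \<delta> (g i - u)\<bar> \<le> 2" if \<delta>: "\<delta> \<in> D" for \<delta> i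
    using bound[OF \<delta>, of "g i"] g1[of i] du[OF \<delta>] by (simp add: blinfun.diff_right)
  have tail: "\<bar>blinfun_apply \<delta> X - blinfun_apply \<delta> (\<phi> u (Suc n))\<bar> \<le> \<rho>^n * d / 8" if \<delta>: "\<delta> \<in> D" for \<delta> n
  proof -
    define a where "a i = \<rho>^i * blinfun_apply \<delta> (g i - u)" for i
    have aF: "a = (\<lambda>i. blinfun_apply \<delta> (F i))" by (simp add: a_def F_def blinfun.scaleR_right fun_eq_iff)
    have sa: "summable a" unfolding aF by (rule bounded_linear.summable[OF blinfun.bounded_linear_right sF])
    have "blinfun_apply \<delta> X = suminf a"
      unfolding aF X_def by (rule bounded_linear.suminf[OF blinfun.bounded_linear_right sF])
    also have "\<dots> = (\<Sum>i. a (i + Suc n)) + sum a {..<Suc n}" by (rule suminf_split_initial_segment[OF sa])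
    also have "sum a {..<Suc n} = blinfun_apply \<delta> (\<phi> u (Suc n))"
      unfolding \<phi>_def a_def by (simp add: blinfun.sum_right blinfun.scaleR_right blinfun.add_right)
    finally have "blinfun_apply \<delta> X - blinfun_apply \<delta> (\<phi> u (Suc n)) = (\<Sum>i. a (i + Suc n))" by simp
    also have "norm \<dots> \<le> (\<Sum>i. 2 * \<rho>^Suc n * \<rho>^i)"
    proof (rule norm_suminf_le)
      show "norm (a (i + Suc n)) \<le> 2 * \<rho>^Suc n * \<rho>^i" for i
        using mult_left_mono[OF dg[OF \<delta>, of "i + Suc n"], of "\<rho>^(i + Suc n)"] \<rho>
        by (simp add: a_def abs_mult power_add mult_ac)
      show "summable (\<lambda>i. 2 * \<rho>^Suc n * \<rho>^i)" using \<rho> by (intro summable_mult summable_geometric) auto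
    qed
    also have "\<dots> = 2 * \<rho>^Suc n * (1 / (1 - \<rho>))"
      using \<rho> by (subst suminf_mult) (auto simp: suminf_geometric summable_geometric)
    also have "\<dots> = 2 * \<rho>^n * (\<rho> / (1 - \<rho>))" by simp
    also have "\<dots> = \<rho>^n * d / 8" unfolding \<rho>(3) by simp
    finally show ?thesis by simp
  qed
  obtain \<delta> where \<delta>: "\<delta> \<in> D" "blinfun_apply \<delta> X = p X" using attain'[OF X] by blast
  have big: "blinfun_apply \<delta> u + d / 4 \<le> blinfun_apply \<delta> (g n)" for n
  proof -
    have "p (\<phi> u (Suc n)) \<le> p X + \<rho>^n * d / 8"
      unfolding p_def
    proof (rule least)
      fix \<delta>' assume "\<delta>' \<in> D"
      then show "blinfun_apply \<delta>' (\<phi> u (Suc n)) \<le> supp_fun D X + \<rho>^n * d / 8"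
        using tail[of \<delta>' n] upper[of \<delta>' X] by linarith
    qed
    moreover have "blinfun_apply \<delta> X \<le> blinfun_apply \<delta> (\<phi> u (Suc n)) + \<rho>^n * d / 8"
      using tail[OF \<delta>(1), of n] by linarith
    moreover have "blinfun_apply \<delta> (\<phi> u (Suc n)) = blinfun_apply \<delta> (\<phi> u n) + \<rho>^n * blinfun_apply \<delta> (g n - u)"
      by (simp add: \<phi>_def blinfun.add_right blinfun.scaleR_right)
    moreover have "blinfun_apply \<delta> (\<phi> u n) \<le> p (\<phi> u n)" unfolding p_def by (rule upper[OF \<delta>(1)])
    ultimately have "\<rho>^n * d / 4 \<le> \<rho>^n * blinfun_apply \<delta> (g n - u)" using grow[of n] \<delta>(2) by linarith
    then have "\<rho>^n * (d / 4) \<le> \<rho>^n * blinfun_apply \<delta> (g n - u)" by simp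
    then have "d / 4 \<le> blinfun_apply \<delta> (g n - u)" by (rule mult_left_le_imp_le) (use \<rho> in simp)
    then show ?thesis by (simp add: blinfun.diff_right)
  qed
  have "blinfun_apply \<delta> u + d / 4 \<le> blinfun_apply \<delta> u"
    using big by (intro betweenD[OF u(2) \<delta>(1)] always_eventually) blast
  then show False using d by simp
qed

text \<open>
  A functional \<open>\<Phi>\<close> dominated by \<open>D\<close> but, on \<open>S\<close>, at positive distance from the span of \<open>D\<close> would produce a triangular sequence,
  and a stable subsequence of it contradicts \<open>james_contradiction\<close>.  The conclusion is the substitute for weak compactness of
  the closed convex hull of \<open>D\<close>.
\<close>

theorem james_attainment:
  fixes S :: "'v::banach set" and D :: "('v \<Rightarrow>\<^sub>L real) set"
  assumes S: "subspace S" "closed S"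
    and D_norm: "\<And>\<delta>. \<delta> \<in> D \<Longrightarrow> norm \<delta> \<le> 1" and sym: "\<And>\<delta>. \<delta> \<in> D \<Longrightarrow> - \<delta> \<in> D"
    and attain: "\<And>T. T \<in> S \<Longrightarrow> \<exists>\<delta>\<in>D. \<forall>\<delta>'\<in>D. blinfun_apply \<delta>' T \<le> blinfun_apply \<delta> T"
    and cluster: "\<And>g. (\<And>n. g n \<in> S) \<Longrightarrow> (\<And>n. norm (g n) \<le> 1) \<Longrightarrow> \<exists>u\<in>S. between D u g"
    and \<Phi>: "linear \<Phi>" and dom: "\<And>T. T \<in> S \<Longrightarrow> \<exists>\<delta>\<in>D. \<Phi> T \<le> blinfun_apply \<delta> T"
    and e: "0 < \<epsilon>"
  shows "\<exists>\<beta>\<in>span D. \<forall>T\<in>S. \<bar>\<Phi> T - blinfun_apply \<beta> T\<bar> \<le> \<epsilon> * norm T"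
proof (rule ccontr)
  assume "\<not> ?thesis"
  then have far: "\<And>\<beta>. \<beta> \<in> span D \<Longrightarrow> \<exists>T\<in>S. \<epsilon> * norm T < \<bar>\<Phi> T - blinfun_apply \<beta> T\<bar>" by (meson not_le)
  show False
  proof (rule exists_triangular_sequence[OF S(1) \<Phi> e far dom])
    fix T :: "nat \<Rightarrow> 'v" and F :: "nat \<Rightarrow> ('v \<Rightarrow>\<^sub>L real) set"
    assume T: "\<And>n. T n \<in> S" "\<And>n. norm (T n) \<le> 1" "\<And>n. F n \<subseteq> D"
      "\<And>m n \<delta>. m < n \<Longrightarrow> \<delta> \<in> F m \<Longrightarrow> blinfun_apply \<delta> (T n) = 0"
      "\<And>n g. g \<in> convex hull (T ` {..n}) \<Longrightarrow> \<exists>\<delta>\<in>F n. \<epsilon> / 2 \<le> blinfun_apply \<delta> g"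
    obtain r :: "nat \<Rightarrow> nat" where r: "strict_mono r" "stable D (T \<circ> r) (convex hull (range T))"
      by (rule pryce_subsequence[OF D_norm T(2)])
    have sub: "convex hull (range (T \<circ> r)) \<subseteq> convex hull (range T)" by (intro hull_mono) auto
    show False
    proof (rule james_contradiction[OF S D_norm sym attain cluster, of "T \<circ> r" "\<epsilon> / 2"])
      show "stable D (T \<circ> r) (convex hull (range (T \<circ> r)))" using r(2) sub by (rule stable_subset)
      fix u g assume "between D u (T \<circ> r)" "g \<in> convex hull (range (T \<circ> r))"
      then have "between D u T" "g \<in> convex hull (range T)" using between_subsequence[OF _ r(1)] sub by auto
      note bg = this
      show "\<exists>\<delta>\<in>D. \<epsilon> / 2 \<le> blinfun_apply \<delta> (g - u)"
        by (rule triangular_sequence_separated[of F D T, OF _ _ _ _ bg]) (fact T sym)+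
    qed (use T(1,2) e in auto)
  qed
qed

section \<open>Banach spaces over the real or complex numbers\<close>

lemma generalized_limit_lower:
  assumes "\<And>c x. bounded (range x) \<Longrightarrow> L (\<lambda>n. c * x n) = c * (L x :: real)"
    and "\<And>a x. bounded (range x) \<Longrightarrow> eventually (\<lambda>n. x n \<le> a) sequentially \<Longrightarrow> L x \<le> a"
    and b: "bounded (range (x :: nat \<Rightarrow> real))" and ev: "eventually (\<lambda>n. a \<le> x n) sequentially"
  shows "a \<le> L x"
proof -
  have "bounded (range (\<lambda>n. - 1 * x n))" using bounded_scaleR_comp[OF b, of "- 1"] by simp
  moreover have "eventually (\<lambda>n. - 1 * x n \<le> - a) sequentially" using ev by (rule eventually_mono) simp
  ultimately have "L (\<lambda>n. - 1 * x n) \<le> - a" by (rule assms(2))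
  then show ?thesis using assms(1)[OF b, of "- 1"] by simp
qed

lemma eq_if_functionals_agree:
  fixes x :: "'a::real_normed_vector"
  assumes "\<And>h :: 'a \<Rightarrow>\<^sub>L real. h x = h y"
  shows "x = y"
proof -
  obtain h :: "'a \<Rightarrow>\<^sub>L real" where "h (x - y) = norm (x - y)" using exists_norming_functional by blast
  then show ?thesis using assms[of h] by (simp add: blinfun.diff_right)
qed

text \<open>
  The elementary tensor, viewed in the dual of the space of operators.
\<close>

lift_definition tensor :: "('a::real_normed_vector \<Rightarrow>\<^sub>L real) \<Rightarrow> 'a \<Rightarrow> ('a \<Rightarrow>\<^sub>L 'a) \<Rightarrow>\<^sub>L real"
  is "\<lambda>h x T. blinfun_apply h (blinfun_apply T x)"
  by (intro bounded_linear_compose[OF blinfun.bounded_linear_right] blinfun.bounded_linear_left)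

lemma tensor_apply [simp]: "blinfun_apply (tensor h x) T = blinfun_apply h (blinfun_apply T x)"
  by (simp add: tensor.rep_eq)

lemma norm_tensor_le: "norm (tensor h x) \<le> norm h * norm x"
proof (rule norm_blinfun_bound)
  fix T
  have "norm (blinfun_apply h (blinfun_apply T x)) \<le> norm h * (norm T * norm x)"
    by (rule order_trans[OF norm_blinfun mult_left_mono[OF norm_blinfun norm_ge_zero]])
  then show "norm (blinfun_apply (tensor h x) T) \<le> norm h * norm x * norm T" by (simp add: mult_ac)
qed simp

text \<open>
  The scalars enter only through their real part.  The last assumption recovers a \<open>'k\<close>-linear functional from a
  real-linear one; for complex scalars this is the usual \<open>g x = h x - \<i> h (\<i> x)\<close>.
\<close>

locale scalar_banach =
  fixes smul :: "'k::real_normed_field \<Rightarrow> 'a::banach \<Rightarrow> 'a" and re :: "'k \<Rightarrow> real"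
  assumes normed_space: "normed_space_over smul"
    and re_bounded_linear: "bounded_linear re"
    and re_le_norm: "re c \<le> norm c"
    and re_rotate: "\<exists>\<omega>. norm \<omega> = 1 \<and> re (\<omega> * c) = norm c"
    and re_eq_one: "re c = 1 \<Longrightarrow> norm c \<le> 1 \<Longrightarrow> c = 1"
    and re_extend: "bounded_linear h \<Longrightarrow>
      \<exists>g. (\<forall>x y. g (x + y) = g x + g y) \<and> (\<forall>c x. g (smul c x) = c * g x) \<and> (\<forall>x. re (g x) = h x)"
begin

sublocale V: normed_space_over smul by (rule normed_space)

lemma abs_re_le: "\<bar>re c\<bar> \<le> norm c"
  using re_le_norm[of c] re_le_norm[of "- c"] linear_neg[OF bounded_linear.linear[OF re_bounded_linear], of c] by simp

lemma smul_scaleR: "smul c (r *\<^sub>R x) = r *\<^sub>R smul c x"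
  unfolding V.smul_of_real[symmetric] by (rule V.scale_left_commute)

lemma smul_scaleR_left: "smul (r *\<^sub>R c) x = r *\<^sub>R smul c x"
proof -
  have "smul (r *\<^sub>R c) x = smul (of_real r) (smul c x)" by (simp add: scaleR_conv_of_real)
  then show ?thesis by (simp only: V.smul_of_real)
qed

lemma bounded_linear_smul: "bounded_linear (smul c)"
  by (rule bounded_linear_intro[where K = "norm c"]) (simp_all add: V.scale_right_distrib smul_scaleR V.norm_smul mult.commute)

lemma bounded_linear_smul_left: "bounded_linear (\<lambda>c. smul c x)"
  by (rule bounded_linear_intro[where K = "norm x"])
    (simp_all add: V.scale_left_distrib V.norm_smul smul_scaleR_left)

lemma dual_iff:
  "g \<in> dual_space smul \<longleftrightarrow> (\<forall>x y. g (x + y) = g x + g y) \<and> (\<forall>c x. g (smul c x) = c * g x) \<and> bounded_linear g"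
  using V.vector_space_axioms normed_space_over.axioms(1)[OF normed_space_over_mult[where 'k = 'k]]
  by (auto simp: dual_space_def Vector_Spaces.linear_iff)

lemma dual_smul: "g \<in> dual_space smul \<Longrightarrow> g (smul c x) = c * g x"
  and dual_bounded_linear: "g \<in> dual_space smul \<Longrightarrow> bounded_linear g"
  by (simp_all add: dual_iff)

lemma exists_dual_with_real_part:
  fixes h :: "'a \<Rightarrow>\<^sub>L real"
  obtains g where "g \<in> dual_space smul" "\<And>x. re (g x) = h x" "\<And>x. norm (g x) \<le> norm h * norm x"
proof -
  obtain g where g: "\<And>x y. g (x + y) = g x + g y" "\<And>c x. g (smul c x) = c * g x" "\<And>x. re (g x) = h x"
    using re_extend[OF blinfun.bounded_linear_right, of h] by metis
  have n: "norm (g x) \<le> norm h * norm x" for x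
  proof -
    obtain \<omega> where w: "norm \<omega> = 1" "re (\<omega> * g x) = norm (g x)" using re_rotate by blast
    \<comment> \<open>rotate \<open>x\<close> so that \<open>g\<close> takes a nonnegative real value there\<close>
    have "norm (g x) = h (smul \<omega> x)" using w g by metis
    also have "\<dots> \<le> norm h * norm (smul \<omega> x)" using norm_blinfun[of h "smul \<omega> x"] by simp
    finally show ?thesis using w by (simp add: V.norm_smul)
  qed
  have "bounded_linear g"
    by (rule bounded_linear_intro[where K = "norm h"])
      (use g n V.smul_of_real in \<open>auto simp: mult.commute scaleR_conv_of_real simp flip: V.smul_of_real\<close>)
  then show ?thesis using that g n by (auto simp: dual_iff)
qed

lemma state_norm_le: "(u, s) \<in> state_pairs smul \<Longrightarrow> norm (s x) \<le> norm x"
  using onorm[of s x] by (auto simp: state_pairs_def dual_iff)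

lemma state_pairsD:
  assumes "(u, s) \<in> state_pairs smul"
  shows "norm u = 1" "s \<in> dual_space smul" "s u = 1"
  using assms by (auto simp: state_pairs_def)

lemma exists_supporting_state:
  assumes "norm u = 1"
  obtains s where "(u, s) \<in> state_pairs smul"
proof -
  obtain h :: "'a \<Rightarrow>\<^sub>L real" where h: "norm h \<le> 1" "h u = norm u" using exists_norming_functional .
  obtain g where g: "g \<in> dual_space smul" "\<And>x. re (g x) = h x" "\<And>x. norm (g x) \<le> norm h * norm x"
    using exists_dual_with_real_part by metis
  have n: "norm (g x) \<le> norm x" for x
    using g(3)[of x] mult_right_mono[OF h(1) norm_ge_zero[of x]] by simp
  have "g u = 1" using n[of u] g(2)[of u] h(2) assms by (intro re_eq_one) auto
  moreover have "onorm g = 1"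
  proof (rule antisym)
    show "onorm g \<le> 1" using n by (intro onorm_bound) auto
    show "1 \<le> onorm g" using onorm[OF dual_bounded_linear[OF g(1)], of u] \<open>g u = 1\<close> assms by simp
  qed
  ultimately show ?thesis using that[of g] g(1) assms by (auto simp: state_pairs_def)
qed

definition klinear :: "('a \<Rightarrow>\<^sub>L 'a) set"
  where "klinear = {T. \<forall>c x. blinfun_apply T (smul c x) = smul c (blinfun_apply T x)}"

lemma subspace_klinear: "subspace klinear"
  by (auto simp: subspace_def klinear_def blinfun.add_left blinfun.scaleR_left V.scale_right_distrib smul_scaleR)

lemma closed_klinear: "closed klinear"
  unfolding klinear_def
  by (intro closed_Collect_all closed_Collect_eq continuous_intros
      bounded_linear.continuous_on[OF bounded_linear_smul])

definition re_fun :: "'k \<Rightarrow> ('a \<Rightarrow> 'k) \<Rightarrow> 'a \<Rightarrow>\<^sub>L real"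
  where "re_fun c g = Blinfun (\<lambda>x. re (c * g x))"

lemma re_fun_apply: "g \<in> dual_space smul \<Longrightarrow> blinfun_apply (re_fun c g) x = re (c * g x)"
proof -
  assume "g \<in> dual_space smul"
  then have "bounded_linear (\<lambda>x. re (c * g x))"
    by (intro bounded_linear_compose[OF re_bounded_linear] bounded_linear_const_mult dual_bounded_linear)
  then show ?thesis by (simp add: re_fun_def bounded_linear_Blinfun_apply)
qed

text \<open>
  The associated multilinear map multiplies the values of \<open>f\<close> at the first \<open>N - 1\<close> arguments and applies \<open>T\<close> to
  the last one.
\<close>

lemma weighted_operator_homogeneous:
  assumes N: "1 \<le> N" and f: "f \<in> dual_space smul" and T: "T \<in> klinear"
  shows "(\<lambda>x. smul (f x ^ (N - 1)) (blinfun_apply T x)) \<in> homogeneous_polynomials smul N"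
proof -
  define A where "A xs = smul (\<Prod>i<N - 1. f (xs ! i)) (blinfun_apply T (xs ! (N - 1)))" for xs
  have Tk: "blinfun_apply T (smul c x) = smul c (blinfun_apply T x)" for c x using T by (simp add: klinear_def)
  have f_lin: "f (x + y) = f x + f y" "f (smul c x) = c * f x" for x y c using f by (auto simp: dual_iff)
  have "multilinear_map smul N A"
    unfolding multilinear_map_def
  proof (intro allI impI)
    fix xs :: "'a list" and i assume len: "length xs = N" and i: "i < N"
    show "Vector_Spaces.linear smul smul (\<lambda>y. A (xs[i := y]))"
    proof (cases "i = N - 1")
      case True
      then have A: "A (xs[i := y]) = smul (\<Prod>j<N - 1. f (xs ! j)) (blinfun_apply T y)" for y
        using len i by (simp add: A_def)
      show ?thesis unfolding A
        using V.vector_space_axioms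
        by (simp add: Vector_Spaces.linear_iff blinfun.add_right V.scale_right_distrib Tk V.scale_left_commute)
    next
      case False
      then have A: "A (xs[i := y]) = smul (f y * (\<Prod>j\<in>{..<N - 1} - {i}. f (xs ! j))) (blinfun_apply T (xs ! (N - 1)))" for y
      proof -
        have "(\<Prod>j<N - 1. f (xs[i := y] ! j)) = f (xs[i := y] ! i) * (\<Prod>j\<in>{..<N - 1} - {i}. f (xs[i := y] ! j))"
          by (rule prod.remove) (use False i in auto)
        also have "\<dots> = f y * (\<Prod>j\<in>{..<N - 1} - {i}. f (xs ! j))"
        proof -
          have "(\<Prod>j\<in>{..<N - 1} - {i}. f (xs[i := y] ! j)) = (\<Prod>j\<in>{..<N - 1} - {i}. f (xs ! j))"
            by (rule prod.cong) auto
          then show ?thesis using len i by simp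
        qed
        finally show ?thesis using False by (simp add: A_def)
      qed
      show ?thesis unfolding A
        using V.vector_space_axioms
        by (simp add: Vector_Spaces.linear_iff f_lin V.scale_left_distrib distrib_right V.scale_scale mult.assoc)
    qed
  qed
  moreover have "smul (f x ^ (N - 1)) (blinfun_apply T x) = A (replicate N x)" for x
    using N by (simp add: A_def)
  moreover have "continuous_on UNIV (\<lambda>x. smul (f x ^ (N - 1)) (blinfun_apply T x))"
  proof -
    have "continuous_on UNIV f" using dual_bounded_linear[OF f] by (rule linear_continuous_on)
    then have "continuous_on UNIV (\<lambda>x. f x ^ (N - 1))" by (rule continuous_on_power)
    moreover have "bounded_bilinear smul"
    proof
      show "\<exists>K. \<forall>a b. norm (smul a b) \<le> norm a * norm b * K" by (auto simp: V.norm_smul intro!: exI[of _ 1])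
    qed (simp_all add: V.scale_left_distrib V.scale_right_distrib smul_scaleR smul_scaleR_left)
    ultimately show ?thesis
      by (intro bounded_bilinear.continuous_on[of smul]) (auto intro: continuous_intros)
  qed
  ultimately show ?thesis by (auto simp: homogeneous_polynomials_def)
qed

lemma attaining_state:
  assumes N: "1 \<le> N" and nra: "homogeneous_polynomials smul N = NRA smul N"
    and f: "(x0, f) \<in> state_pairs smul" and T: "T \<in> klinear"
  obtains u s where "(u, s) \<in> state_pairs smul"
    "\<And>u' s'. (u', s') \<in> state_pairs smul \<Longrightarrow>
      norm (f u' ^ (N - 1) * s' (blinfun_apply T u')) \<le> norm (f u ^ (N - 1) * s (blinfun_apply T u))"
proof -
  define P where "P x = smul (f x ^ (N - 1)) (blinfun_apply T x)" for x
  have "P \<in> NRA smul N"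
    using weighted_operator_homogeneous[OF N state_pairsD(2)[OF f] T] nra unfolding P_def by simp
  then obtain u s where us: "(u, s) \<in> state_pairs smul" "numerical_radius smul P = norm (s (P u))"
    by (auto simp: NRA_def)
  have sP: "s' (P u') = f u' ^ (N - 1) * s' (blinfun_apply T u')" if "(u', s') \<in> state_pairs smul" for u' s'
    using dual_smul[OF state_pairsD(2)[OF that]] by (simp add: P_def)
  have bound: "norm (s' (P u')) \<le> norm T" if us': "(u', s') \<in> state_pairs smul" for u' s'
  proof -
    have "norm (f u' ^ (N - 1)) \<le> 1"
      using state_norm_le[OF f, of u'] state_pairsD(1)[OF us'] by (simp add: norm_power power_le_one)
    moreover have "norm (s' (blinfun_apply T u')) \<le> norm T"
      using state_norm_le[OF us', of "blinfun_apply T u'"] norm_blinfun[of T u'] state_pairsD(1)[OF us'] by simp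
    ultimately show ?thesis
      using mult_mono[of "norm (f u' ^ (N - 1))" 1 "norm (s' (blinfun_apply T u'))" "norm T"]
      by (simp add: sP[OF us'] norm_mult)
  qed
  have "norm (s' (P u')) \<le> numerical_radius smul P" if us': "(u', s') \<in> state_pairs smul" for u' s'
  proof -
    have "bdd_above ((\<lambda>(x, f). norm (f (P x))) ` state_pairs smul)"
      using bound by (intro bdd_aboveI[of _ "norm T"]) auto
    from cSUP_upper[OF us' this] show ?thesis by (simp add: numerical_radius_def)
  qed
  then show ?thesis using that[OF us(1)] us sP by metis
qed

lemma finite_dimensional_if_finite_spanning:
  assumes "finite A" "V.span A = UNIV"
  shows "\<exists>B. finite_dimensional_vector_space smul B"
proof -
  obtain B where B: "B \<subseteq> A" "V.independent B" "A \<subseteq> V.span B" using V.maximal_independent_subset by blast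
  have "V.span A \<subseteq> V.span (V.span B)" by (rule V.span_mono[OF B(3)])
  then have "V.span B = UNIV" unfolding V.span_span assms(2) by blast
  then have "finite_dimensional_vector_space smul B"
    using B finite_subset[OF B(1) assms(1)] by unfold_locales auto
  then show ?thesis ..
qed

text \<open>
  Finitely many functionals have a finite dimensional complement to their common kernel, so the kernel is
  nonzero in infinite dimension.
\<close>

lemma common_kernel_nontrivial:
  assumes inf: "\<nexists>B. finite_dimensional_vector_space smul B" and "finite F" "F \<subseteq> dual_space smul"
  obtains y where "norm y = 1" "\<And>s. s \<in> F \<Longrightarrow> s y = 0"
proof -
  have "\<exists>A. finite A \<and> (\<forall>x. \<exists>b\<in>V.span A. \<forall>s\<in>F. s (x - b) = 0)"
    using assms(2,3)
  proof (induction F rule: finite_induct)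
    case empty
    then show ?case using V.span_zero by (intro exI[of _ "{}"]) auto
  next
    case (insert s F)
    then obtain A where A: "finite A" "\<And>x. \<exists>b\<in>V.span A. \<forall>s\<in>F. s (x - b) = 0" by auto
    have lin: "t (x - y) = t x - t y" "t (smul c x) = c * t x" if "t \<in> insert s F" for t x y c
    proof -
      have t: "t \<in> dual_space smul" using insert.prems that by blast
      show "t (x - y) = t x - t y" by (rule linear_diff[OF bounded_linear.linear[OF dual_bounded_linear[OF t]]])
      show "t (smul c x) = c * t x" by (rule dual_smul[OF t])
    qed
    show ?case
    proof (cases "\<forall>z. (\<forall>t\<in>F. t z = 0) \<longrightarrow> s z = 0")
      case True
      have "\<exists>b\<in>V.span A. \<forall>t\<in>insert s F. t (x - b) = 0" for x
        using A(2)[of x] True by blast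
      then show ?thesis using A(1) by blast
    next
      case False
      then obtain z where z: "\<And>t. t \<in> F \<Longrightarrow> t z = 0" "s z \<noteq> 0" by auto
      have "\<exists>b\<in>V.span (insert z A). \<forall>t\<in>insert s F. t (x - b) = 0" for x
      proof -
        obtain b where b: "b \<in> V.span A" "\<forall>t\<in>F. t (x - b) = 0" using A(2) by blast
        let ?b = "b + smul (s (x - b) / s z) z"
        have "b \<in> V.span (insert z A)" using b(1) V.span_mono[of A "insert z A"] by auto
        moreover have "z \<in> V.span (insert z A)" by (rule V.span_base) simp
        ultimately have "?b \<in> V.span (insert z A)" by (intro V.span_add V.span_scale)
        moreover have "t (x - ?b) = 0" if "t \<in> insert s F" for t
        proof -
          have "x - ?b = (x - b) - smul (s (x - b) / s z) z" by simp
          then have "t (x - ?b) = t (x - b) - (s (x - b) / s z) * t z" by (simp only: lin[OF that])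
          then show ?thesis using that b(2) z by auto
        qed
        ultimately show ?thesis by blast
      qed
      then show ?thesis using A(1) by (intro exI[of _ "insert z A"]) auto
    qed
  qed
  then obtain A where A: "finite A" "\<And>x. \<exists>b\<in>V.span A. \<forall>s\<in>F. s (x - b) = 0" by blast
  have "V.span A \<noteq> UNIV" using finite_dimensional_if_finite_spanning[OF A(1)] inf by blast
  then obtain x where x: "x \<notin> V.span A" by blast
  obtain b where b: "b \<in> V.span A" "\<forall>s\<in>F. s (x - b) = 0" using A(2) by blast
  have ne: "x - b \<noteq> 0" using x b(1) by auto
  show ?thesis
  proof (rule that[of "(1 / norm (x - b)) *\<^sub>R (x - b)"])
    show "norm ((1 / norm (x - b)) *\<^sub>R (x - b)) = 1" using ne by simp
    fix s assume s: "s \<in> F"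
    then have "linear s" using assms(3) by (intro bounded_linear.linear dual_bounded_linear) blast
    moreover have "s (x - b) = 0" using s b(2) by blast
    ultimately show "s ((1 / norm (x - b)) *\<^sub>R (x - b)) = 0" by (metis linear_scale scaleR_zero_right)
  qed
qed

end

section \<open>Reflexivity\<close>

lemma exists_half_norming_vector:
  fixes h :: "'a::real_normed_vector \<Rightarrow>\<^sub>L real"
  assumes "h \<noteq> 0"
  obtains y where "norm y = 1" "norm h / 2 < \<bar>blinfun_apply h y\<bar>"
proof -
  have "\<not> (\<forall>y. norm (blinfun_apply h y) \<le> norm h / 2 * norm y)"
  proof
    assume "\<forall>y. norm (blinfun_apply h y) \<le> norm h / 2 * norm y"
    then have "norm h \<le> norm h / 2" by (intro norm_blinfun_bound) auto
    then show False using assms by simp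
  qed
  then obtain y where y: "norm h / 2 * norm y < \<bar>blinfun_apply h y\<bar>"
    unfolding not_all not_le real_norm_def by blast
  have "y \<noteq> 0" using y by (auto simp: blinfun.zero_right)
  show ?thesis
  proof (rule that[of "(1 / norm y) *\<^sub>R y"])
    show "norm ((1 / norm y) *\<^sub>R y) = 1" using \<open>y \<noteq> 0\<close> by simp
    show "norm h / 2 < \<bar>blinfun_apply h ((1 / norm y) *\<^sub>R y)\<bar>"
      using y \<open>y \<noteq> 0\<close> by (simp add: blinfun.scaleR_right abs_mult pos_less_divide_eq)
  qed
qed

text \<open>
  The evaluation points form a Cauchy sequence, because the norm of a point is the supremum of the values of
  functionals of norm one.
\<close>

lemma evaluation_if_approximable:
  fixes \<Phi> :: "('a::banach \<Rightarrow>\<^sub>L real) \<Rightarrow> real"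
  assumes "\<And>\<epsilon>. 0 < \<epsilon> \<Longrightarrow> \<exists>y. \<forall>h. \<bar>\<Phi> h - blinfun_apply h y\<bar> \<le> \<epsilon> * norm h"
  obtains x where "\<And>h. \<Phi> h = blinfun_apply h x"
proof -
  have "\<exists>y. \<forall>h. \<bar>\<Phi> h - blinfun_apply h y\<bar> \<le> inverse (real (Suc n)) * norm h" for n
    by (rule assms) simp
  then obtain y where y: "\<And>n h. \<bar>\<Phi> h - blinfun_apply h (y n)\<bar> \<le> inverse (real (Suc n)) * norm h" by metis
  have lim0: "(\<lambda>n. inverse (real (Suc n))) \<longlonglongrightarrow> 0" by (rule LIMSEQ_inverse_real_of_nat)
  have dist: "norm (y m - y n) \<le> inverse (real (Suc m)) + inverse (real (Suc n))" for m n
  proof -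
    obtain h :: "'a \<Rightarrow>\<^sub>L real" where h: "norm h \<le> 1" "h (y m - y n) = norm (y m - y n)"
      using exists_norming_functional .
    have b: "\<bar>\<Phi> h - blinfun_apply h (y k)\<bar> \<le> inverse (real (Suc k))" for k
      by (rule order_trans[OF y]) (use h(1) mult_left_mono[OF h(1), of "inverse (real (Suc k))"] in simp)
    show ?thesis using b[of m] b[of n] h(2) by (simp add: blinfun.diff_right)
  qed
  have "Cauchy y"
  proof (rule CauchyI)
    fix e :: real assume e: "0 < e"
    then obtain M where M: "inverse (real (Suc M)) < e / 2" using reals_Archimedean[of "e/2"] by auto
    have inv: "inverse (real (Suc k)) \<le> inverse (real (Suc M))" if "k \<ge> M" for k
      using that by (intro le_imp_inverse_le) auto
    have "norm (y m - y n) < e" if "m \<ge> M" "n \<ge> M" for m n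
      using dist[of m n] inv[OF that(1)] inv[OF that(2)] M by linarith
    then show "\<exists>M. \<forall>m\<ge>M. \<forall>n\<ge>M. norm (y m - y n) < e" by blast
  qed
  then obtain x where x: "y \<longlonglongrightarrow> x" using Cauchy_convergent convergent_def by blast
  show ?thesis
  proof (rule that)
    fix h :: "'a \<Rightarrow>\<^sub>L real"
    have "(\<lambda>n. inverse (real (Suc n)) * norm h) \<longlonglongrightarrow> 0" by (rule tendsto_mult_left_zero[OF lim0])
    then have "(\<lambda>n. \<Phi> h - blinfun_apply h (y n)) \<longlonglongrightarrow> 0"
      by (rule Lim_null_comparison[rotated]) (use y in auto)
    moreover have "(\<lambda>n. \<Phi> h - blinfun_apply h (y n)) \<longlonglongrightarrow> \<Phi> h - blinfun_apply h x"
      by (intro tendsto_diff tendsto_const blinfun.tendsto x)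
    ultimately show "\<Phi> h = blinfun_apply h x" using LIMSEQ_unique by fastforce
  qed
qed

text \<open>
  The attainment assumption is stated for the exponent \<open>M\<close>, which will be \<open>N - 1\<close>.
\<close>

locale attaining = scalar_banach smul re for smul :: "'k::real_normed_field \<Rightarrow> 'a::banach \<Rightarrow> 'a" and re +
  fixes x0 :: 'a and f :: "'a \<Rightarrow> 'k" and M :: nat
  assumes base_state: "(x0, f) \<in> state_pairs smul"
    and attain_klinear: "T \<in> klinear \<Longrightarrow> \<exists>u s. (u, s) \<in> state_pairs smul \<and>
      (\<forall>u' s'. (u', s') \<in> state_pairs smul \<longrightarrow>
        norm (f u' ^ M * s' (blinfun_apply T u')) \<le> norm (f u ^ M * s (blinfun_apply T u)))"
begin

text \<open>
  The rotations \<open>\<omega>\<close> make suprema of absolute values into suprema of real functionals.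
\<close>

definition num_funs :: "(('a \<Rightarrow>\<^sub>L 'a) \<Rightarrow>\<^sub>L real) set"
  where "num_funs = {tensor (re_fun (\<omega> * f u ^ M) s) u | \<omega> u s. norm \<omega> = 1 \<and> (u, s) \<in> state_pairs smul}"

lemmas f_dual = state_pairsD(2)[OF base_state]
lemmas f_x0 = state_pairsD(3)[OF base_state]
lemmas norm_x0 = state_pairsD(1)[OF base_state]
lemmas f_norm_le = state_norm_le[OF base_state]

lemma f_linear: "f (smul c x) = c * f x" "f (x + y) = f x + f y" "f (r *\<^sub>R x) = r *\<^sub>R f x" "f (x - y) = f x - f y"
  using f_dual linear_diff[OF bounded_linear.linear[OF dual_bounded_linear[OF f_dual]]]
    linear_scale[OF bounded_linear.linear[OF dual_bounded_linear[OF f_dual]]]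
  by (auto simp: dual_iff)

lemma num_funs_apply:
  "(u, s) \<in> state_pairs smul \<Longrightarrow>
    blinfun_apply (tensor (re_fun (\<omega> * f u ^ M) s) u) T = re (\<omega> * (f u ^ M * s (blinfun_apply T u)))"
  by (simp add: re_fun_apply state_pairsD mult.assoc)

lemma num_funsI: "norm \<omega> = 1 \<Longrightarrow> (u, s) \<in> state_pairs smul \<Longrightarrow> tensor (re_fun (\<omega> * f u ^ M) s) u \<in> num_funs"
  by (auto simp: num_funs_def)

lemma num_funs_rotate:
  assumes "(u, s) \<in> state_pairs smul"
  obtains \<delta> where "\<delta> \<in> num_funs" "blinfun_apply \<delta> T = norm (f u ^ M * s (blinfun_apply T u))"
proof -
  obtain \<omega> where w: "norm \<omega> = 1" "re (\<omega> * (f u ^ M * s (blinfun_apply T u))) = norm (f u ^ M * s (blinfun_apply T u))"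
    using re_rotate by blast
  show ?thesis by (rule that[OF num_funsI[OF w(1) assms]]) (simp only: num_funs_apply[OF assms] w(2))
qed

lemma num_funs_upper:
  assumes "\<delta> \<in> num_funs"
  obtains u s where "(u, s) \<in> state_pairs smul" "\<And>T. blinfun_apply \<delta> T \<le> norm (f u ^ M * s (blinfun_apply T u))"
proof -
  obtain \<omega> u s where d: "\<delta> = tensor (re_fun (\<omega> * f u ^ M) s) u" "norm \<omega> = 1" "(u, s) \<in> state_pairs smul"
    using assms by (auto simp: num_funs_def)
  have "blinfun_apply \<delta> T \<le> norm (f u ^ M * s (blinfun_apply T u))" for T
    unfolding d(1) num_funs_apply[OF d(3)] using re_le_norm[of "\<omega> * (f u ^ M * s (blinfun_apply T u))"] d(2)
    by (simp add: norm_mult)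
  then show ?thesis using that d(3) by blast
qed

lemma num_funs_norm: "\<delta> \<in> num_funs \<Longrightarrow> norm \<delta> \<le> 1"
proof (rule norm_blinfun_bound)
  assume "\<delta> \<in> num_funs"
  then obtain u s where us: "(u, s) \<in> state_pairs smul" "\<And>T. blinfun_apply \<delta> T \<le> norm (f u ^ M * s (blinfun_apply T u))"
    using num_funs_upper by blast
  have *: "blinfun_apply \<delta> T \<le> norm T" for T
  proof -
    have "norm (f u ^ M) \<le> 1"
      using f_norm_le[of u] state_pairsD(1)[OF us(1)] by (simp add: norm_power power_le_one)
    moreover have "norm (s (blinfun_apply T u)) \<le> norm T"
      using state_norm_le[OF us(1), of "blinfun_apply T u"] norm_blinfun[of T u] state_pairsD(1)[OF us(1)] by simp
    ultimately have "norm (f u ^ M * s (blinfun_apply T u)) \<le> 1 * norm T"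
      unfolding norm_mult by (intro mult_mono) auto
    then show ?thesis using us(2)[of T] by simp
  qed
  show "norm (blinfun_apply \<delta> T) \<le> 1 * norm T" for T
    using *[of T] *[of "- T"] by (simp add: blinfun.minus_right abs_le_iff)
qed simp

lemma num_funs_symmetric: "\<delta> \<in> num_funs \<Longrightarrow> - \<delta> \<in> num_funs"
proof -
  assume "\<delta> \<in> num_funs"
  then obtain \<omega> u s where d: "\<delta> = tensor (re_fun (\<omega> * f u ^ M) s) u" "norm \<omega> = 1" "(u, s) \<in> state_pairs smul"
    by (auto simp: num_funs_def)
  have "- \<delta> = tensor (re_fun ((- \<omega>) * f u ^ M) s) u"
  proof (rule blinfun_eqI)
    fix T
    have "re (- (\<omega> * (f u ^ M * s (blinfun_apply T u)))) = - re (\<omega> * (f u ^ M * s (blinfun_apply T u)))"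
      by (rule linear_neg[OF bounded_linear.linear[OF re_bounded_linear]])
    then show "blinfun_apply (- \<delta>) T = blinfun_apply (tensor (re_fun ((- \<omega>) * f u ^ M) s) u) T"
      unfolding blinfun.minus_left d(1) num_funs_apply[OF d(3)] by simp
  qed
  then show ?thesis using num_funsI[OF _ d(3), of "- \<omega>"] d(2) by simp
qed

lemma num_funs_attained:
  assumes "T \<in> klinear"
  shows "\<exists>\<delta>\<in>num_funs. \<forall>\<delta>'\<in>num_funs. blinfun_apply \<delta>' T \<le> blinfun_apply \<delta> T"
proof -
  obtain u s where us: "(u, s) \<in> state_pairs smul"
    "\<And>u' s'. (u', s') \<in> state_pairs smul \<Longrightarrow> norm (f u' ^ M * s' (blinfun_apply T u')) \<le> norm (f u ^ M * s (blinfun_apply T u))"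
    using attain_klinear[OF assms] by blast
  obtain \<delta> where d: "\<delta> \<in> num_funs" "blinfun_apply \<delta> T = norm (f u ^ M * s (blinfun_apply T u))" using num_funs_rotate[OF us(1)] .
  have "blinfun_apply \<delta>' T \<le> blinfun_apply \<delta> T" if \<delta>': "\<delta>' \<in> num_funs" for \<delta>'
  proof (rule num_funs_upper[OF \<delta>'])
    fix u' s' assume "(u', s') \<in> state_pairs smul" "\<And>T. blinfun_apply \<delta>' T \<le> norm (f u' ^ M * s' (blinfun_apply T u'))"
    then show "blinfun_apply \<delta>' T \<le> blinfun_apply \<delta> T" using us(2)[of u' s'] d(2) order_trans by metis
  qed
  then show ?thesis using d(1) by blast
qed

text \<open>
  Since \<open>f x0 = 1\<close>, these are exactly the operators \<open>g(_) x0\<close> with \<open>g\<close> in the dual, and \<open>g\<close> is recovered by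
  composing with \<open>f\<close>.
\<close>

definition rank1 :: "('a \<Rightarrow>\<^sub>L 'a) set"
  where "rank1 = {T \<in> klinear. \<forall>x. blinfun_apply T x = smul (f (blinfun_apply T x)) x0}"

definition re_f :: "'a \<Rightarrow>\<^sub>L real" where "re_f = re_fun 1 f"

lemma re_f_apply: "blinfun_apply re_f x = re (f x)"
  unfolding re_f_def by (simp add: re_fun_apply[OF f_dual])

lemma subspace_rank1: "subspace rank1"
proof -
  have "rank1 = klinear \<inter> {T. \<forall>x. blinfun_apply T x = smul (f (blinfun_apply T x)) x0}" by (auto simp: rank1_def)
  moreover have "subspace {T. \<forall>x. blinfun_apply T x = smul (f (blinfun_apply T x)) x0}"
    unfolding subspace_def
    by (auto simp: blinfun.add_left blinfun.scaleR_left f_linear V.scale_left_distrib smul_scaleR_left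
        linear_0[OF bounded_linear.linear[OF dual_bounded_linear[OF f_dual]]])
  ultimately show ?thesis using subspace_inter[OF subspace_klinear] by (simp only:)
qed

lemma closed_rank1: "closed rank1"
proof -
  have "rank1 = klinear \<inter> {T. \<forall>x. blinfun_apply T x = smul (f (blinfun_apply T x)) x0}" by (auto simp: rank1_def)
  moreover have "closed {T. \<forall>x. blinfun_apply T x = smul (f (blinfun_apply T x)) x0}"
    by (intro closed_Collect_all closed_Collect_eq continuous_intros
      bounded_linear.continuous_on[OF bounded_linear_smul_left] bounded_linear.continuous_on[OF dual_bounded_linear[OF f_dual]])
  ultimately show ?thesis using closed_Int[OF closed_klinear] by (simp only:)
qed

lemma rank1_evaluation:
  assumes "(u, s) \<in> state_pairs smul" "T \<in> rank1"
  shows "blinfun_apply (tensor (re_fun c s) u) T = blinfun_apply re_f (blinfun_apply T (smul (c * s x0) u))"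
proof -
  have T: "blinfun_apply T u = smul (f (blinfun_apply T u)) x0" "blinfun_apply T (smul a u) = smul a (blinfun_apply T u)" for a
    using assms(2) by (auto simp: rank1_def klinear_def)
  have "s (blinfun_apply T u) = f (blinfun_apply T u) * s x0"
    by (subst T(1)) (rule dual_smul[OF state_pairsD(2)[OF assms(1)]])
  then show ?thesis
    by (simp add: re_fun_apply[OF state_pairsD(2)[OF assms(1)]] re_f_apply T(2) f_linear mult_ac)
qed

lemma rank1_cluster:
  assumes g: "\<And>n. g n \<in> rank1" "\<And>n. norm (g n) \<le> 1"
  shows "\<exists>u\<in>rank1. between num_funs u g"
proof -
  obtain L :: "(nat \<Rightarrow> real) \<Rightarrow> real" where L:
    "\<And>x y. bounded (range x) \<Longrightarrow> bounded (range y) \<Longrightarrow> L (\<lambda>n. x n + y n) = L x + L y"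
    "\<And>c x. bounded (range x) \<Longrightarrow> L (\<lambda>n. c * x n) = c * L x"
    "\<And>a x. bounded (range x) \<Longrightarrow> eventually (\<lambda>n. x n \<le> a) sequentially \<Longrightarrow> L x \<le> a"
    using exists_generalized_limit by blast
  define q where "q x n = blinfun_apply re_f (blinfun_apply (g n) x)" for x n
  have q_le: "\<bar>q x n\<bar> \<le> norm re_f * norm x" for x n
  proof -
    have "\<bar>q x n\<bar> \<le> norm re_f * norm (blinfun_apply (g n) x)" using norm_blinfun[of re_f] by (simp add: q_def)
    also have "norm (blinfun_apply (g n) x) \<le> 1 * norm x"
      by (rule order_trans[OF norm_blinfun mult_right_mono[OF g(2) norm_ge_zero]])
    finally show ?thesis by (simp add: mult_left_mono)
  qed
  have q_b: "bounded (range (q x))" for x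
    using q_le by (auto simp: bounded_iff)
  have "linear (\<lambda>x. L (q x))"
  proof (rule linearI)
    have "q (x + y) = (\<lambda>n. q x n + q y n)" for x y by (simp add: q_def fun_eq_iff blinfun.add_right)
    then show "L (q (x + y)) = L (q x) + L (q y)" for x y using L(1)[OF q_b q_b] by simp
    have "q (r *\<^sub>R x) = (\<lambda>n. r * q x n)" for r x by (simp add: q_def fun_eq_iff blinfun.scaleR_right)
    then show "L (q (r *\<^sub>R x)) = r *\<^sub>R L (q x)" for r x using L(2)[OF q_b] by simp
  qed
  moreover have "L (q x) \<le> norm re_f * norm x" for x
    using q_le[of x] by (intro L(3) q_b always_eventually) (auto simp: abs_le_iff)
  ultimately have bl: "bounded_linear (\<lambda>x. L (q x))" by (rule linear_le_norm_imp_bounded)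
  obtain k where k: "k \<in> dual_space smul" "\<And>x. re (k x) = L (q x)"
    using exists_dual_with_real_part[of "Blinfun (\<lambda>x. L (q x))"]
    unfolding bounded_linear_Blinfun_apply[OF bl] by metis
  define u where "u = Blinfun (\<lambda>x. smul (k x) x0)"
  have u: "blinfun_apply u x = smul (k x) x0" for x
    unfolding u_def
    by (simp add: bounded_linear_Blinfun_apply bounded_linear_compose[OF bounded_linear_smul_left dual_bounded_linear[OF k(1)]])
  have uR: "u \<in> rank1"
    using k(1) by (simp add: rank1_def klinear_def u f_linear f_x0 dual_iff)
  have "between num_funs u g"
    unfolding between_def
  proof (intro ballI allI impI)
    fix \<delta> a assume "\<delta> \<in> num_funs" and ev: "eventually (\<lambda>n. a \<le> blinfun_apply \<delta> (g n)) sequentially"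
    then obtain \<omega> w s where d: "\<delta> = tensor (re_fun (\<omega> * f w ^ M) s) w" "(w, s) \<in> state_pairs smul"
      by (auto simp: num_funs_def)
    define y where "y = smul (\<omega> * f w ^ M * s x0) w"
    have ev': "blinfun_apply \<delta> T = blinfun_apply re_f (blinfun_apply T y)" if "T \<in> rank1" for T
      unfolding d(1) y_def by (rule rank1_evaluation[OF d(2) that])
    have "blinfun_apply \<delta> u = L (q y)" unfolding ev'[OF uR] by (simp add: re_f_apply u f_linear f_x0 k(2))
    moreover have "a \<le> L (q y)"
      by (rule generalized_limit_lower[of L]) (use L(2,3) q_b ev ev'[OF g(1)] in \<open>auto simp: q_def\<close>)
    ultimately show "a \<le> blinfun_apply \<delta> u" by simp
  qed
  then show ?thesis using uR by blast
qed

text \<open>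
  For \<open>T = g(_) x0\<close> a member of \<open>num_funs\<close> has the value \<open>|f u|^M |g u| |s x0|\<close>.  A unit vector
  \<open>u\<close> close to \<open>x0\<close> makes \<open>|f u|\<close> and \<open>|s x0|\<close> large, since \<open>s\<close> norms \<open>u\<close>.  Moving from \<open>x0\<close> by a
  quarter of an almost norming vector, in one direction or the other, makes \<open>|g u|\<close> comparable to
  the norm of \<open>g\<close>.
\<close>

lemma rank1_lower_bound:
  assumes T: "T \<in> rank1"
  shows "\<exists>\<delta>\<in>num_funs. (1/2)^M / 20 * norm (re_f o\<^sub>L T) \<le> blinfun_apply \<delta> T"
proof (cases "re_f o\<^sub>L T = 0")
  case True
  obtain \<delta> where d: "\<delta> \<in> num_funs" "blinfun_apply \<delta> T = norm (f x0 ^ M * f (blinfun_apply T x0))" using num_funs_rotate[OF base_state] .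
  then have "0 \<le> blinfun_apply \<delta> T" by simp
  then show ?thesis using True d(1) by (intro bexI[of _ \<delta>]) auto
next
  case False
  define h where "h = re_f o\<^sub>L T"
  obtain y where y: "norm y = 1" "norm h / 2 < \<bar>blinfun_apply h y\<bar>"
    using exists_half_norming_vector False unfolding h_def by blast
  have "norm h / 8 \<le> \<bar>blinfun_apply h (x0 + (1/4) *\<^sub>R y)\<bar> \<or> norm h / 8 \<le> \<bar>blinfun_apply h (x0 - (1/4) *\<^sub>R y)\<bar>"
  proof -
    have "\<bar>b\<bar> / 2 \<le> \<bar>a + b / 4\<bar> + \<bar>a - b / 4\<bar>" for a b :: real by linarith
    from this[of "blinfun_apply h y" "blinfun_apply h x0"] y(2) show ?thesis
      unfolding blinfun.add_right blinfun.diff_right blinfun.scaleR_right by auto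
  qed
  moreover have "x0 - (1/4) *\<^sub>R y = x0 + (1/4) *\<^sub>R (- y)" by simp
  ultimately obtain z where z: "norm z = 1" "norm h / 8 \<le> \<bar>blinfun_apply h (x0 + (1/4) *\<^sub>R z)\<bar>"
    using y(1) norm_minus_cancel by metis
  define v where "v = x0 + (1/4) *\<^sub>R z"
  have nv: "3/4 \<le> norm v" "norm v \<le> 5/4"
    using norm_triangle_ineq[of x0 "(1/4) *\<^sub>R z"] norm_diff_ineq[of x0 "(1/4) *\<^sub>R z"] z(1) norm_x0
    by (simp_all add: v_def)
  define u where "u = (1 / norm v) *\<^sub>R v"
  have "norm u = 1" using nv(1) by (auto simp: u_def)
  then obtain s where s: "(u, s) \<in> state_pairs smul" using exists_supporting_state by blast
  obtain \<delta> where d: "\<delta> \<in> num_funs" "blinfun_apply \<delta> T = norm (f u ^ M * s (blinfun_apply T u))" using num_funs_rotate[OF s] .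
  have s_lin: "s (x + y) = s x + s y" "s (r *\<^sub>R x) = r *\<^sub>R s x" for x y r
    using linear_add[OF bounded_linear.linear[OF dual_bounded_linear[OF state_pairsD(2)[OF s]]]]
      linear_scale[OF bounded_linear.linear[OF dual_bounded_linear[OF state_pairsD(2)[OF s]]]] by auto
  have Tu: "blinfun_apply T u = smul (f (blinfun_apply T u)) x0" using T by (auto simp: rank1_def)
  have sTu: "norm (s (blinfun_apply T u)) = norm (f (blinfun_apply T u)) * norm (s x0)"
    by (subst Tu) (simp add: dual_smul[OF state_pairsD(2)[OF s]] norm_mult)
  have "norm h / 10 * norm v \<le> norm h / 8" using mult_left_mono[OF nv(2) norm_ge_zero[of h]]
    unfolding times_divide_eq_left by linarith
  then have "norm h / 10 \<le> norm h / 8 / norm v" using nv(1) by (intro mult_imp_le_div_pos) (auto simp: mult_ac)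
  also have "\<dots> \<le> \<bar>blinfun_apply h v\<bar> / norm v"
    using z(2) nv(1) unfolding v_def[symmetric] by (intro divide_right_mono) auto
  also have "\<dots> = \<bar>blinfun_apply h u\<bar>" by (simp add: u_def blinfun.scaleR_right abs_mult)
  also have "\<dots> = \<bar>re (f (blinfun_apply T u))\<bar>" by (simp add: h_def re_f_apply)
  also have "\<dots> \<le> norm (f (blinfun_apply T u))" by (rule abs_re_le)
  finally have fTu: "norm h / 10 \<le> norm (f (blinfun_apply T u))" .
  have sx0: "1/2 \<le> norm (s x0)"
  proof -
    have "v = norm v *\<^sub>R u" using nv(1) by (auto simp: u_def)
    then have "s v = norm v *\<^sub>R s u" by (metis s_lin(2))
    then have "norm (s v) = norm v" using state_pairsD(3)[OF s] by simp
    moreover have "norm (s v) \<le> norm (s x0) + norm (s z) / 4"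
      using norm_triangle_ineq[of "s x0" "(1/4) *\<^sub>R s z"] by (simp add: v_def s_lin)
    ultimately show ?thesis using nv(1) state_norm_le[OF s, of z] z(1) by linarith
  qed
  have fu: "1/2 \<le> norm (f u)"
  proof -
    have "f v = 1 + (1/4) *\<^sub>R f z" by (simp add: v_def f_linear f_x0)
    then have "norm (1 :: 'k) - norm ((1/4) *\<^sub>R f z) \<le> norm (f v)" by (metis norm_diff_ineq)
    then have fv: "3/4 \<le> norm (f v)" using f_norm_le[of z] z(1) by simp
    have "norm (f u) = norm (f v) / norm v" by (simp add: u_def f_linear)
    moreover have "1/2 * norm v \<le> norm (f v)" using fv nv(2) by simp
    then have "1/2 \<le> norm (f v) / norm v" using nv(1) by (intro mult_imp_le_div_pos) auto
    ultimately show ?thesis by simp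
  qed
  have "(1/2)^M \<le> norm (f u ^ M)" unfolding norm_power using fu by (intro power_mono) auto
  moreover have "norm h / 10 * (1/2) \<le> norm (s (blinfun_apply T u))"
    unfolding sTu using fTu sx0 by (intro mult_mono) auto
  ultimately have "(1/2)^M * (norm h / 10 * (1/2)) \<le> blinfun_apply \<delta> T"
    unfolding d(2) norm_mult by (intro mult_mono) auto
  then show ?thesis using d(1) unfolding h_def[symmetric] by (intro bexI[of _ \<delta>]) auto
qed

lemma rank1_span_evaluation:
  assumes "\<beta> \<in> span num_funs"
  shows "\<exists>y. \<forall>T\<in>rank1. blinfun_apply \<beta> T = blinfun_apply re_f (blinfun_apply T y)"
  using assms
proof (induction rule: span_induct)
  case base
  show ?case
    unfolding subspace_def
  proof (intro conjI ballI allI)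
    show "0 \<in> {\<beta>. \<exists>y. \<forall>T\<in>rank1. blinfun_apply \<beta> T = blinfun_apply re_f (blinfun_apply T y)}"
      by (auto simp: blinfun.zero_right intro: exI[of _ 0])
  next
    fix \<beta> \<gamma> assume "\<beta> \<in> {\<beta>. \<exists>y. \<forall>T\<in>rank1. blinfun_apply \<beta> T = blinfun_apply re_f (blinfun_apply T y)}"
      "\<gamma> \<in> {\<beta>. \<exists>y. \<forall>T\<in>rank1. blinfun_apply \<beta> T = blinfun_apply re_f (blinfun_apply T y)}"
    then obtain y z where "\<forall>T\<in>rank1. blinfun_apply \<beta> T = blinfun_apply re_f (blinfun_apply T y)"
      "\<forall>T\<in>rank1. blinfun_apply \<gamma> T = blinfun_apply re_f (blinfun_apply T z)" by blast
    then show "\<beta> + \<gamma> \<in> {\<beta>. \<exists>y. \<forall>T\<in>rank1. blinfun_apply \<beta> T = blinfun_apply re_f (blinfun_apply T y)}"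
      by (auto simp: blinfun.add_left blinfun.add_right intro: exI[of _ "y + z"])
  next
    fix c \<beta> assume "\<beta> \<in> {\<beta>. \<exists>y. \<forall>T\<in>rank1. blinfun_apply \<beta> T = blinfun_apply re_f (blinfun_apply T y)}"
    then obtain y where "\<forall>T\<in>rank1. blinfun_apply \<beta> T = blinfun_apply re_f (blinfun_apply T y)" by blast
    then show "c *\<^sub>R \<beta> \<in> {\<beta>. \<exists>y. \<forall>T\<in>rank1. blinfun_apply \<beta> T = blinfun_apply re_f (blinfun_apply T y)}"
      by (auto simp: blinfun.scaleR_left blinfun.scaleR_right intro: exI[of _ "c *\<^sub>R y"])
  qed
next
  case (step \<beta>)
  then obtain \<omega> w s where "\<beta> = tensor (re_fun (\<omega> * f w ^ M) s) w" "(w, s) \<in> state_pairs smul"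
    by (auto simp: num_funs_def)
  then show ?case using rank1_evaluation by blast
qed

text \<open>
  A multiple of \<open>\<Phi>\<close>, read as a functional on \<open>rank1\<close>, is dominated by \<open>num_funs\<close>.  James's theorem approximates it by
  combinations of \<open>num_funs\<close>, which act on \<open>rank1\<close> as evaluations.
\<close>

theorem reflexive:
  fixes \<Phi> :: "('a \<Rightarrow>\<^sub>L real) \<Rightarrow> real"
  assumes \<Phi>: "bounded_linear \<Phi>"
  obtains x where "\<And>h. \<Phi> h = blinfun_apply h x"
proof -
  obtain B where B: "0 < B" "\<And>h. norm (\<Phi> h) \<le> norm h * B" using bounded_linear.pos_bounded[OF \<Phi>] by blast
  define c where "c = (1/2)^M / 20 / B"
  have c: "0 < c" using B by (simp add: c_def)
  define \<Psi> where "\<Psi> T = c * \<Phi> (re_f o\<^sub>L T)" for T :: "'a \<Rightarrow>\<^sub>L 'a"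
  have "bounded_linear (\<lambda>T :: 'a \<Rightarrow>\<^sub>L 'a. re_f o\<^sub>L T)"
    by (rule bounded_bilinear.bounded_linear_right[OF bounded_bilinear_blinfun_compose])
  then have "bounded_linear \<Psi>" unfolding \<Psi>_def
    by (intro bounded_linear_const_mult bounded_linear_compose[OF \<Phi>])
  then have lin: "linear \<Psi>" by (rule bounded_linear.linear)
  have dom: "\<exists>\<delta>\<in>num_funs. \<Psi> T \<le> blinfun_apply \<delta> T" if T: "T \<in> rank1" for T
  proof -
    have "\<Psi> T \<le> c * (norm (re_f o\<^sub>L T) * B)"
      unfolding \<Psi>_def using B(2)[of "re_f o\<^sub>L T"] c by (intro mult_left_mono) auto
    also have "\<dots> = (1/2)^M / 20 * norm (re_f o\<^sub>L T)" using B(1) by (simp add: c_def)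
    finally show ?thesis using rank1_lower_bound[OF T] by (meson order_trans)
  qed
  have att: "\<exists>\<delta>\<in>num_funs. \<forall>\<delta>'\<in>num_funs. blinfun_apply \<delta>' T \<le> blinfun_apply \<delta> T" if "T \<in> rank1" for T
    using num_funs_attained that by (simp add: rank1_def)
  have approx: "\<exists>y. \<forall>h. \<bar>c * \<Phi> h - blinfun_apply h y\<bar> \<le> \<epsilon> * norm h" if \<epsilon>: "0 < \<epsilon>" for \<epsilon>
  proof -
    obtain \<beta> where b: "\<beta> \<in> span num_funs" "\<And>T. T \<in> rank1 \<Longrightarrow> \<bar>\<Psi> T - blinfun_apply \<beta> T\<bar> \<le> \<epsilon> * norm T"
      using james_attainment[OF subspace_rank1 closed_rank1 num_funs_norm num_funs_symmetric att rank1_cluster lin dom \<epsilon>] by blast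
    obtain y where y: "\<And>T. T \<in> rank1 \<Longrightarrow> blinfun_apply \<beta> T = blinfun_apply re_f (blinfun_apply T y)"
      using rank1_span_evaluation[OF b(1)] by blast
    have "\<bar>c * \<Phi> h - blinfun_apply h y\<bar> \<le> \<epsilon> * norm h" for h :: "'a \<Rightarrow>\<^sub>L real"
    proof -
      obtain k where k: "k \<in> dual_space smul" "\<And>x. re (k x) = h x" "\<And>x. norm (k x) \<le> norm h * norm x"
        using exists_dual_with_real_part by metis
      define T where "T = Blinfun (\<lambda>x. smul (k x) x0)"
      have T: "blinfun_apply T x = smul (k x) x0" for x
        unfolding T_def
        by (simp add: bounded_linear_Blinfun_apply bounded_linear_compose[OF bounded_linear_smul_left dual_bounded_linear[OF k(1)]])
      have TR: "T \<in> rank1" using k(1) by (simp add: rank1_def klinear_def T f_linear f_x0 dual_iff)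
      have FT: "re_f o\<^sub>L T = h" by (rule blinfun_eqI) (simp add: re_f_apply T f_linear f_x0 k(2))
      have "norm T \<le> norm h" using k(3) by (intro norm_blinfun_bound) (auto simp: T V.norm_smul norm_x0)
      then have "\<epsilon> * norm T \<le> \<epsilon> * norm h" using \<epsilon> by simp
      moreover have "\<Psi> T = c * \<Phi> h" by (simp add: \<Psi>_def FT)
      moreover have "blinfun_apply \<beta> T = blinfun_apply h y" using y[OF TR] FT by (metis blinfun_apply_blinfun_compose)
      ultimately show ?thesis using b(2)[OF TR] by simp
    qed
    then show ?thesis by blast
  qed
  obtain x where "\<And>h. c * \<Phi> h = blinfun_apply h x" using evaluation_if_approximable[OF approx] by blast
  then have "\<Phi> h = blinfun_apply h ((1/c) *\<^sub>R x)" for h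
    using c by (simp add: blinfun.scaleR_right field_simps)
  then show ?thesis by (rule that)
qed

end

section \<open>Nuclear functionals on operators\<close>

lemma compact_scaled_finite_sets:
  fixes A :: "nat \<Rightarrow> 'a::real_normed_vector set"
  assumes fin: "\<And>k. finite (A k)" and sub: "\<And>k. A k \<subseteq> cball 0 1"
  shows "compact (insert 0 (\<Union>k. (\<lambda>x. (1/2)^k *\<^sub>R x) ` A k))"
proof (rule compactI)
  fix \<C> :: "'a set set"
  assume op: "\<forall>U\<in>\<C>. open U" and cov: "insert 0 (\<Union>k. (\<lambda>x. (1/2)^k *\<^sub>R x) ` A k) \<subseteq> \<Union>\<C>"
  obtain U where U: "U \<in> \<C>" "0 \<in> U" using cov by auto
  obtain e where e: "0 < e" "ball 0 e \<subseteq> U" using op U openE by blast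
  obtain n where n: "(1/2)^n < e" using real_arch_pow_inv[OF e(1), of "1/2"] by auto
  have small: "(1/2)^k *\<^sub>R x \<in> U" if "n \<le> k" "x \<in> A k" for k x
  proof -
    have "norm ((1/2)^k *\<^sub>R x) = (1/2)^k * norm x" by (simp add: norm_power)
    also have "\<dots> \<le> (1/2)^k * 1" using sub[of k] that by (intro mult_left_mono) auto
    also have "\<dots> = (1/2)^k" by simp
    also have "\<dots> \<le> (1/2)^n" using that by (intro power_decreasing) auto
    also have "\<dots> < e" by (rule n)
    finally show ?thesis using e(2) by auto
  qed
  have "finite (\<Union>k<n. (\<lambda>x. (1/2)^k *\<^sub>R x) ` A k)" using fin by simp
  then have comp: "compact (\<Union>k<n. (\<lambda>x. (1/2)^k *\<^sub>R x) ` A k)" by (rule finite_imp_compact)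
  have sub': "(\<Union>k<n. (\<lambda>x. (1/2)^k *\<^sub>R x) ` A k) \<subseteq> \<Union>\<C>" using cov by blast
  obtain \<C>' where C': "\<C>' \<subseteq> \<C>" "finite \<C>'" "(\<Union>k<n. (\<lambda>x. (1/2)^k *\<^sub>R x) ` A k) \<subseteq> \<Union>\<C>'"
    by (rule compactE[OF comp sub' bspec[OF op]])
  have "insert 0 (\<Union>k. (\<lambda>x. (1/2)^k *\<^sub>R x) ` A k) \<subseteq> \<Union>(insert U \<C>')"
  proof
    fix z assume "z \<in> insert 0 (\<Union>k. (\<lambda>x. (1/2)^k *\<^sub>R x) ` A k)"
    then consider "z = 0" | k x where "x \<in> A k" "z = (1/2)^k *\<^sub>R x" by blast
    then show "z \<in> \<Union>(insert U \<C>')"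
    proof cases
      case 1 then show ?thesis using U by simp
    next
      case 2
      show ?thesis
      proof (cases "n \<le> k")
        case True
        then show ?thesis using small[OF True 2(1)] 2(2) by simp
      next
        case False
        then have "z \<in> (\<Union>k<n. (\<lambda>x. (1/2)^k *\<^sub>R x) ` A k)" using 2 by auto
        then show ?thesis using C'(3) by blast
      qed
    qed
  qed
  then show "\<exists>\<C>'\<subseteq>\<C>. finite \<C>' \<and> insert 0 (\<Union>k. (\<lambda>x. (1/2)^k *\<^sub>R x) ` A k) \<subseteq> \<Union>\<C>'"
    using C' U(1) by (intro exI[of _ "insert U \<C>'"]) auto
qed

lift_definition evaluation :: "'v::real_normed_vector \<Rightarrow> ('v \<Rightarrow>\<^sub>L real) \<Rightarrow>\<^sub>L real"
  is "\<lambda>T \<psi>. blinfun_apply \<psi> T" by (rule blinfun.bounded_linear_left)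

lemma evaluation_apply [simp]: "blinfun_apply (evaluation T) \<psi> = blinfun_apply \<psi> T"
  by (simp add: evaluation.rep_eq)

lemma norm_evaluation_le: "norm (evaluation T) \<le> norm T"
proof (rule norm_blinfun_bound)
  fix \<psi> show "norm (blinfun_apply (evaluation T) \<psi>) \<le> norm T * norm \<psi>"
    using norm_blinfun[of \<psi> T] by (simp add: mult.commute)
qed simp

definition unit_tensors :: "(('a::real_normed_vector \<Rightarrow>\<^sub>L 'a) \<Rightarrow>\<^sub>L real) set"
  where "unit_tensors = {tensor h x | h x. norm h \<le> 1 \<and> norm x \<le> 1}"

text \<open>
  For a single tensor take its vector, and for a convex combination the union of the finite sets.
\<close>

lemma hull_unit_tensors_finite_control:
  assumes "\<gamma> \<in> convex hull (unit_tensors :: (('a::real_normed_vector \<Rightarrow>\<^sub>L 'a) \<Rightarrow>\<^sub>L real) set)"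
  shows "\<exists>A. finite A \<and> A \<subseteq> cball 0 1 \<and>
    (\<forall>T \<epsilon>. (\<forall>x\<in>A. norm (blinfun_apply T x) \<le> \<epsilon>) \<longrightarrow> \<bar>blinfun_apply \<gamma> T\<bar> \<le> \<epsilon>)"
proof -
  define Q where "Q = (\<lambda>A (\<gamma> :: ('a \<Rightarrow>\<^sub>L 'a) \<Rightarrow>\<^sub>L real). finite A \<and> A \<subseteq> cball 0 1 \<and>
    (\<forall>T \<epsilon>. (\<forall>x\<in>A. norm (blinfun_apply T x) \<le> \<epsilon>) \<longrightarrow> \<bar>blinfun_apply \<gamma> T\<bar> \<le> \<epsilon>))"
  have "unit_tensors \<subseteq> {\<gamma>. \<exists>A. Q A \<gamma>}"
  proof
    fix \<gamma> :: "('a \<Rightarrow>\<^sub>L 'a) \<Rightarrow>\<^sub>L real" assume "\<gamma> \<in> unit_tensors"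
    then obtain h x where hx: "\<gamma> = tensor h x" "norm h \<le> 1" "norm x \<le> 1" by (auto simp: unit_tensors_def)
    have "Q {x} \<gamma>"
      unfolding Q_def
    proof (intro conjI allI impI)
      fix T :: "'a \<Rightarrow>\<^sub>L 'a" and \<epsilon> assume "\<forall>x\<in>{x}. norm (blinfun_apply T x) \<le> \<epsilon>"
      then have "norm h * norm (blinfun_apply T x) \<le> 1 * \<epsilon>" using hx(2) by (intro mult_mono) auto
      then show "\<bar>blinfun_apply \<gamma> T\<bar> \<le> \<epsilon>" using norm_blinfun[of h "blinfun_apply T x"] by (simp add: hx(1))
    qed (use hx(3) in auto)
    then show "\<gamma> \<in> {\<gamma>. \<exists>A. Q A \<gamma>}" by blast
  qed
  moreover have "convex {\<gamma>. \<exists>A. Q A \<gamma>}"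
  proof (rule convexI)
    fix \<gamma> \<gamma>' :: "('a \<Rightarrow>\<^sub>L 'a) \<Rightarrow>\<^sub>L real" and a b :: real
    assume "\<gamma> \<in> {\<gamma>. \<exists>A. Q A \<gamma>}" "\<gamma>' \<in> {\<gamma>. \<exists>A. Q A \<gamma>}" and ab: "0 \<le> a" "0 \<le> b" "a + b = 1"
    then obtain A A' where A: "Q A \<gamma>" "Q A' \<gamma>'" by blast
    have "Q (A \<union> A') (a *\<^sub>R \<gamma> + b *\<^sub>R \<gamma>')"
      unfolding Q_def
    proof (intro conjI allI impI)
      fix T :: "'a \<Rightarrow>\<^sub>L 'a" and \<epsilon> assume "\<forall>x\<in>A \<union> A'. norm (blinfun_apply T x) \<le> \<epsilon>"
      then have "\<bar>blinfun_apply \<gamma> T\<bar> \<le> \<epsilon>" "\<bar>blinfun_apply \<gamma>' T\<bar> \<le> \<epsilon>" using A by (auto simp: Q_def)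
      then have "a * \<bar>blinfun_apply \<gamma> T\<bar> + b * \<bar>blinfun_apply \<gamma>' T\<bar> \<le> a * \<epsilon> + b * \<epsilon>"
        using ab by (intro add_mono mult_left_mono) auto
      also have "\<dots> = \<epsilon>" using ab(3) by (simp add: distrib_right[symmetric])
      finally have "a * \<bar>blinfun_apply \<gamma> T\<bar> + b * \<bar>blinfun_apply \<gamma>' T\<bar> \<le> \<epsilon>" .
      moreover have "\<bar>a * blinfun_apply \<gamma> T + b * blinfun_apply \<gamma>' T\<bar> \<le> a * \<bar>blinfun_apply \<gamma> T\<bar> + b * \<bar>blinfun_apply \<gamma>' T\<bar>"
        using ab abs_triangle_ineq[of "a * blinfun_apply \<gamma> T" "b * blinfun_apply \<gamma>' T"] by (simp add: abs_mult)
      ultimately show "\<bar>blinfun_apply (a *\<^sub>R \<gamma> + b *\<^sub>R \<gamma>') T\<bar> \<le> \<epsilon>"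
        by (simp add: blinfun.add_left blinfun.scaleR_left)
    qed (use A in \<open>auto simp: Q_def\<close>)
    then show "a *\<^sub>R \<gamma> + b *\<^sub>R \<gamma>' \<in> {\<gamma>. \<exists>A. Q A \<gamma>}" by blast
  qed
  ultimately have "convex hull unit_tensors \<subseteq> {\<gamma>. \<exists>A. Q A \<gamma>}" by (rule hull_minimal)
  then show ?thesis using assms unfolding Q_def by blast
qed

context attaining
begin

text \<open>
  By reflexivity, a bounded bilinear form on the dual times the space is given by an operator; the balance
  condition makes it linear over \<open>'k\<close>.
\<close>

lemma klinear_operator_from_bilinear:
  assumes add: "\<And>h k x. B (h + k) x = B h x + (B k x :: real)" and scale: "\<And>r h x. B (r *\<^sub>R h) x = r * B h x"
    and add': "\<And>h x y. B h (x + y) = B h x + B h y" and scale': "\<And>r h x. B h (r *\<^sub>R x) = r * B h x"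
    and bal: "\<And>h c x. B h (smul c x) = B (h o\<^sub>L Blinfun (smul c)) x"
    and bound: "\<And>h x. B h x \<le> norm h * norm x"
  shows "\<exists>U\<in>klinear. \<forall>h x. B h x = blinfun_apply h (blinfun_apply U x)"
proof -
  have "\<exists>z. \<forall>h. B h x = blinfun_apply h z" for x
  proof -
    have "linear (\<lambda>h. B h x)" by (rule linearI) (simp_all add: add scale)
    then have "bounded_linear (\<lambda>h. B h x)"
      by (rule linear_le_norm_imp_bounded[where c = "norm x"]) (use bound in \<open>simp add: mult.commute\<close>)
    then show ?thesis using reflexive by metis
  qed
  then obtain V where V: "\<And>h x. B h x = blinfun_apply h (V x)" by metis
  have "linear V"
  proof (rule linearI)
    show "V (x + y) = V x + V y" for x y
      by (rule eq_if_functionals_agree) (simp add: V[symmetric] add' blinfun.add_right)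
    show "V (r *\<^sub>R x) = r *\<^sub>R V x" for r x
      by (rule eq_if_functionals_agree) (simp add: V[symmetric] scale' blinfun.scaleR_right)
  qed
  moreover have "norm (V x) \<le> norm x * 1" for x
  proof -
    obtain h :: "'a \<Rightarrow>\<^sub>L real" where h: "norm h \<le> 1" "h (V x) = norm (V x)" using exists_norming_functional .
    have "norm (V x) \<le> norm h * norm x" using bound[of h x] h(2) V[of h x] by simp
    also have "\<dots> \<le> 1 * norm x" using h(1) by (rule mult_right_mono) simp
    finally show ?thesis by simp
  qed
  ultimately have bl: "bounded_linear V"
    by (auto simp: bounded_linear_def bounded_linear_axioms_def intro!: exI[of _ 1])
  have "V (smul c x) = smul c (V x)" for c x
  proof (rule eq_if_functionals_agree)
    fix h :: "'a \<Rightarrow>\<^sub>L real"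
    have "blinfun_apply h (V (smul c x)) = B (h o\<^sub>L Blinfun (smul c)) x" by (simp only: V[symmetric] bal)
    then show "blinfun_apply h (V (smul c x)) = blinfun_apply h (smul c (V x))"
      by (simp add: V bounded_linear_Blinfun_apply[OF bounded_linear_smul])
  qed
  then have "Blinfun V \<in> klinear" by (simp add: klinear_def bounded_linear_Blinfun_apply[OF bl])
  then show ?thesis using V by (intro bexI[of _ "Blinfun V"]) (simp_all add: bounded_linear_Blinfun_apply[OF bl])
qed

lemma klinear_cluster:
  assumes g: "\<And>n. g n \<in> klinear" "\<And>n. norm (g n) \<le> 1"
  shows "\<exists>u\<in>klinear. between num_funs u g"
proof -
  \<comment> \<open>the cluster point is the operator representing the generalized limits of \<open>h (g n x)\<close>\<close>
  obtain L :: "(nat \<Rightarrow> real) \<Rightarrow> real" where L: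
    "\<And>x y. bounded (range x) \<Longrightarrow> bounded (range y) \<Longrightarrow> L (\<lambda>n. x n + y n) = L x + L y"
    "\<And>c x. bounded (range x) \<Longrightarrow> L (\<lambda>n. c * x n) = c * L x"
    "\<And>a x. bounded (range x) \<Longrightarrow> eventually (\<lambda>n. x n \<le> a) sequentially \<Longrightarrow> L x \<le> a"
    using exists_generalized_limit by blast
  define q where "q h x n = blinfun_apply h (blinfun_apply (g n) x)" for h :: "'a \<Rightarrow>\<^sub>L real" and x n
  have q_le: "\<bar>q h x n\<bar> \<le> norm h * norm x" for h x n
  proof -
    have "\<bar>q h x n\<bar> \<le> norm h * norm (blinfun_apply (g n) x)" using norm_blinfun[of h] by (simp add: q_def)
    also have "norm (blinfun_apply (g n) x) \<le> 1 * norm x"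
      by (rule order_trans[OF norm_blinfun mult_right_mono[OF g(2) norm_ge_zero]])
    finally show ?thesis by (simp add: mult_left_mono)
  qed
  have q_b: "bounded (range (q h x))" for h x
    using q_le by (auto simp: bounded_iff)
  have "\<exists>U\<in>klinear. \<forall>h x. L (q h x) = blinfun_apply h (blinfun_apply U x)"
  proof (rule klinear_operator_from_bilinear[of "\<lambda>h x. L (q h x)"])
    have "q (h + k) x = (\<lambda>n. q h x n + q k x n)" for h k x by (simp add: q_def fun_eq_iff blinfun.add_left)
    then show "L (q (h + k) x) = L (q h x) + L (q k x)" for h k x using L(1)[OF q_b q_b] by simp
    have "q h (x + y) = (\<lambda>n. q h x n + q h y n)" for h x y by (simp add: q_def fun_eq_iff blinfun.add_right)
    then show "L (q h (x + y)) = L (q h x) + L (q h y)" for h x y using L(1)[OF q_b q_b] by simp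
    have "q (r *\<^sub>R h) x = (\<lambda>n. r * q h x n)" for r h x by (simp add: q_def fun_eq_iff blinfun.scaleR_left)
    then show "L (q (r *\<^sub>R h) x) = r * L (q h x)" for r h x using L(2)[OF q_b] by simp
    have "q h (r *\<^sub>R x) = (\<lambda>n. r * q h x n)" for r h x by (simp add: q_def fun_eq_iff blinfun.scaleR_right)
    then show "L (q h (r *\<^sub>R x)) = r * L (q h x)" for r h x using L(2)[OF q_b] by simp
    have "q h (smul c x) = q (h o\<^sub>L Blinfun (smul c)) x" for h c x
      using g(1) by (simp add: q_def fun_eq_iff klinear_def bounded_linear_Blinfun_apply[OF bounded_linear_smul])
    then show "L (q h (smul c x)) = L (q (h o\<^sub>L Blinfun (smul c)) x)" for h c x by simp
    show "L (q h x) \<le> norm h * norm x" for h x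
      using q_le[of h x] by (intro L(3) q_b always_eventually) (auto simp: abs_le_iff)
  qed
  then obtain U where U: "U \<in> klinear" "\<And>h x. L (q h x) = blinfun_apply h (blinfun_apply U x)" by blast
  have "between num_funs U g"
    unfolding between_def
  proof (intro ballI allI impI)
    fix \<delta> a assume "\<delta> \<in> num_funs" and ev: "eventually (\<lambda>n. a \<le> blinfun_apply \<delta> (g n)) sequentially"
    then obtain h w where d: "\<delta> = tensor h w" by (auto simp: num_funs_def)
    have "a \<le> L (q h w)"
      by (rule generalized_limit_lower[of L]) (use L(2,3) q_b ev in \<open>auto simp: q_def d\<close>)
    then show "a \<le> blinfun_apply \<delta> U" by (simp add: d U(2))
  qed
  then show ?thesis using U(1) by blast
qed

text \<open>
  On a reflexive space, the projective tensor norm of a finite tensor equals its norm as a functional on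
  operators.  If \<open>\<beta>\<close> were far from all convex combinations of unit tensors, a separating functional would be
  represented by an operator \<open>T\<close> with \<open>\<beta> T \<ge> norm T + \<eta>\<close>.
\<close>

lemma tensor_span_approximation:
  assumes \<beta>: "\<beta> \<in> span (range (case_prod tensor))"
    and small: "\<And>T. T \<in> klinear \<Longrightarrow> \<bar>blinfun_apply \<beta> T\<bar> \<le> norm T" and \<eta>: "0 < \<eta>"
  obtains \<gamma> where "\<gamma> \<in> convex hull unit_tensors"
    "\<And>T. T \<in> klinear \<Longrightarrow> \<bar>blinfun_apply \<beta> T - blinfun_apply \<gamma> T\<bar> \<le> \<eta> * norm T"
proof (rule ccontr)
  note found = that
  assume no: "\<not> thesis"
  have far: "\<exists>T\<in>klinear. \<eta> * norm T < \<bar>blinfun_apply \<beta> T - blinfun_apply \<gamma> T\<bar>"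
    if "\<gamma> \<in> convex hull unit_tensors" for \<gamma>
    using no found[OF that] by (meson not_le)
  define E where "E = evaluation ` {T \<in> klinear. norm T \<le> 1}"
  have zero: "(0 :: 'a \<Rightarrow>\<^sub>L 'a) \<in> klinear" by (rule subspace_0[OF subspace_klinear])
  have E_ne: "E \<noteq> {}" using zero by (auto simp: E_def)
  have E_unit: "E \<subseteq> cball 0 1" using order_trans[OF norm_evaluation_le] by (auto simp: E_def)
  define p where "p = supp_fun E"
  have p: "sublinear p" unfolding p_def by (rule sublinear_supp_fun[OF E_ne E_unit])
  have p_upper: "blinfun_apply \<psi> T \<le> p \<psi>" if "T \<in> klinear" "norm T \<le> 1" for \<psi> T
    using supp_fun_upper[OF E_ne E_unit, of "evaluation T" \<psi>] that by (auto simp: E_def p_def)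
  have p_least: "p \<psi> \<le> a" if "\<And>T. T \<in> klinear \<Longrightarrow> norm T \<le> 1 \<Longrightarrow> blinfun_apply \<psi> T \<le> a" for \<psi> a
    unfolding p_def by (rule supp_fun_least[OF E_ne E_unit]) (use that in \<open>auto simp: E_def\<close>)
  have p_norm: "p \<psi> \<le> 1 * norm \<psi>" for \<psi> using supp_fun_norm[OF E_ne E_unit] by (simp add: p_def)
  define C where "C = (\<lambda>\<gamma>. \<beta> - \<gamma>) ` (convex hull unit_tensors)"
  have "convex C"
    using convex_translation[OF convex_negations[OF convex_convex_hull], of \<beta> unit_tensors]
    by (simp add: C_def image_image)
  moreover have "\<eta> \<le> p c" if c: "c \<in> C" for c
  proof -
    obtain \<gamma> where "\<gamma> \<in> convex hull unit_tensors" "c = \<beta> - \<gamma>" using c by (auto simp: C_def)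
    then obtain T where T: "T \<in> klinear" "\<eta> * norm T < \<bar>blinfun_apply c T\<bar>" using far by (auto simp: blinfun.diff_left)
    have "T \<noteq> 0" using T(2) by (auto simp: blinfun.zero_right)
    define S where "S = (sgn (blinfun_apply c T) / norm T) *\<^sub>R T"
    have "S \<in> klinear" unfolding S_def by (rule subspace_scale[OF subspace_klinear T(1)])
    moreover have "norm S \<le> 1" using \<open>T \<noteq> 0\<close> by (simp add: S_def abs_sgn_eq)
    moreover have "blinfun_apply c S = \<bar>blinfun_apply c T\<bar> / norm T"
      by (simp add: S_def blinfun.scaleR_right abs_sgn mult.commute)
    ultimately have "\<bar>blinfun_apply c T\<bar> / norm T \<le> p c" using p_upper by metis
    moreover have "\<eta> \<le> \<bar>blinfun_apply c T\<bar> / norm T" using T(2) \<open>T \<noteq> 0\<close> by (intro mult_imp_le_div_pos) auto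
    ultimately show ?thesis by simp
  qed
  ultimately obtain G where G: "linear G" "\<And>\<psi>. G \<psi> \<le> p \<psi>" "\<And>c. c \<in> C \<Longrightarrow> \<eta> \<le> G c"
    using mazur_orlicz[OF p] by metis
  have G_norm: "G \<psi> \<le> norm \<psi>" for \<psi> using order_trans[OF G(2) p_norm, of \<psi>] by simp
  \<comment> \<open>so \<open>G\<close> sees only the restriction to linear operators over \<open>'k\<close>\<close>
  have G_cong: "G \<psi> = G \<psi>'" if "\<And>T. T \<in> klinear \<Longrightarrow> blinfun_apply \<psi> T = blinfun_apply \<psi>' T" for \<psi> \<psi>'
  proof -
    have "p (\<psi> - \<psi>') \<le> 0" "p (\<psi>' - \<psi>) \<le> 0" by (auto intro!: p_least simp: blinfun.diff_left that)
    then have "G (\<psi> - \<psi>') \<le> 0" "G (\<psi>' - \<psi>) \<le> 0" using G(2) order_trans by blast+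
    then show ?thesis by (simp add: linear_diff[OF G(1)])
  qed
  have "\<exists>T\<in>klinear. \<forall>h x. G (tensor h x) = blinfun_apply h (blinfun_apply T x)"
  proof (rule klinear_operator_from_bilinear[of "\<lambda>h x. G (tensor h x)"])
    have "tensor (h + k) x = tensor h x + tensor k x" for h k and x :: 'a
      by (rule blinfun_eqI) (simp add: blinfun.add_left)
    then show "G (tensor (h + k) x) = G (tensor h x) + G (tensor k x)" for h k x by (simp add: linear_add[OF G(1)])
    have "tensor h (x + y) = tensor h x + tensor h y" for h and x y :: 'a
      by (rule blinfun_eqI) (simp add: blinfun.add_left blinfun.add_right)
    then show "G (tensor h (x + y)) = G (tensor h x) + G (tensor h y)" for h x y by (simp add: linear_add[OF G(1)])
    have "tensor (r *\<^sub>R h) x = r *\<^sub>R tensor h x" for r h and x :: 'a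
      by (rule blinfun_eqI) (simp add: blinfun.scaleR_left)
    then show "G (tensor (r *\<^sub>R h) x) = r * G (tensor h x)" for r h x by (simp add: linear_scale[OF G(1)])
    have "tensor h (r *\<^sub>R x) = r *\<^sub>R tensor h x" for r h and x :: 'a
      by (rule blinfun_eqI) (simp add: blinfun.scaleR_left blinfun.scaleR_right)
    then show "G (tensor h (r *\<^sub>R x)) = r * G (tensor h x)" for r h x by (simp add: linear_scale[OF G(1)])
    show "G (tensor h (smul c x)) = G (tensor (h o\<^sub>L Blinfun (smul c)) x)" for h c x
      by (rule G_cong) (simp add: klinear_def bounded_linear_Blinfun_apply[OF bounded_linear_smul])
    show "G (tensor h x) \<le> norm h * norm x" for h x by (rule order_trans[OF G_norm norm_tensor_le])
  qed
  then obtain T where T: "T \<in> klinear" "\<And>h x. G (tensor h x) = blinfun_apply h (blinfun_apply T x)" by blast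
  have G\<beta>: "G \<beta> = blinfun_apply \<beta> T"
    using \<beta>
  proof (induction rule: span_induct)
    case base
    show ?case
      by (auto simp: subspace_def linear_add[OF G(1)] linear_scale[OF G(1)] linear_0[OF G(1)] blinfun.add_left blinfun.scaleR_left)
  qed (use T(2) in auto)
  have le: "blinfun_apply h (blinfun_apply T x) \<le> blinfun_apply \<beta> T - \<eta>" if "norm h \<le> 1" "norm x \<le> 1" for h x
  proof -
    have "tensor h x \<in> convex hull unit_tensors" using that by (intro hull_inc) (auto simp: unit_tensors_def)
    then have "\<eta> \<le> G (\<beta> - tensor h x)" by (intro G(3)) (auto simp: C_def)
    then show ?thesis by (simp add: linear_diff[OF G(1)] G\<beta> T(2))
  qed
  have "norm T \<le> blinfun_apply \<beta> T - \<eta>"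
  proof (rule norm_blinfun_bound)
    show nn: "0 \<le> blinfun_apply \<beta> T - \<eta>" using le[of 0 0] by simp
    fix x show "norm (blinfun_apply T x) \<le> (blinfun_apply \<beta> T - \<eta>) * norm x"
    proof (cases "x = 0")
      case False
      obtain h :: "'a \<Rightarrow>\<^sub>L real" where h: "norm h \<le> 1" "h (blinfun_apply T x) = norm (blinfun_apply T x)"
        using exists_norming_functional .
      have "norm (blinfun_apply T x) / norm x \<le> blinfun_apply \<beta> T - \<eta>"
        using le[OF h(1), of "(1 / norm x) *\<^sub>R x"] False h(2) by (simp add: blinfun.scaleR_right)
      then show ?thesis using False by (simp add: pos_divide_le_eq)
    qed (simp add: blinfun.zero_right)
  qed
  then show False using small[OF T(1)] \<eta> by linarith
qed

text \<open>
  Successive approximation writes \<open>\<Phi>\<close> as the sum of \<open>2 (1/4)^n \<gamma> n\<close> with \<open>\<gamma> n\<close> in the hull of the unit tensors.  The vectors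
  seen by \<open>\<gamma> n\<close>, scaled by \<open>(1/2)^n\<close>, together form a compact set; half of the decay of the coefficients
  is spent on this scaling, and the other half keeps the series summable.
\<close>

lemma nuclear_continuity:
  fixes \<Phi> :: "('a \<Rightarrow>\<^sub>L 'a) \<Rightarrow>\<^sub>L real"
  assumes norm: "\<And>T. T \<in> klinear \<Longrightarrow> \<bar>blinfun_apply \<Phi> T\<bar> \<le> norm T"
    and approx: "\<And>\<epsilon>. 0 < \<epsilon> \<Longrightarrow> \<exists>\<beta>\<in>span (range (case_prod tensor)).
      \<forall>T\<in>klinear. \<bar>blinfun_apply \<Phi> T - blinfun_apply \<beta> T\<bar> \<le> \<epsilon> * norm T"
  obtains C where "compact C"
    "\<And>T \<epsilon>. T \<in> klinear \<Longrightarrow> (\<And>x. x \<in> C \<Longrightarrow> norm (blinfun_apply T x) \<le> \<epsilon>) \<Longrightarrow> \<bar>blinfun_apply \<Phi> T\<bar> \<le> 4 * \<epsilon>"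
proof -
  let ?W = "span (range (case_prod tensor)) :: (('a \<Rightarrow>\<^sub>L 'a) \<Rightarrow>\<^sub>L real) set"
  have "convex hull unit_tensors \<subseteq> ?W"
    by (intro hull_minimal subspace_imp_convex subspace_span) (auto simp: unit_tensors_def intro!: span_base)
  define P where "P n \<Psi> \<longleftrightarrow> (\<forall>T\<in>klinear. \<bar>blinfun_apply \<Psi> T\<bar> \<le> (1/4)^n * norm T) \<and>
    (\<forall>\<epsilon>>0. \<exists>\<beta>\<in>?W. \<forall>T\<in>klinear. \<bar>blinfun_apply \<Psi> T - blinfun_apply \<beta> T\<bar> \<le> \<epsilon> * norm T) \<and> (n = 0 \<longrightarrow> \<Psi> = \<Phi>)"
    for n :: nat and \<Psi> :: "('a \<Rightarrow>\<^sub>L 'a) \<Rightarrow>\<^sub>L real"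
  define R where "R n \<Psi> \<Psi>' \<longleftrightarrow> (\<exists>\<gamma>\<in>convex hull unit_tensors. \<Psi>' = \<Psi> - (2 * (1/4)^n) *\<^sub>R \<gamma>)"
    for n :: nat and \<Psi> \<Psi>' :: "('a \<Rightarrow>\<^sub>L 'a) \<Rightarrow>\<^sub>L real"
  have "\<exists>\<psi>. \<forall>n. P n (\<psi> n) \<and> R n (\<psi> n) (\<psi> (Suc n))"
  proof (rule dependent_nat_choice)
    show "\<exists>\<Psi>. P 0 \<Psi>" using norm approx by (auto simp: P_def)
  next
    fix \<Psi> n assume \<Psi>: "P n \<Psi>"
    define r :: real where "r = (1/4)^n"
    have r: "0 < r" by (simp add: r_def)
    obtain \<beta> where \<beta>: "\<beta> \<in> ?W" "\<And>T. T \<in> klinear \<Longrightarrow> \<bar>blinfun_apply \<Psi> T - blinfun_apply \<beta> T\<bar> \<le> r / 8 * norm T"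
      using \<Psi> r unfolding P_def by (metis divide_pos_pos zero_less_numeral)
    define \<beta>' where "\<beta>' = (1 / (2 * r)) *\<^sub>R \<beta>"
    have "\<beta>' \<in> ?W" unfolding \<beta>'_def using \<beta>(1) by (rule span_scale)
    moreover have "\<bar>blinfun_apply \<beta>' T\<bar> \<le> norm T" if T: "T \<in> klinear" for T
    proof -
      have "\<bar>blinfun_apply \<Psi> T\<bar> \<le> r * norm T" using \<Psi> T by (simp add: P_def r_def)
      moreover have "\<bar>blinfun_apply \<Psi> T - blinfun_apply \<beta> T\<bar> \<le> (r * norm T) / 8" using \<beta>(2)[OF T] by simp
      moreover have "0 \<le> r * norm T" using r by simp
      ultimately have "\<bar>blinfun_apply \<beta> T\<bar> \<le> 2 * (r * norm T)" by linarith
      then show ?thesis using r by (simp add: \<beta>'_def blinfun.scaleR_left abs_mult pos_divide_le_eq mult_ac)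
    qed
    ultimately obtain \<gamma> where \<gamma>: "\<gamma> \<in> convex hull unit_tensors"
      "\<And>T. T \<in> klinear \<Longrightarrow> \<bar>blinfun_apply \<beta>' T - blinfun_apply \<gamma> T\<bar> \<le> (1/16) * norm T"
      by (rule tensor_span_approximation[of \<beta>' "1/16"]) auto
    \<comment> \<open>the factor 2 absorbs the error of replacing \<open>\<Psi>\<close> by \<open>\<beta>\<close>, whose norm may exceed \<open>r\<close>\<close>
    define \<Psi>' where "\<Psi>' = \<Psi> - (2 * r) *\<^sub>R \<gamma>"
    have "\<bar>blinfun_apply \<Psi>' T\<bar> \<le> (1/4)^Suc n * norm T" if T: "T \<in> klinear" for T
    proof -
      have "blinfun_apply \<Psi>' T = (blinfun_apply \<Psi> T - blinfun_apply \<beta> T) + 2 * r * (blinfun_apply \<beta>' T - blinfun_apply \<gamma> T)"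
        using r by (simp add: \<Psi>'_def \<beta>'_def blinfun.diff_left blinfun.scaleR_left algebra_simps)
      also have "\<bar>\<dots>\<bar> \<le> r / 8 * norm T + 2 * r * ((1/16) * norm T)"
        using r by (intro order_trans[OF abs_triangle_ineq] add_mono \<beta>(2)[OF T]) (use \<gamma>(2)[OF T] r in \<open>simp add: abs_mult\<close>)
      also have "\<dots> = (1/4)^Suc n * norm T" by (simp add: r_def)
      finally show ?thesis .
    qed
    moreover have "\<exists>\<beta>\<in>?W. \<forall>T\<in>klinear. \<bar>blinfun_apply \<Psi>' T - blinfun_apply \<beta> T\<bar> \<le> \<epsilon> * norm T" if \<epsilon>: "0 < \<epsilon>" for \<epsilon>
    proof -
      obtain b where b: "b \<in> ?W" "\<forall>T\<in>klinear. \<bar>blinfun_apply \<Psi> T - blinfun_apply b T\<bar> \<le> \<epsilon> * norm T"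
        using \<Psi> \<epsilon> unfolding P_def by blast
      have "\<gamma> \<in> ?W" using \<gamma>(1) \<open>convex hull unit_tensors \<subseteq> ?W\<close> by blast
      then have "b - (2 * r) *\<^sub>R \<gamma> \<in> ?W" using b(1) by (intro span_diff span_scale)
      then show ?thesis using b(2) by (intro bexI) (auto simp: \<Psi>'_def blinfun.diff_left)
    qed
    ultimately have "P (Suc n) \<Psi>'" by (auto simp: P_def)
    moreover have "R n \<Psi> \<Psi>'" using \<gamma>(1) by (auto simp: R_def \<Psi>'_def r_def)
    ultimately show "\<exists>\<Psi>'. P (Suc n) \<Psi>' \<and> R n \<Psi> \<Psi>'" by blast
  qed
  then obtain \<psi> where \<psi>: "\<And>n. P n (\<psi> n)" "\<And>n. R n (\<psi> n) (\<psi> (Suc n))" by blast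
  have "\<forall>n. \<exists>\<gamma>. \<gamma> \<in> convex hull unit_tensors \<and> \<psi> (Suc n) = \<psi> n - (2 * (1/4)^n) *\<^sub>R \<gamma>"
    using \<psi>(2) by (auto simp: R_def)
  then obtain \<gamma> where \<gamma>: "\<And>n. \<gamma> n \<in> convex hull unit_tensors" "\<And>n. \<psi> (Suc n) = \<psi> n - (2 * (1/4)^n) *\<^sub>R \<gamma> n"
    by metis
  have "\<forall>n. \<exists>A. finite A \<and> A \<subseteq> cball 0 1 \<and>
    (\<forall>T \<epsilon>. (\<forall>x\<in>A. norm (blinfun_apply T x) \<le> \<epsilon>) \<longrightarrow> \<bar>blinfun_apply (\<gamma> n) T\<bar> \<le> \<epsilon>)"
    using hull_unit_tensors_finite_control[OF \<gamma>(1)] by blast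
  then obtain A where A: "\<And>n. finite (A n)" "\<And>n. A n \<subseteq> cball 0 1"
    "\<And>n T \<epsilon>. (\<And>x. x \<in> A n \<Longrightarrow> norm (blinfun_apply T x) \<le> \<epsilon>) \<Longrightarrow> \<bar>blinfun_apply (\<gamma> n) T\<bar> \<le> \<epsilon>"
    by metis
  define C where "C = insert 0 (\<Union>k. (\<lambda>x. (1/2)^k *\<^sub>R x) ` A k)"
  show ?thesis
  proof (rule that)
    show "compact C" unfolding C_def by (rule compact_scaled_finite_sets[OF A(1,2)])
    fix T \<epsilon> assume T: "T \<in> klinear" and C: "\<And>x. x \<in> C \<Longrightarrow> norm (blinfun_apply T x) \<le> \<epsilon>"
    have \<epsilon>: "0 \<le> \<epsilon>" using C[of 0] by (simp add: C_def blinfun.zero_right)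
    have \<gamma>T: "\<bar>blinfun_apply (\<gamma> n) T\<bar> \<le> 2^n * \<epsilon>" for n
    proof (rule A(3))
      fix x assume "x \<in> A n"
      then have "norm (blinfun_apply T ((1/2)^n *\<^sub>R x)) \<le> \<epsilon>" by (intro C) (auto simp: C_def)
      then have "(1/2)^n * norm (blinfun_apply T x) \<le> \<epsilon>" by (simp add: blinfun.scaleR_right norm_power)
      then have "2^n * ((1/2)^n * norm (blinfun_apply T x)) \<le> 2^n * \<epsilon>" by (rule mult_left_mono) simp
      moreover have "2^n * (1/2 :: real)^n = 1" by (simp add: power_mult_distrib[symmetric])
      ultimately show "norm (blinfun_apply T x) \<le> 2^n * \<epsilon>" by (simp add: mult.assoc[symmetric])
    qed
    have bound: "\<bar>blinfun_apply \<Phi> T\<bar> \<le> 4 * \<epsilon> * (1 - (1/2)^n) + \<bar>blinfun_apply (\<psi> n) T\<bar>" for n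
    proof (induction n)
      case 0
      have "\<psi> 0 = \<Phi>" using \<psi>(1)[of 0] by (simp add: P_def)
      then show ?case by simp
    next
      case (Suc n)
      have "blinfun_apply (\<psi> n) T = 2 * (1/4)^n * blinfun_apply (\<gamma> n) T + blinfun_apply (\<psi> (Suc n)) T"
        unfolding \<gamma>(2) by (simp add: blinfun.diff_left blinfun.scaleR_left)
      then have "\<bar>blinfun_apply (\<psi> n) T\<bar> \<le> 2 * (1/4)^n * \<bar>blinfun_apply (\<gamma> n) T\<bar> + \<bar>blinfun_apply (\<psi> (Suc n)) T\<bar>"
        using abs_triangle_ineq[of "2 * (1/4)^n * blinfun_apply (\<gamma> n) T" "blinfun_apply (\<psi> (Suc n)) T"]
        by (simp add: abs_mult)
      moreover have "2 * (1/4)^n * \<bar>blinfun_apply (\<gamma> n) T\<bar> \<le> 2 * (1/4)^n * (2^n * \<epsilon>)"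
        by (intro mult_left_mono \<gamma>T) simp
      moreover have "2 * (1/4 :: real)^n * (2^n * \<epsilon>) = 2 * (1/2)^n * \<epsilon>"
      proof -
        have "(1/4 :: real)^n * 2^n = (1/2)^n" by (simp add: power_mult_distrib[symmetric])
        then show ?thesis by (simp add: mult.assoc[symmetric])
      qed
      moreover have "4 * \<epsilon> * (1 - (1/2)^n) + 2 * (1/2)^n * \<epsilon> = 4 * \<epsilon> * (1 - (1/2)^Suc n)"
        by (simp add: algebra_simps)
      ultimately show ?case using Suc by linarith
    qed
    have "\<bar>blinfun_apply \<Phi> T\<bar> \<le> 4 * \<epsilon> + (1/4)^n * norm T" for n
    proof -
      have "\<bar>blinfun_apply (\<psi> n) T\<bar> \<le> (1/4)^n * norm T" using \<psi>(1)[of n] T by (simp add: P_def)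
      moreover have "4 * \<epsilon> * (1 - (1/2)^n) \<le> 4 * \<epsilon> * 1" using \<epsilon> by (intro mult_left_mono) auto
      ultimately show ?thesis using bound[of n] by linarith
    qed
    moreover have "(\<lambda>n. 4 * \<epsilon> + (1/4)^n * norm T) \<longlonglongrightarrow> 4 * \<epsilon> + 0 * norm T"
      by (intro tendsto_intros LIMSEQ_realpow_zero) auto
    ultimately show "\<bar>blinfun_apply \<Phi> T\<bar> \<le> 4 * \<epsilon>" using LIMSEQ_le_const[of _ "4 * \<epsilon>"] by simp
  qed
qed

section \<open>Compact operators and the contradiction\<close>

definition compact_klinear :: "('a \<Rightarrow>\<^sub>L 'a) set"
  where "compact_klinear = {K \<in> klinear. compact (closure (blinfun_apply K ` cball 0 1))}"

lemma convex_compact_klinear: "convex compact_klinear"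
proof (rule convexI)
  fix K L and a b :: real assume K: "K \<in> compact_klinear" and L: "L \<in> compact_klinear"
  let ?k = "closure (blinfun_apply K ` cball 0 1)" and ?l = "closure (blinfun_apply L ` cball 0 1)"
  let ?kl = "(\<lambda>(x, y). a *\<^sub>R x + b *\<^sub>R y) ` (?k \<times> ?l)"
  have comp: "compact ?kl"
    using K L by (intro compact_continuous_image compact_Times)
      (auto simp: compact_klinear_def case_prod_unfold intro!: continuous_intros)
  have "blinfun_apply (a *\<^sub>R K + b *\<^sub>R L) ` cball 0 1 \<subseteq> ?kl"
  proof
    fix z assume "z \<in> blinfun_apply (a *\<^sub>R K + b *\<^sub>R L) ` cball 0 1"
    then obtain x where x: "x \<in> cball 0 1" "z = a *\<^sub>R blinfun_apply K x + b *\<^sub>R blinfun_apply L x"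
      by (auto simp: blinfun.add_left blinfun.scaleR_left)
    then have "(blinfun_apply K x, blinfun_apply L x) \<in> ?k \<times> ?l" by (auto intro: subsetD[OF closure_subset])
    then show "z \<in> ?kl" unfolding x(2) by (rule rev_image_eqI) simp
  qed
  then have "closure (blinfun_apply (a *\<^sub>R K + b *\<^sub>R L) ` cball 0 1) \<subseteq> ?kl"
    by (rule closure_minimal[OF _ compact_imp_closed[OF comp]])
  then have "?kl \<inter> closure (blinfun_apply (a *\<^sub>R K + b *\<^sub>R L) ` cball 0 1)
      = closure (blinfun_apply (a *\<^sub>R K + b *\<^sub>R L) ` cball 0 1)" by blast
  then have "compact (closure (blinfun_apply (a *\<^sub>R K + b *\<^sub>R L) ` cball 0 1))"
    using compact_Int_closed[OF comp closed_closure] by metis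
  moreover have "a *\<^sub>R K + b *\<^sub>R L \<in> klinear"
    using K L by (intro subspace_add subspace_scale subspace_klinear) (auto simp: compact_klinear_def)
  ultimately show "a *\<^sub>R K + b *\<^sub>R L \<in> compact_klinear" by (simp add: compact_klinear_def)
qed

lemma compact_operator_klinear:
  assumes "compact_operator smul T"
  obtains K where "K \<in> compact_klinear" "blinfun_apply K = T"
proof -
  have lin: "T (x + y) = T x + T y" "T (smul c x) = smul c (T x)" for x y c
    using assms by (auto simp: compact_operator_def Vector_Spaces.linear_iff)
  have "bounded (T ` cball 0 1)"
    using assms by (auto simp: compact_operator_def intro: bounded_subset[OF compact_imp_bounded closure_subset])
  then obtain B where "\<forall>z\<in>T ` cball 0 1. norm z \<le> B" unfolding bounded_iff by blast
  then have B: "norm (T x) \<le> B" if "norm x \<le> 1" for x using that by auto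
  have sc: "T (r *\<^sub>R x) = r *\<^sub>R T x" for r x using lin(2)[of "of_real r" x] by (simp add: V.smul_of_real)
  have "norm (T x) \<le> norm x * B" for x
  proof (cases "x = 0")
    case True
    then show ?thesis using sc[of 0 0] by simp
  next
    case False
    then have "norm (T ((1 / norm x) *\<^sub>R x)) \<le> B" by (intro B) simp
    then show ?thesis using False by (simp add: sc pos_divide_le_eq mult.commute)
  qed
  then have bl: "bounded_linear T" using lin(1) sc by (intro bounded_linear_intro)
  have "Blinfun T \<in> compact_klinear"
    using assms lin by (simp add: compact_klinear_def klinear_def bounded_linear_Blinfun_apply[OF bl] compact_operator_def)
  then show ?thesis using that bounded_linear_Blinfun_apply[OF bl] by blast
qed

definition kernel_proj :: "'a \<Rightarrow>\<^sub>L 'a" where "kernel_proj = Blinfun (\<lambda>x. x - smul (f x) x0)"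

lemma kernel_proj_apply: "blinfun_apply kernel_proj x = x - smul (f x) x0"
  unfolding kernel_proj_def
  by (subst bounded_linear_Blinfun_apply)
    (intro bounded_linear_sub bounded_linear_ident
      bounded_linear_compose[OF bounded_linear_smul_left dual_bounded_linear[OF f_dual]], simp)

text \<open>
  Choose unit vectors in the kernel of \<open>f\<close>, each annihilated by the supporting functionals of the previous
  ones.  They are at mutual distance at least one, whereas a subsequence of their images under \<open>K\<close> is Cauchy; the difference of two
  of them does the job after normalisation.
\<close>

lemma compact_small_on_kernel:
  assumes inf: "\<nexists>B. finite_dimensional_vector_space smul B" and K: "K \<in> compact_klinear" and e: "0 < e"
  obtains y where "norm y = 1" "f y = 0" "norm (blinfun_apply K y) < e"
proof -
  define P where "P g n ys \<longleftrightarrow> norm (fst ys) = 1 \<and> f (fst ys) = 0 \<and> (fst ys, snd ys) \<in> state_pairs smul \<and>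
      (\<forall>z\<in>g ` {..<n}. snd z (fst ys) = 0)" for g :: "nat \<Rightarrow> 'a \<times> ('a \<Rightarrow> 'k)" and n :: nat and ys
  have "\<exists>g. \<forall>n. P g n (g n)"
  proof (rule dependent_wellorder_choice)
    fix r and g g' :: "nat \<Rightarrow> 'a \<times> ('a \<Rightarrow> 'k)" and n :: nat assume "\<And>m. m < n \<Longrightarrow> g m = g' m"
    then have "g ` {..<n} = g' ` {..<n}" by (intro image_cong) auto
    then show "P g n r = P g' n r" by (simp only: P_def)
  next
    fix n and g :: "nat \<Rightarrow> 'a \<times> ('a \<Rightarrow> 'k)" assume g: "\<And>m. m < n \<Longrightarrow> P g m (g m)"
    have "snd (g m) \<in> dual_space smul" if "m < n" for m
      using g[OF that] state_pairsD(2)[of "fst (g m)" "snd (g m)"] by (simp add: P_def)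
    then have "snd ` g ` {..<n} \<subseteq> dual_space smul" by auto
    then have "insert f (snd ` g ` {..<n}) \<subseteq> dual_space smul" using f_dual by simp
    then obtain y where y: "norm y = 1" "\<And>s. s \<in> insert f (snd ` g ` {..<n}) \<Longrightarrow> s y = 0"
      using common_kernel_nontrivial[OF inf, of "insert f (snd ` g ` {..<n})"] by auto
    obtain s where "(y, s) \<in> state_pairs smul" using exists_supporting_state[OF y(1)] .
    then have "P g n (y, s)" using y by (simp add: P_def)
    then show "\<exists>r. P g n r" by blast
  qed
  then obtain g where g: "\<And>n. P g n (g n)" by blast
  define y where "y n = fst (g n)" for n
  have y: "norm (y n) = 1" "f (y n) = 0" for n using g[of n] by (auto simp: P_def y_def)
  have sep: "1 \<le> norm (y m - y n)" if "m < n" for m n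
  proof -
    have s: "(y m, snd (g m)) \<in> state_pairs smul" using g[of m] by (simp add: P_def y_def)
    have "snd (g m) (y n) = 0" using g[of n] that by (auto simp: P_def y_def)
    moreover have "snd (g m) (y m - y n) = snd (g m) (y m) - snd (g m) (y n)"
      by (rule linear_diff[OF bounded_linear.linear[OF dual_bounded_linear[OF state_pairsD(2)[OF s]]]])
    ultimately have "snd (g m) (y m - y n) = 1" using state_pairsD(3)[OF s] by simp
    then show ?thesis using state_norm_le[OF s, of "y m - y n"] by simp
  qed
  have "seq_compact (closure (blinfun_apply K ` cball 0 1))"
    using K by (simp add: compact_klinear_def compact_eq_seq_compact_metric)
  moreover have "\<forall>n. blinfun_apply K (y n) \<in> closure (blinfun_apply K ` cball 0 1)"
    using y(1) by (auto intro!: subsetD[OF closure_subset] imageI)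
  ultimately obtain l r where r: "strict_mono (r :: nat \<Rightarrow> nat)" "((\<lambda>n. blinfun_apply K (y n)) \<circ> r) \<longlonglongrightarrow> l"
    by (metis seq_compactE)
  have "Cauchy ((\<lambda>n. blinfun_apply K (y n)) \<circ> r)" using r(2) by (rule LIMSEQ_imp_Cauchy)
  then obtain N where N: "\<forall>m\<ge>N. \<forall>n\<ge>N. norm (((\<lambda>n. blinfun_apply K (y n)) \<circ> r) m - ((\<lambda>n. blinfun_apply K (y n)) \<circ> r) n) < e"
    using CauchyD[OF _ e] by blast
  define z where "z = y (r N) - y (r (Suc N))"
  have "norm (blinfun_apply K (y (r N)) - blinfun_apply K (y (r (Suc N)))) < e" using N by (auto simp: o_def)
  then have Kz: "norm (blinfun_apply K z) < e" by (simp add: z_def blinfun.diff_right)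
  have z1: "1 \<le> norm z" unfolding z_def using r(1) by (intro sep) (simp add: strict_mono_def)
  have "f z = 0" by (simp add: z_def f_linear y)
  show ?thesis
  proof (rule that[of "(1 / norm z) *\<^sub>R z"])
    show "norm ((1 / norm z) *\<^sub>R z) = 1" using z1 by auto
    show "f ((1 / norm z) *\<^sub>R z) = 0" by (simp add: f_linear \<open>f z = 0\<close>)
    have "norm (blinfun_apply K ((1 / norm z) *\<^sub>R z)) = norm (blinfun_apply K z) / norm z" by (simp add: blinfun.scaleR_right)
    also have "\<dots> \<le> norm (blinfun_apply K z) / 1" using z1 by (intro divide_left_mono) auto
    finally show "norm (blinfun_apply K ((1 / norm z) *\<^sub>R z)) < e" using Kz by simp
  qed
qed

text \<open>
  Let \<open>y\<close> be a unit vector of the kernel of \<open>f\<close> with \<open>K y\<close> small, and let \<open>u = (x0 + t y) / 2\<close> have norm one,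
  with supporting functional \<open>s\<close>.  Then \<open>f u = 1/2\<close>, and \<open>u - w\<close> is the image of \<open>u\<close> with \<open>w = x0 / 2 + (t/2) K y\<close>
  of norm at most \<open>2/3\<close>; hence \<open>|s (u - w)| \<ge> 1 - 2/3\<close>.
\<close>

lemma identity_not_near_compact:
  assumes inf: "\<nexists>B. finite_dimensional_vector_space smul B" and K: "K \<in> compact_klinear"
  shows "\<exists>\<delta>\<in>num_funs. (1/2)^M / 6 \<le> blinfun_apply \<delta> (kernel_proj - (K o\<^sub>L kernel_proj))"
proof -
  obtain y where y: "norm y = 1" "f y = 0" "norm (blinfun_apply K y) < 1 / 9"
    using compact_small_on_kernel[OF inf K, of "1/9"] by auto
  have "\<exists>t\<ge>0. t \<le> 3 \<and> norm (x0 + t *\<^sub>R y) = 2"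
  proof (rule IVT')
    show "norm (x0 + 0 *\<^sub>R y) \<le> 2" by (simp add: norm_x0)
    show "2 \<le> norm (x0 + 3 *\<^sub>R y)"
      using norm_diff_ineq[of "3 *\<^sub>R y" x0] by (simp add: norm_x0 y add.commute)
    show "continuous_on {0..3} (\<lambda>t. norm (x0 + t *\<^sub>R y))" by (intro continuous_intros)
  qed simp
  then obtain t where t: "0 \<le> t" "t \<le> 3" "norm (x0 + t *\<^sub>R y) = 2" by blast
  define u where "u = (1/2) *\<^sub>R (x0 + t *\<^sub>R y)"
  have "norm u = 1" using t by (simp add: u_def)
  then obtain s where s: "(u, s) \<in> state_pairs smul" using exists_supporting_state by blast
  have fu: "f u = (1/2) *\<^sub>R 1" by (simp add: u_def f_linear f_x0 y)
  have Qu: "blinfun_apply kernel_proj u = (t / 2) *\<^sub>R y"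
    unfolding kernel_proj_apply fu by (simp add: u_def smul_scaleR_left scaleR_add_right)
  define w where "w = (1/2) *\<^sub>R x0 + (t / 2) *\<^sub>R blinfun_apply K y"
  have QKu: "blinfun_apply (kernel_proj - (K o\<^sub>L kernel_proj)) u = u - w"
    unfolding blinfun.diff_left blinfun_apply_blinfun_compose Qu
    by (simp add: w_def u_def scaleR_add_right blinfun.scaleR_right)
  have "norm w \<le> norm ((1/2) *\<^sub>R x0) + norm ((t / 2) *\<^sub>R blinfun_apply K y)" unfolding w_def by (rule norm_triangle_ineq)
  also have "\<dots> = 1/2 + t / 2 * norm (blinfun_apply K y)" using t by (simp add: norm_x0)
  also have "t / 2 * norm (blinfun_apply K y) \<le> 3 / 2 * (1 / 9)" using t y by (intro mult_mono) auto
  finally have w: "norm w \<le> 2/3" by simp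
  have "s (u - w) = s u - s w"
    by (rule linear_diff[OF bounded_linear.linear[OF dual_bounded_linear[OF state_pairsD(2)[OF s]]]])
  then have "norm (1 :: 'k) - norm (s w) \<le> norm (s (u - w))" using state_pairsD(3)[OF s] norm_triangle_ineq2 by metis
  then have "1/6 \<le> norm (s (u - w))" using state_norm_le[OF s, of w] w by simp
  moreover have "norm (f u ^ M) = (1/2)^M" by (simp add: fu norm_power)
  ultimately have "(1/2)^M * (1/6) \<le> norm (f u ^ M * s (blinfun_apply (kernel_proj - (K o\<^sub>L kernel_proj)) u))"
    unfolding QKu norm_mult by (intro mult_mono) auto
  moreover obtain \<delta> where "\<delta> \<in> num_funs"
    "blinfun_apply \<delta> (kernel_proj - (K o\<^sub>L kernel_proj)) = norm (f u ^ M * s (blinfun_apply (kernel_proj - (K o\<^sub>L kernel_proj)) u))" using num_funs_rotate[OF s] .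
  ultimately show ?thesis by (intro bexI[of _ \<delta>]) auto
qed

text \<open>
  Hahn-Banach provides a functional dominated by \<open>num_funs\<close> that is at least \<open>c\<close> on all operators
  \<open>Q - K Q\<close>, where \<open>Q\<close> is \<open>kernel_proj\<close>.  By James's theorem and reflexivity it is controlled by the
  behaviour of operators on a compact set \<open>Z\<close>, and the compact approximation property, applied to the
  image of \<open>Z\<close> under \<open>Q\<close>, makes \<open>Q - K Q\<close> uniformly small on \<open>Z\<close>.
\<close>

theorem finite_dimensional:
  assumes cap: "compact_approximation_property smul"
  shows "\<exists>B. finite_dimensional_vector_space smul B"
proof (rule ccontr)
  assume inf: "\<not> ?thesis"
  define c :: real where "c = (1/2)^M / 6"
  have c: "0 < c" by (simp add: c_def)
  have num_funs_unit: "num_funs \<subseteq> cball 0 1" using num_funs_norm by auto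
  have num_funs_ne: "num_funs \<noteq> {}" using num_funs_attained[OF subspace_0[OF subspace_klinear]] by auto
  define C where "C = (\<lambda>K. kernel_proj - (K o\<^sub>L kernel_proj)) ` compact_klinear"
  have "convex C"
  proof -
    have "linear (\<lambda>K :: 'a \<Rightarrow>\<^sub>L 'a. K o\<^sub>L kernel_proj)"
      by (rule bounded_linear.linear[OF bounded_bilinear.bounded_linear_left[OF bounded_bilinear_blinfun_compose]])
    then have "convex ((\<lambda>K. K o\<^sub>L kernel_proj) ` compact_klinear)" using convex_compact_klinear by (rule convex_linear_image)
    from convex_translation[OF convex_negations[OF this], of kernel_proj] show ?thesis by (simp add: C_def image_image)
  qed
  moreover have "c \<le> supp_fun num_funs T" if T: "T \<in> C" for T
  proof -
    obtain K where K: "K \<in> compact_klinear" "T = kernel_proj - (K o\<^sub>L kernel_proj)" using T by (auto simp: C_def)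
    obtain \<delta> where "\<delta> \<in> num_funs" "c \<le> blinfun_apply \<delta> T"
      using identity_not_near_compact[OF inf K(1)] unfolding c_def K(2) by blast
    then show ?thesis using supp_fun_upper[OF num_funs_ne num_funs_unit, of \<delta> T] by linarith
  qed
  ultimately obtain G where G: "linear G" "\<And>T. G T \<le> supp_fun num_funs T" "\<And>T. T \<in> C \<Longrightarrow> c \<le> G T"
    using mazur_orlicz[OF sublinear_supp_fun[OF num_funs_ne num_funs_unit]] by metis
  have G_le: "G T \<le> 1 * norm T" for T using order_trans[OF G(2) supp_fun_norm[OF num_funs_ne num_funs_unit]] by simp
  have bl: "bounded_linear G" by (rule linear_le_norm_imp_bounded(1)[OF G(1) G_le])
  define \<Phi> where "\<Phi> = Blinfun G"
  have \<Phi>: "blinfun_apply \<Phi> T = G T" for T by (simp add: \<Phi>_def bounded_linear_Blinfun_apply[OF bl])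
  have dom: "\<exists>\<delta>\<in>num_funs. G T \<le> blinfun_apply \<delta> T" if T: "T \<in> klinear" for T
  proof -
    obtain \<delta> where \<delta>: "\<delta> \<in> num_funs" "\<forall>\<delta>'\<in>num_funs. blinfun_apply \<delta>' T \<le> blinfun_apply \<delta> T" using num_funs_attained[OF T] by blast
    then have "supp_fun num_funs T \<le> blinfun_apply \<delta> T" by (intro supp_fun_least[OF num_funs_ne num_funs_unit]) auto
    then show ?thesis using \<delta>(1) G(2)[of T] by (intro bexI[of _ \<delta>]) auto
  qed
  have num_funs_W: "span num_funs \<subseteq> span (range (case_prod tensor))" by (rule span_mono) (auto simp: num_funs_def)
  have approx: "\<exists>\<beta>\<in>span (range (case_prod tensor)). \<forall>T\<in>klinear. \<bar>blinfun_apply \<Phi> T - blinfun_apply \<beta> T\<bar> \<le> \<epsilon> * norm T"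
    if "0 < \<epsilon>" for \<epsilon>
    unfolding \<Phi>
    using james_attainment[OF subspace_klinear closed_klinear num_funs_norm num_funs_symmetric num_funs_attained klinear_cluster G(1) dom that] num_funs_W
    by blast
  have "\<bar>blinfun_apply \<Phi> T\<bar> \<le> norm T" for T
    unfolding \<Phi> using linear_le_norm_imp_bounded(2)[OF G(1) G_le, of T] by simp
  then obtain Z where Z: "compact Z"
    "\<And>T \<epsilon>. T \<in> klinear \<Longrightarrow> (\<And>x. x \<in> Z \<Longrightarrow> norm (blinfun_apply T x) \<le> \<epsilon>) \<Longrightarrow> \<bar>blinfun_apply \<Phi> T\<bar> \<le> 4 * \<epsilon>"
    by (rule nuclear_continuity[OF _ approx]) auto
  have "compact (blinfun_apply kernel_proj ` Z)"
    by (intro compact_continuous_image linear_continuous_on blinfun.bounded_linear_right Z(1))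
  moreover have "0 < c / 8" using c by simp
  ultimately obtain T where T: "compact_operator smul T" "\<forall>x\<in>blinfun_apply kernel_proj ` Z. norm (T x - x) \<le> c / 8"
    using cap unfolding compact_approximation_property_def by blast
  obtain K where K: "K \<in> compact_klinear" "blinfun_apply K = T" using compact_operator_klinear[OF T(1)] .
  have "kernel_proj - (K o\<^sub>L kernel_proj) \<in> klinear"
    using K(1) by (auto simp: klinear_def compact_klinear_def blinfun.diff_left kernel_proj_apply f_linear
        V.scale_right_diff_distrib blinfun.diff_right)
  then have "\<bar>blinfun_apply \<Phi> (kernel_proj - (K o\<^sub>L kernel_proj))\<bar> \<le> 4 * (c / 8)"
    by (rule Z(2)) (use T(2) K(2) in \<open>auto simp: blinfun.diff_left norm_minus_commute\<close>)
  moreover have "c \<le> blinfun_apply \<Phi> (kernel_proj - (K o\<^sub>L kernel_proj))" unfolding \<Phi> using K(1) by (intro G(3)) (auto simp: C_def)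
  ultimately show False using c by simp
qed

end

context scalar_banach
begin

theorem finite_dimensional_if_all_attain:
  assumes N: "1 \<le> N" and cap: "compact_approximation_property smul"
    and nra: "homogeneous_polynomials smul N = NRA smul N"
  shows "\<exists>B. finite_dimensional_vector_space smul B"
proof (cases "\<exists>x :: 'a. x \<noteq> 0")
  case False
  then have "V.span {} = UNIV" by (auto simp: V.span_empty)
  then show ?thesis using finite_dimensional_if_finite_spanning[of "{}"] by simp
next
  case True
  then obtain x :: 'a where "x \<noteq> 0" by blast
  then have "norm ((1 / norm x) *\<^sub>R x) = 1" by simp
  then obtain f where f: "((1 / norm x) *\<^sub>R x, f) \<in> state_pairs smul" using exists_supporting_state by blast
  interpret attaining smul re "(1 / norm x) *\<^sub>R x" f "N - 1"
  proof
    fix T assume T: "T \<in> klinear"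
    show "\<exists>u s. (u, s) \<in> state_pairs smul \<and> (\<forall>u' s'. (u', s') \<in> state_pairs smul \<longrightarrow>
        norm (f u' ^ (N - 1) * s' (blinfun_apply T u')) \<le> norm (f u ^ (N - 1) * s (blinfun_apply T u)))"
      by (rule attaining_state[OF N nra f T]) blast
  qed (rule f)
  show ?thesis by (rule finite_dimensional[OF cap])
qed

end

section \<open>Real and complex scalars\<close>

lemma scalar_banach_real: "scalar_banach ((*\<^sub>R) :: real \<Rightarrow> 'a::banach \<Rightarrow> 'a) (\<lambda>x. x)"
proof (rule scalar_banach.intro)
  show "normed_space_over ((*\<^sub>R) :: real \<Rightarrow> 'a \<Rightarrow> 'a)" by (rule normed_space_over_scaleR)
  show "\<exists>\<omega>::real. norm \<omega> = 1 \<and> \<omega> * c = norm c" for c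
    by (rule exI[of _ "if c < 0 then -1 else 1"]) auto
  show "\<exists>g. (\<forall>x y. g (x + y) = g x + g y) \<and> (\<forall>c x. g (c *\<^sub>R x) = c * g x) \<and> (\<forall>x. g x = h x)"
    if "bounded_linear h" for h :: "'a \<Rightarrow> real"
    using that linear_add linear_scale bounded_linear.linear
    by (intro exI[of _ h]) (auto simp: linear_add linear_scale bounded_linear.linear)
qed auto

lemma scalar_banach_complex:
  fixes smul :: "complex \<Rightarrow> 'a::banach \<Rightarrow> 'a"
  assumes "normed_space_over smul"
  shows "scalar_banach smul Re"
proof (rule scalar_banach.intro)
  interpret V: normed_space_over smul by (rule assms)
  show "normed_space_over smul" by (rule assms)
  show "bounded_linear Re" by (rule bounded_linear_Re)
  show "Re c \<le> norm c" for c by (rule complex_Re_le_cmod)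
  show "\<exists>\<omega>. norm \<omega> = 1 \<and> Re (\<omega> * c) = norm c" for c
  proof (cases "c = 0")
    case True
    then show ?thesis by (intro exI[of _ 1]) simp
  next
    case False
    have "cnj (sgn c) * c = complex_of_real (norm c)"
      using False by (simp add: sgn_eq complex_norm_square[symmetric] mult.commute power2_eq_square)
    then show ?thesis using False by (intro exI[of _ "cnj (sgn c)"]) (simp add: norm_sgn)
  qed
  show "c = 1" if "Re c = 1" "norm c \<le> 1" for c
  proof -
    have "(Re c)\<^sup>2 + (Im c)\<^sup>2 \<le> 1" using that(2) by (simp add: cmod_def)
    then show ?thesis using that(1) by (auto simp: complex_eq_iff)
  qed
  show "\<exists>g. (\<forall>x y. g (x + y) = g x + g y) \<and> (\<forall>c x. g (smul c x) = c * g x) \<and> (\<forall>x. Re (g x) = h x)"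
    if "bounded_linear h" for h :: "'a \<Rightarrow> real"
  proof (intro exI conjI allI)
    define g where "g x = Complex (h x) (- h (smul \<i> x))" for x
    have h: "h (x + y) = h x + h y" "h (r *\<^sub>R x) = r * h x" for x y r
      using bounded_linear.linear[OF that] by (simp_all add: linear_add linear_scale)
    show "g (x + y) = g x + g y" for x y by (simp add: g_def h V.scale_right_distrib complex_eq_iff)
    have smul: "h (smul c x) = Re c * h x + Im c * h (smul \<i> x)" for c x
    proof -
      have "smul c x = smul (of_real (Re c)) x + smul (of_real (Im c)) (smul \<i> x)"
        by (simp add: V.scale_left_distrib[symmetric] complex_eq_iff mult.commute)
      then show ?thesis by (simp only: V.smul_of_real h)
    qed
    have "h (smul \<i> (smul c x)) = Re c * h (smul \<i> x) - Im c * h x" for c x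
      using smul[of "\<i> * c" x] by simp
    then show "g (smul c x) = c * g x" for c x using smul[of c x] by (simp add: g_def complex_eq_iff)
    show "Re (g x) = h x" for x by (simp add: g_def)
  qed
qed

theorem theorem3p5:
  fixes N :: nat
    and scaleC :: "complex \<Rightarrow> 'b::banach \<Rightarrow> 'b"
  assumes "1 \<le> N"
  shows
    "(compact_approximation_property ((*\<^sub>R) :: real \<Rightarrow> 'a::banach \<Rightarrow> 'a) \<longrightarrow>
      homogeneous_polynomials ((*\<^sub>R) :: real \<Rightarrow> 'a \<Rightarrow> 'a) N = NRA (*\<^sub>R) N \<longrightarrow>
      (\<exists>B. finite_dimensional_vector_space ((*\<^sub>R) :: real \<Rightarrow> 'a \<Rightarrow> 'a) B)) \<and>
     (normed_space_over scaleC \<longrightarrow>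
      compact_approximation_property scaleC \<longrightarrow>
      homogeneous_polynomials scaleC N = NRA scaleC N \<longrightarrow>
      (\<exists>B. finite_dimensional_vector_space scaleC B))"
  using scalar_banach.finite_dimensional_if_all_attain[OF scalar_banach_real assms]
    scalar_banach.finite_dimensional_if_all_attain[OF scalar_banach_complex assms]
  by blast

end
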